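(* Let $\nu,\beta\in(0,1)$ and $\lambda>0$. Consider the generalized Yule model in which genera appear following the mixed Poisson process up to a time transformation $M$ with parameter $\nu$, and the number of species in each genus evolves as an independent copy of the time-fractional pure birth process $\mathcal{Y}$ with linear rates $\lambda_k=\lambda k$, $k\ge1$, and fractional exponent $\beta$. For $t>0$ let ${}_t\mathfrak{N}$ be the number of species at time $t$ in a genus chosen uniformly at random among those that have appeared up to time $t$. Then, for every $t>0$ and every integer $k\ge 1$, $$\mathbb{P}({}_t\mathfrak{N}=k)=\Gamma(\nu+1)\sum_{j=1}^{k}\binom{k-1}{j-1}(-1)^{j-1}E_{\beta,\nu+1}(-\lambda j t^\beta).$$
   Context: Mittag-Leffler function: $E_{\beta,\delta}(z)=\sum_{r=0}^\infty \frac{z^r}{\Gamma(\beta r+\delta)}$. Genera process $M$ with parameter $\nu\in(0,1)$: $M_t=N_{Wq(t)}$, where $N$ is a unit-rate homogeneous Poisson process, $q(t)=\mu t^\nu/\Gamma(1+\nu)$ for some constant $\mu>0$, and $W$ is a non-negative random variable independent of $N$, with density $f_W(w)=\frac{1}{\Gamma(1+\nu)}\phi\left(-\nu,1-\nu;\frac{-w}{\Gamma(1+\nu)}\right)$, $w>0$, $\phi(\alpha,\beta;z)=\sum_{r\ge0}\frac{z^r}{r!\,\Gamma(\alpha r+\beta)}$ being the Wright function. The jump times of $M$ are the times of appearance of genera. Species process $\mathcal{Y}$: let $(Y_t)_{t\ge0}$ be the pure birth process on $\{1,2,\dots\}$ with $Y_0=1$ and birth rate $\lambda k$ in state $k$.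 Let $(D_t)_{t\ge0}$ be an independent $\beta$-stable subordinator with Lévy measure $\frac{\beta}{\Gamma(1-\beta)}x^{-1-\beta}dx$ on $(0,\infty)$ and no drift, and $E_t=\inf\{s:D_s>t\}$. Then $\mathcal{Y}_t=Y_{E_t}$. Generalized Yule model: genera appear at the jump times of $M$; at the appearance time $T_i$ of the $i$-th genus a copy $\mathcal{Y}^{(i)}$ of $\mathcal{Y}$ starts (from a single species), so that the number of species in genus $i$ at time $t\ge T_i$ is $\mathcal{Y}^{(i)}_{t-T_i}$; the copies are independent of one another and of $M$. The random variable ${}_t\mathfrak{N}$ is defined conditionally on $M_t\ge1$: given $M_t\geq 1$, an index is chosen uniformly at random in $\{1,\dots,M_t\}$ (independently of everything else given $M_t$) and ${}_t\mathfrak{N}$ is the number of species at time $t$ in that genus; $\mathbb{P}({}_t\mathfrak{N}=k)$ is the corresponding conditional probability. *)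

theory Defs
  imports "HOL-Probability.Probability"
begin

section \<open>Special functions\<close>

definition mittag_leffler :: "real \<Rightarrow> real \<Rightarrow> real \<Rightarrow> real" where
  "mittag_leffler \<beta> \<delta> z = (\<Sum>r. z ^ r / Gamma (\<beta> * real r + \<delta>))"

text \<open>For negative \<open>\<alpha>\<close> the argument of the Gamma function may hit a pole; \<^const>\<open>rGamma\<close>
  is the entire function \<open>1 / \<Gamma>\<close>, which vanishes there.\<close>

definition wright :: "real \<Rightarrow> real \<Rightarrow> real \<Rightarrow> real" where
  "wright \<alpha> \<beta> z = (\<Sum>r. z ^ r / fact r * rGamma (\<alpha> * real r + \<beta>))"


section \<open>Processes indexed by time\<close>

text \<open>Throughout, a process is a function \<open>X\<close> with \<open>X t \<omega>\<close> its value at time \<open>t\<close>. Only times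
  \<open>t \<ge> 0\<close> and outcomes \<open>\<omega> \<in> space M\<close> matter.\<close>

definition process_events ::
  "'a measure \<Rightarrow> 'b measure \<Rightarrow> (real \<Rightarrow> 'a \<Rightarrow> 'b) \<Rightarrow> 'a set set" where
  "process_events M S X =
     sigma_sets (space M) (\<Union>t\<in>{0..}. sets (vimage_algebra (space M) (X t) S))"

text \<open>A finite set of times is covered by taking \<open>\<tau>\<close> eventually constant.\<close>

definition indep_increments :: "'a measure \<Rightarrow> (real \<Rightarrow> 'a \<Rightarrow> real) \<Rightarrow> bool" where
  "indep_increments M X \<longleftrightarrow>
     (\<forall>\<tau> :: nat \<Rightarrow> real. 0 \<le> \<tau> 0 \<longrightarrow> mono \<tau> \<longrightarrow>
        prob_space.indep_vars M (\<lambda>_. borel) (\<lambda>i \<omega>. X (\<tau> (Suc i)) \<omega> - X (\<tau> i) \<omega>) UNIV)"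

definition passage_time :: "(real \<Rightarrow> 'a \<Rightarrow> nat) \<Rightarrow> nat \<Rightarrow> 'a \<Rightarrow> real" where
  "passage_time X i \<omega> = Inf {s. 0 \<le> s \<and> i \<le> X s \<omega>}"


section \<open>The genera process\<close>

definition poisson_process :: "'a measure \<Rightarrow> real \<Rightarrow> (real \<Rightarrow> 'a \<Rightarrow> nat) \<Rightarrow> bool" where
  "poisson_process M \<rho> N \<longleftrightarrow>
     (\<forall>t\<ge>0. N t \<in> measurable M (count_space UNIV)) \<and>
     (\<forall>\<omega>\<in>space M. N 0 \<omega> = 0 \<and> mono_on {0..} (\<lambda>t. N t \<omega>) \<and>
        (\<forall>t\<ge>0. continuous (at_right t) (\<lambda>s. N s \<omega>))) \<and>
     indep_increments M (\<lambda>t \<omega>. real (N t \<omega>)) \<and>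
     (\<forall>s t. 0 \<le> s \<longrightarrow> s < t \<longrightarrow>
        distr M (count_space UNIV) (\<lambda>\<omega>. N t \<omega> - N s \<omega>) = measure_pmf (poisson_pmf (\<rho> * (t - s))))"

definition mixing_density :: "real \<Rightarrow> real \<Rightarrow> real" where
  "mixing_density \<nu> w =
     (if 0 < w then 1 / Gamma (1 + \<nu>) * wright (- \<nu>) (1 - \<nu>) (- w / Gamma (1 + \<nu>)) else 0)"

definition genera_clock :: "real \<Rightarrow> real \<Rightarrow> real \<Rightarrow> real" where
  "genera_clock \<nu> \<mu> t = \<mu> * t powr \<nu> / Gamma (1 + \<nu>)"

definition genera_process :: "'a measure \<Rightarrow> real \<Rightarrow> real \<Rightarrow> (real \<Rightarrow> 'a \<Rightarrow> nat) \<Rightarrow> bool" where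
  "genera_process M \<nu> \<mu> G \<longleftrightarrow>
     (\<exists>N W.
        poisson_process M 1 N \<and>
        distributed M lborel W (\<lambda>w. ennreal (mixing_density \<nu> w)) \<and>
        (\<forall>\<omega>\<in>space M. 0 \<le> W \<omega>) \<and>
        prob_space.indep_set M
          (process_events M (count_space UNIV) N) (sets (vimage_algebra (space M) W borel)) \<and>
        (\<forall>t\<ge>0. \<forall>\<omega>\<in>space M. G t \<omega> = N (W \<omega> * genera_clock \<nu> \<mu> t) \<omega>))"


section \<open>The species process\<close>

text \<open>Pure birth process started at \<open>1\<close>, with birth rate \<open>r k\<close> in state \<open>k\<close>, in its description by
  holding times: \<open>S k\<close> is the exponential time spent in state \<open>k\<close>, and the process is above \<open>k\<close>
  from time \<open>S 1 + \<dots> + S k\<close> on. At \<open>t = 0\<close> this gives the value \<open>1\<close> because \<open>S 1 > 0\<close>.\<close>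

definition pure_birth_process ::
  "'a measure \<Rightarrow> (nat \<Rightarrow> real) \<Rightarrow> (real \<Rightarrow> 'a \<Rightarrow> nat) \<Rightarrow> bool" where
  "pure_birth_process M r Y \<longleftrightarrow>
     (\<exists>S :: nat \<Rightarrow> 'a \<Rightarrow> real.
        prob_space.indep_vars M (\<lambda>_. borel) S {1..} \<and>
        (\<forall>k\<ge>1. distributed M lborel (S k) (\<lambda>x. ennreal (exponential_density (r k) x)) \<and>
                (\<forall>\<omega>\<in>space M. 0 < S k \<omega>)) \<and>
        (\<forall>t\<ge>0. \<forall>\<omega>\<in>space M. \<forall>k. k < Y t \<omega> \<longleftrightarrow> (\<Sum>i=1..k. S i \<omega>) \<le> t))"

text \<open>A subordinator with drift \<open>d\<close> and Levy measure \<open>\<Lambda>\<close>, the latter two entering through the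
  Levy-Khintchine formula for the Laplace exponent.\<close>

definition subordinator ::
  "'a measure \<Rightarrow> real \<Rightarrow> real measure \<Rightarrow> (real \<Rightarrow> 'a \<Rightarrow> real) \<Rightarrow> bool" where
  "subordinator M d \<Lambda> D \<longleftrightarrow>
     0 \<le> d \<and> sets \<Lambda> = sets borel \<and> (AE x in \<Lambda>. 0 < x) \<and> integrable \<Lambda> (\<lambda>x. min 1 x) \<and>
     (\<forall>t\<ge>0. D t \<in> borel_measurable M) \<and>
     (\<forall>\<omega>\<in>space M. D 0 \<omega> = 0 \<and> mono_on {0..} (\<lambda>t. D t \<omega>) \<and>
        (\<forall>t\<ge>0. continuous (at_right t) (\<lambda>s. D s \<omega>))) \<and>
     indep_increments M D \<and>
     (\<forall>s\<ge>0. \<forall>t\<ge>0. distr M borel (\<lambda>\<omega>. D (s + t) \<omega> - D s \<omega>) = distr M borel (D t)) \<and>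
     (\<forall>t\<ge>0. \<forall>u\<ge>0. (\<integral>\<omega>. exp (- u * D t \<omega>) \<partial>M) =
        exp (- t * (d * u + (\<integral>x. 1 - exp (- u * x) \<partial>\<Lambda>))))"

definition stable_levy_measure :: "real \<Rightarrow> real measure" where
  "stable_levy_measure \<beta> =
     density lborel
       (\<lambda>x. ennreal (if 0 < x then \<beta> / Gamma (1 - \<beta>) * x powr (- 1 - \<beta>) else 0))"

text \<open>For the stable subordinator the set is nonempty for all \<open>t\<close>, almost surely.\<close>

definition inverse_process :: "(real \<Rightarrow> 'a \<Rightarrow> real) \<Rightarrow> real \<Rightarrow> 'a \<Rightarrow> real" where
  "inverse_process D t \<omega> = Inf {s. 0 \<le> s \<and> t < D s \<omega>}"

definition fractional_birth_process ::
  "'a measure \<Rightarrow> real \<Rightarrow> (nat \<Rightarrow> real) \<Rightarrow> (real \<Rightarrow> 'a \<Rightarrow> nat) \<Rightarrow> bool" where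
  "fractional_birth_process M \<beta> r X \<longleftrightarrow>
     (\<exists>Y D.
        pure_birth_process M r Y \<and>
        subordinator M 0 (stable_levy_measure \<beta>) D \<and>
        prob_space.indep_set M
          (process_events M (count_space UNIV) Y) (process_events M borel D) \<and>
        (\<forall>t\<ge>0. \<forall>\<omega>\<in>space M. X t \<omega> = Y (inverse_process D t \<omega>) \<omega>))"


section \<open>The generalized Yule model\<close>

text \<open>\<open>G\<close> counts the genera and \<open>X i\<close> is the number of species of the \<open>i\<close>-th genus (\<open>i \<ge> 1\<close>) as a
  function of its age. In the joint independence of \<open>G, X 1, X 2, \<dots>\<close> the index \<open>0\<close> stands
  for \<open>G\<close>.\<close>

definition yule_model ::
  "'a measure \<Rightarrow> real \<Rightarrow> real \<Rightarrow> real \<Rightarrow> real \<Rightarrow>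
     (real \<Rightarrow> 'a \<Rightarrow> nat) \<Rightarrow> (nat \<Rightarrow> real \<Rightarrow> 'a \<Rightarrow> nat) \<Rightarrow> bool" where
  "yule_model M \<nu> \<mu> \<beta> l G X \<longleftrightarrow>
     genera_process M \<nu> \<mu> G \<and>
     (\<forall>i\<ge>1. fractional_birth_process M \<beta> (\<lambda>k. l * real k) (X i)) \<and>
     prob_space.indep_sets M
       (\<lambda>i. process_events M (count_space UNIV) (if i = 0 then G else X i)) UNIV"

definition yule_events ::
  "'a measure \<Rightarrow> (real \<Rightarrow> 'a \<Rightarrow> nat) \<Rightarrow> (nat \<Rightarrow> real \<Rightarrow> 'a \<Rightarrow> nat) \<Rightarrow> 'a set set" where
  "yule_events M G X =
     sigma_sets (space M)
       (process_events M (count_space UNIV) G \<union>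
        (\<Union>i\<in>{1..}. process_events M (count_space UNIV) (X i)))"

text \<open>Given \<open>n = m \<ge> 1\<close>, the index \<open>J\<close> is uniform on \<open>{1..m}\<close> and independent of the events
  in \<open>\<A>\<close>.\<close>

definition uniform_index ::
  "'a measure \<Rightarrow> 'a set set \<Rightarrow> ('a \<Rightarrow> nat) \<Rightarrow> ('a \<Rightarrow> nat) \<Rightarrow> bool" where
  "uniform_index M \<A> n J \<longleftrightarrow>
     J \<in> measurable M (count_space UNIV) \<and>
     (\<forall>\<omega>\<in>space M. 1 \<le> n \<omega> \<longrightarrow> J \<omega> \<in> {1..n \<omega>}) \<and>
     (\<forall>m\<ge>1. \<forall>i\<in>{1..m}. \<forall>A\<in>\<A>.
        \<P>(\<omega> in M. J \<omega> = i \<and> \<omega> \<in> A \<bar> n \<omega> = m) = 1 / real m * \<P>(\<omega> in M. \<omega> \<in> A \<bar> n \<omega> = m))"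

definition species_in_genus ::
  "(real \<Rightarrow> 'a \<Rightarrow> nat) \<Rightarrow> (nat \<Rightarrow> real \<Rightarrow> 'a \<Rightarrow> nat) \<Rightarrow> real \<Rightarrow> nat \<Rightarrow> 'a \<Rightarrow> nat" where
  "species_in_genus G X t i \<omega> = X i (t - passage_time G i \<omega>) \<omega>"

end

theory Submission
  imports Defs
begin

text \<open>
  Given the mixing variable \<open>W\<close>, the genera appear as a Poisson process in the clock \<open>t powr \<nu>\<close>, so
  binomial thinning gives \<open>E[G s; G t = m] = (s / t) powr \<nu> * m * P(G t = m)\<close>, whatever the law of
  \<open>W\<close>. Hence the birth time of a uniformly chosen genus has distribution function
  \<open>(s / t) powr \<nu>\<close> on \<open>[0, t]\<close>, and its age is independent of its species process. The density of
  \<open>W\<close> is needed only to exclude \<open>W = 0\<close>, which makes the conditioning event non-null.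

  The Yule process has the geometric tail \<open>P(Y s > k) = (1 - exp (- l * s)) ^ k\<close>. Evaluated at the
  inverse stable subordinator \<open>E s\<close> this leaves the quantities \<open>E[exp (- \<theta> * E s)]\<close>. Their Laplace
  transform in \<open>s\<close> is \<open>u powr (\<beta> - 1) / (u powr \<beta> + \<theta>)\<close>, which is also that of the Mittag-Leffler
  function \<open>mittag_leffler \<beta> 1 (- \<theta> * s powr \<beta>)\<close>. Integrating the latter against the law of the age
  turns each term of the series into a Beta integral, and this shifts the second index to
  \<open>\<nu> + 1\<close>.
\<close>

text \<open>A process is read at a random time in three places: \<open>Y\<close> at the inverse
  subordinator, \<open>N\<close> at a multiple of \<open>W\<close>, and the chosen
  \<open>X i\<close> at its age. Independence is given between generated sigma-algebras, and joint
  measurability in time and outcome is not part of the model.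
  \<open>prob_at_independent_time\<close> therefore asks only for right-constant paths and for
  product formulas on the events \<open>R < a\<close>. The age makes sense only on
  \<open>1 \<le> G t\<close>, so its product formulas are proved under the conditional measure, by
  summing over the values of \<open>J\<close>.

  The law of the birth time comes from a count: the chosen genus is born by time \<open>c\<close>
  iff \<open>J \<le> G c\<close>, and for \<open>J\<close> uniform on \<open>{1..m}\<close> this has
  conditional probability \<open>G c / m\<close>. Only the mean of \<open>G c\<close> given
  \<open>G t = m\<close> enters, and in it \<open>W\<close> cancels because the two clock values are
  compared through their ratio.

  Termwise integration of the Mittag-Leffler series gives its Laplace transform at \<open>u\<close>
  only when \<open>\<theta> < u powr \<beta>\<close>. Uniqueness must therefore be drawn from large
  frequencies alone; a factor \<open>exp (- c * s)\<close> with large \<open>c\<close> shifts these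
  to \<open>0, 1, 2, ...\<close>.\<close>

section \<open>Termwise integration of a series\<close>

text \<open>Since each \<open>f r\<close> is nonnegative, the norms of the terms are
  \<open>\<bar>a r\<bar> * f r\<close> and integrate to \<open>\<bar>a r\<bar> * c r\<close>, so
  absolute convergence is checked on explicit series. It serves the Laplace transform, the Beta
  convolution and the discretised random time.\<close>

lemma has_bochner_integral_suminf_mult:
  fixes f :: "nat \<Rightarrow> 'b \<Rightarrow> real" and a c :: "nat \<Rightarrow> real"
  assumes int: "\<And>r. has_bochner_integral M (f r) (c r)"
    and nonneg: "\<And>r x. 0 \<le> f r x"
    and s1: "\<And>x. summable (\<lambda>r. \<bar>a r\<bar> * f r x)"
    and s2: "summable (\<lambda>r. \<bar>a r\<bar> * c r)"
  shows "has_bochner_integral M (\<lambda>x. \<Sum>r. a r * f r x) (\<Sum>r. a r * c r)"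
proof -
  have i: "integrable M (\<lambda>x. a r * f r x)" for r
    using int[of r] by (simp add: has_bochner_integral_iff)
  have c: "(\<integral>x. f r x \<partial>M) = c r" for r
    using int[of r] by (simp add: has_bochner_integral_iff)
  have n: "norm (a r * f r x) = \<bar>a r\<bar> * f r x" for r x
    using nonneg by (simp add: abs_mult)
  have S1: "AE x in M. summable (\<lambda>r. norm (a r * f r x))"
    unfolding n using s1 by simp
  have S2: "summable (\<lambda>r. \<integral>x. norm (a r * f r x) \<partial>M)"
    unfolding n using s2 by (simp add: c)
  show ?thesis
    using integrable_suminf[OF i S1 S2] integral_suminf[OF i S1 S2]
    by (simp add: has_bochner_integral_iff c)
qed

section \<open>Mittag-Leffler functions\<close>

text \<open>Euler's integral is bounded below by its part over \<open>{A..A+1}\<close>, where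
  \<open>t powr (x - 1) \<ge> A powr (x - 1)\<close> and \<open>exp t \<le> exp (A + 1)\<close>. As
  \<open>A\<close> is free, \<open>Gamma\<close> outgrows every geometric sequence.\<close>

lemma Gamma_lower_bound:
  fixes x A :: real
  assumes x: "1 \<le> x" and A: "0 < A"
  shows "A powr (x - 1) / exp (A + 1) \<le> Gamma x"
proof -
  have "ennreal (A powr (x - 1) / exp (A + 1)) =
      (\<integral>\<^sup>+t. ennreal (A powr (x - 1) / exp (A + 1)) * indicator {A..A+1} t \<partial>lborel)"
    by (simp add: nn_integral_cmult_indicator)
  also have "\<dots> \<le> (\<integral>\<^sup>+t. ennreal (indicator {0..} t * t powr (x - 1) / exp t) \<partial>lborel)"
  proof (rule nn_integral_mono)
    fix t :: real
    show "ennreal (A powr (x - 1) / exp (A + 1)) * indicator {A..A+1} t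
        \<le> ennreal (indicator {0..} t * t powr (x - 1) / exp t)"
    proof (cases "t \<in> {A..A+1}")
      case True
      then have "A powr (x - 1) / exp (A + 1) \<le> t powr (x - 1) / exp t"
        using A x by (intro frac_le powr_mono2) auto
      with True A show ?thesis by (auto intro!: ennreal_leI)
    qed auto
  qed
  also have "\<dots> = ennreal (Gamma x)"
    using x by (subst Gamma_conv_nn_integral_real) auto
  finally show ?thesis
    using x by (subst (asm) ennreal_le_iff) auto
qed

lemma summable_mittag_leffler_abs:
  fixes \<beta> \<delta> z :: real
  assumes b: "0 < \<beta>" and d: "1 \<le> \<delta>"
  shows "summable (\<lambda>r. \<bar>z\<bar> ^ r / Gamma (\<beta> * real r + \<delta>))"
proof -
  \<comment> \<open>Chosen so that \<open>A powr \<beta> = 2 * \<bar>z\<bar> + 1\<close>: the terms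
    are then dominated by powers of \<open>\<bar>z\<bar> / (2 * \<bar>z\<bar> + 1)\<close>, which is
    below \<open>1/2\<close>. The summand \<open>1\<close> keeps \<open>A\<close> positive at
    \<open>z = 0\<close>.\<close>
  define A where "A = (2 * \<bar>z\<bar> + 1) powr (1 / \<beta>)"
  have A: "A > 0" unfolding A_def by simp
  have A\<beta>: "A powr \<beta> = 2 * \<bar>z\<bar> + 1"
    unfolding A_def using b by (simp add: powr_powr)
  define C where "C = exp (A + 1) / A powr (\<delta> - 1)"
  have bound: "norm (\<bar>z\<bar> ^ r / Gamma (\<beta> * real r + \<delta>)) \<le> C * (1/2) ^ r" for r
  proof -
    have g1: "1 \<le> \<beta> * real r + \<delta>" using b d
      by (metis add_mono_thms_linordered_semiring(1) add_0 mult_nonneg_nonneg of_nat_0_le_iff less_imp_le)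
    have pw: "A powr (\<beta> * real r + \<delta> - 1) = (2 * \<bar>z\<bar> + 1) ^ r * A powr (\<delta> - 1)"
    proof -
      have "A powr (\<beta> * real r + \<delta> - 1) = (A powr \<beta>) powr real r * A powr (\<delta> - 1)"
        by (simp add: powr_powr powr_add[symmetric] add_diff_eq)
      then show ?thesis unfolding A\<beta> by (simp add: powr_realpow)
    qed
    have pos: "0 < A powr (\<beta> * real r + \<delta> - 1) / exp (A + 1)"
      using A by simp
    have "norm (\<bar>z\<bar> ^ r / Gamma (\<beta> * real r + \<delta>)) = \<bar>z\<bar> ^ r / Gamma (\<beta> * real r + \<delta>)"
      using g1 by (simp add: abs_divide Gamma_real_pos)
    also have "\<dots> \<le> \<bar>z\<bar> ^ r / (A powr (\<beta> * real r + \<delta> - 1) / exp (A + 1))"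
      using Gamma_lower_bound[OF g1 A] pos g1
      by (intro divide_left_mono mult_pos_pos) (auto simp: Gamma_real_pos)
    also have "\<dots> = C * (\<bar>z\<bar> / (2 * \<bar>z\<bar> + 1)) ^ r"
      unfolding pw C_def power_divide by (simp add: mult_ac)
    also have "\<dots> \<le> C * (1/2) ^ r"
      unfolding C_def by (intro mult_left_mono power_mono) (auto simp: field_simps)
    finally show ?thesis .
  qed
  show ?thesis
    by (rule summable_comparison_test'[where g="\<lambda>r. C * (1/2) ^ r" and N=0])
      (use bound in \<open>auto intro!: summable_mult summable_geometric\<close>)
qed

lemma summable_mittag_leffler:
  fixes \<beta> \<delta> z :: real
  assumes b: "0 < \<beta>" and d: "1 \<le> \<delta>"
  shows "summable (\<lambda>r. z ^ r / Gamma (\<beta> * real r + \<delta>))"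
proof (rule summable_norm_cancel)
  have "0 < Gamma (\<beta> * real r + \<delta>)" for r
    using b d by (intro Gamma_real_pos add_nonneg_pos) auto
  then have "norm (z ^ r / Gamma (\<beta> * real r + \<delta>)) = \<bar>z\<bar> ^ r / Gamma (\<beta> * real r + \<delta>)" for r
    by (simp add: power_abs less_imp_le)
  then show "summable (\<lambda>r. norm (z ^ r / Gamma (\<beta> * real r + \<delta>)))"
    using summable_mittag_leffler_abs[OF b d] by simp
qed

lemma mittag_leffler_altdef:
  "mittag_leffler \<beta> \<delta> z = (\<Sum>r. (1 / Gamma (\<beta> * real r + \<delta>)) * z ^ r)"
  unfolding mittag_leffler_def by (simp add: field_simps)

lemma isCont_mittag_leffler:
  assumes b: "0 < \<beta>" and d: "1 \<le> \<delta>"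
  shows "isCont (mittag_leffler \<beta> \<delta>) z"
proof -
  have "isCont (\<lambda>x. \<Sum>r. (1 / Gamma (\<beta> * real r + \<delta>)) * x ^ r) z"
  proof (rule isCont_powser_converges_everywhere)
    fix y :: real
    show "summable (\<lambda>r. (1 / Gamma (\<beta> * real r + \<delta>)) * y ^ r)"
      using summable_mittag_leffler[OF b d, of y] by simp
  qed
  then show ?thesis
    by (simp add: mittag_leffler_altdef[abs_def])
qed

lemma continuous_mittag_leffler_powr:
  assumes b: "0 < \<beta>" and d: "1 \<le> \<delta>" and s: "0 \<le> s"
  shows "continuous (at_right s) (\<lambda>s. mittag_leffler \<beta> \<delta> (c * s powr \<beta>))"
proof -
  have "continuous_on {0..} (\<lambda>s. s powr \<beta>)"
    using b by (intro continuous_on_powr') auto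
  then have "continuous (at s within {0..}) (\<lambda>s. s powr \<beta>)"
    using s by (simp add: continuous_on_eq_continuous_within)
  then have "continuous (at_right s) (\<lambda>s. s powr \<beta>)"
    by (rule continuous_within_subset) (use s in \<open>auto simp: greaterThan_def atLeast_def\<close>)
  then have "continuous (at_right s) (\<lambda>s. c * s powr \<beta>)"
    by (intro continuous_mult continuous_const)
  then show ?thesis
    by (rule continuous_within_compose3[OF isCont_mittag_leffler[OF b d]])
qed

lemma mittag_leffler_measurable:
  assumes b: "0 < \<beta>" and d: "1 \<le> \<delta>"
  shows "mittag_leffler \<beta> \<delta> \<in> borel_measurable borel"
  by (intro borel_measurable_continuous_onI continuous_at_imp_continuous_on ballI
      isCont_mittag_leffler[OF b d])

section \<open>Laplace transforms\<close>

text \<open>Euler's integral for \<open>Gamma (p + 1)\<close> after the substitution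
  \<open>t = u * s\<close>, which produces one factor \<open>u\<close> from the differential and
  \<open>u powr p\<close> from the integrand.\<close>

lemma nn_integral_powr_exp:
  fixes p u :: real
  assumes p: "- 1 < p" and u: "0 < u"
  shows "(\<integral>\<^sup>+s. ennreal (indicator {0..} s * (s powr p * exp (- u * s))) \<partial>lborel) =
    ennreal (Gamma (p + 1) / u powr (p + 1))"
proof -
  have "ennreal (Gamma (p + 1)) =
      (\<integral>\<^sup>+t. ennreal (indicator {0..} t * t powr (p + 1 - 1) / exp t) \<partial>lborel)"
    by (rule Gamma_conv_nn_integral_real) (use p in auto)
  also have "\<dots> = ennreal \<bar>u\<bar> *
      (\<integral>\<^sup>+s. ennreal (indicator {0..} (0 + u * s) * (0 + u * s) powr (p + 1 - 1) / exp (0 + u * s)) \<partial>lborel)"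
    by (rule nn_integral_real_affine) (use u in auto)
  also have "(\<integral>\<^sup>+s. ennreal (indicator {0..} (0 + u * s) * (0 + u * s) powr (p + 1 - 1) / exp (0 + u * s)) \<partial>lborel)
    = (\<integral>\<^sup>+s. ennreal (u powr p) * ennreal (indicator {0..} s * (s powr p * exp (- u * s))) \<partial>lborel)"
    using u by (intro nn_integral_cong)
      (auto simp: indicator_def powr_mult exp_minus field_simps zero_le_mult_iff ennreal_mult' [symmetric])
  also have "\<dots> = ennreal (u powr p) * (\<integral>\<^sup>+s. ennreal (indicator {0..} s * (s powr p * exp (- u * s))) \<partial>lborel)"
    by (rule nn_integral_cmult) auto
  finally have eq: "ennreal (Gamma (p + 1)) = ennreal \<bar>u\<bar> * (ennreal (u powr p) *
      (\<integral>\<^sup>+s. ennreal (indicator {0..} s * (s powr p * exp (- u * s))) \<partial>lborel))"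
      (is "_ = _ * (_ * ?I)") .
  have G: "0 \<le> Gamma (p + 1)" using p by (simp add: Gamma_real_pos less_imp_le)
  have "ennreal \<bar>u\<bar> * ennreal (u powr p) = ennreal (u powr (p + 1))"
    using u by (simp add: powr_add ennreal_mult'[symmetric] mult.commute)
  then have eq2: "ennreal (Gamma (p + 1)) = ennreal (u powr (p + 1)) * ?I"
    using eq by (simp only: mult.assoc[symmetric])
  have "ennreal (Gamma (p + 1) / u powr (p + 1)) = ennreal (1 / u powr (p + 1)) * ennreal (Gamma (p + 1))"
    using G by (subst ennreal_mult'[symmetric]) auto
  also have "\<dots> = ennreal (1 / u powr (p + 1)) * ennreal (u powr (p + 1)) * ?I"
    unfolding eq2 by (simp only: mult.assoc)
  also have "ennreal (1 / u powr (p + 1)) * ennreal (u powr (p + 1)) = 1"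
    using u by (subst ennreal_mult'[symmetric]) auto
  finally show ?thesis by simp
qed

lemma has_bochner_integral_powr_exp:
  fixes p u :: real
  assumes p: "- 1 < p" and u: "0 < u"
  shows "has_bochner_integral lborel (\<lambda>s. indicator {0..} s * (s powr p * exp (- u * s)))
    (Gamma (p + 1) / u powr (p + 1))"
  using nn_integral_powr_exp[OF assms] p u
  by (intro has_bochner_integral_nn_integral) (auto intro!: divide_nonneg_nonneg simp: Gamma_real_pos less_imp_le)

text \<open>Positivity of \<open>s\<close> matters at \<open>r = 0\<close>: \<open>0 powr 0\<close>
  is \<open>0\<close>, but \<open>0 ^ 0\<close> is \<open>1\<close>.\<close>

lemma power_mult_powr:
  fixes s :: real
  assumes "0 < s"
  shows "(c * s powr \<beta>) ^ r = c ^ r * s powr (\<beta> * real r)"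
  using assms by (simp add: power_mult_distrib powr_realpow[symmetric] powr_powr)

text \<open>The \<open>Gamma\<close> factor of the integral of each power cancels the coefficient,
  leaving a geometric series in \<open>- \<theta> / u powr \<beta>\<close>. Its convergence is the
  condition \<open>\<theta> < u powr \<beta>\<close>.\<close>

lemma laplace_mittag_leffler:
  fixes \<beta> \<theta> u :: real
  assumes b: "0 < \<beta>" and th: "0 < \<theta>" and u: "0 < u" "\<theta> < u powr \<beta>"
  shows "has_bochner_integral lborel
    (\<lambda>s. indicator {0..} s * (exp (- u * s) * mittag_leffler \<beta> 1 (- \<theta> * s powr \<beta>)))
    (u powr (\<beta> - 1) / (u powr \<beta> + \<theta>))"
proof -
  define a where "a r = (- \<theta>) ^ r / Gamma (\<beta> * real r + 1)" for r :: nat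
  define f where "f r s = indicator {0..} s * (s powr (\<beta> * real r) * exp (- u * s))" for r :: nat and s :: real
  define c where "c r = Gamma (\<beta> * real r + 1) / u powr (\<beta> * real r + 1)" for r :: nat
  define q where "q = \<theta> / u powr \<beta>"
  have q: "0 < q" "q < 1" using th u by (auto simp: q_def)
  have gp: "0 < Gamma (\<beta> * real r + 1)" for r :: nat
    using b by (intro Gamma_real_pos add_nonneg_pos) auto
  have int: "has_bochner_integral lborel (f r) (c r)" for r
  proof -
    have "0 \<le> \<beta> * real r" using b by simp
    then have "- 1 < \<beta> * real r" by linarith
    then show ?thesis
      unfolding f_def c_def using u(1) by (intro has_bochner_integral_powr_exp)
  qed
  have upow: "u powr (\<beta> * real r + 1) = u * (u powr \<beta>) ^ r" for r :: nat
    using u(1) by (simp add: powr_add powr_powr[symmetric] powr_realpow)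
  have ac: "a r * c r = (1 / u) * (- q) ^ r" for r
  proof -
    have "a r * c r = (- \<theta>) ^ r / (u * (u powr \<beta>) ^ r)"
      unfolding a_def c_def upow using gp[of r] by simp
    also have "\<dots> = (1 / u) * (- \<theta> / u powr \<beta>) ^ r"
      unfolding power_divide by simp
    finally show ?thesis by (simp add: q_def)
  qed
  have aa: "\<bar>a r\<bar> = \<theta> ^ r / Gamma (\<beta> * real r + 1)" for r
    unfolding a_def using gp[of r] th by (simp add: abs_divide power_abs)
  have aac: "\<bar>a r\<bar> * c r = (1 / u) * q ^ r" for r
    unfolding aa c_def upow q_def power_divide using gp[of r] by simp
  have "has_bochner_integral lborel (\<lambda>s. \<Sum>r. a r * f r s) (\<Sum>r. a r * c r)"
  proof (rule has_bochner_integral_suminf_mult[OF int])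
    show "0 \<le> f r x" for r x unfolding f_def by simp
    show "summable (\<lambda>r. \<bar>a r\<bar> * c r)"
      unfolding aac using q by (intro summable_mult summable_geometric) auto
    show "summable (\<lambda>r. \<bar>a r\<bar> * f r s)" for s
    proof (cases "s > 0")
      case True
      have "\<bar>a r\<bar> * f r s = exp (- u * s) * (\<bar>\<theta> * s powr \<beta>\<bar> ^ r / Gamma (\<beta> * real r + 1))" for r
        using True th unfolding aa f_def by (simp add: power_mult_powr[OF True] abs_mult)
      then show ?thesis
        using summable_mult[OF summable_mittag_leffler_abs[OF b order_refl, of "\<theta> * s powr \<beta>"]] by simp
    next
      case False
      then have "\<bar>a r\<bar> * f r s = 0" for r
        by (cases "s = 0") (auto simp: f_def)
      then show ?thesis by (simp only: summable_zero)
    qed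
  qed
  also have "(\<Sum>r. a r * c r) = (1 / u) * (1 / (1 + q))"
  proof -
    have "(\<lambda>r. (1 / u) * (- q) ^ r) sums ((1 / u) * (1 / (1 - (- q))))"
      using q by (intro sums_mult geometric_sums) auto
    then show ?thesis unfolding ac by (simp add: sums_iff)
  qed
  also have "\<dots> = u powr (\<beta> - 1) / (u powr \<beta> + \<theta>)"
  proof -
    have "0 < u powr \<beta>" "u powr (\<beta> - 1) = u powr \<beta> / u" using u(1) by (auto simp: powr_diff)
    moreover from this have "0 < u powr \<beta> + \<theta>" using th by linarith
    ultimately show ?thesis
      unfolding q_def using u(1) by (simp add: divide_simps)
  qed
  finally have main: "has_bochner_integral lborel (\<lambda>s. \<Sum>r. a r * f r s) (u powr (\<beta> - 1) / (u powr \<beta> + \<theta>))" .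
  have meas: "mittag_leffler \<beta> 1 \<in> borel_measurable borel"
    using b by (intro mittag_leffler_measurable) auto
  \<comment> \<open>At \<open>s = 0\<close> the two sides differ: \<open>0 powr 0 = 0\<close> kills
    every \<open>f r 0\<close>, while the Mittag-Leffler function has the value
    \<open>1\<close>.\<close>
  have "AE s in lborel. s \<noteq> (0::real)" by (rule AE_lborel_singleton)
  then have ae: "AE s in lborel. (\<Sum>r. a r * f r s) =
      indicator {0..} s * (exp (- u * s) * mittag_leffler \<beta> 1 (- \<theta> * s powr \<beta>))"
  proof eventually_elim
    case (elim s)
    show ?case
    proof (cases "s > 0")
      case True
      have "a r * f r s = exp (- u * s) * ((- \<theta> * s powr \<beta>) ^ r / Gamma (\<beta> * real r + 1))" for r
        using True unfolding a_def f_def by (simp only: power_mult_powr[OF True]) simp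
      moreover have "summable (\<lambda>r. (- \<theta> * s powr \<beta>) ^ r / Gamma (\<beta> * real r + 1))"
        by (rule summable_mittag_leffler[OF b order_refl])
      ultimately show ?thesis
        using True by (simp only: suminf_mult mittag_leffler_def mult.commute[of \<beta> "real _"]) simp
    qed (use elim in \<open>simp add: f_def\<close>)
  qed
  have m1: "(\<lambda>s. \<Sum>r. a r * f r s) \<in> borel_measurable lborel"
    using main by (auto simp: has_bochner_integral_iff)
  have m2: "(\<lambda>s. indicator {0..} s * (exp (- u * s) * mittag_leffler \<beta> 1 (- \<theta> * s powr \<beta>))) \<in> borel_measurable lborel"
    by (intro borel_measurable_times measurable_compose[OF _ meas]) auto
  show ?thesis
    using main by (rule iffD1[OF has_bochner_integral_cong_AE[OF m1 m2 ae]])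
qed

text \<open>
  By the Weierstrass theorem in the variable \<open>exp (- s)\<close>, integer frequencies suffice. Right-continuity
  makes it possible to test against a bump supported on an interval \<open>[s0, b]\<close> on which \<open>g > 0\<close>.
\<close>

lemma laplace_unique_pos:
  fixes g :: "real \<Rightarrow> real"
  assumes int: "integrable lborel (\<lambda>s. indicator {0..} s * g s)"
    and zero: "\<And>n::nat. (\<integral>s. indicator {0..} s * g s * exp (- real n * s) \<partial>lborel) = 0"
    and s0: "0 \<le> s0" and rc: "continuous (at_right s0) g"
  shows "\<not> 0 < g s0"
proof
  assume gpos: "0 < g s0"
  define h where "h s = indicator {0..} s * g s" for s :: real
  have h_int: "integrable lborel h" using int by (simp add: h_def[abs_def])
  have prod_int: "integrable lborel (\<lambda>s. h s * \<phi> (exp (- s)))"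
    if \<phi>: "continuous_on {0..1} \<phi>" for \<phi> :: "real \<Rightarrow> real"
  proof -
    obtain K where K: "\<And>x. x \<in> {0..1} \<Longrightarrow> \<bar>\<phi> x\<bar> \<le> K"
      using continuous_on_compact_bound[OF compact_Icc \<phi>] by auto
    \<comment> \<open>\<open>\<phi>\<close> is controlled only on \<open>{0..1}\<close>, that is for
      \<open>s \<ge> 0\<close>; the extra indicator changes nothing in the product, because
      \<open>h\<close> vanishes for negative \<open>s\<close>.\<close>
    have m: "(\<lambda>s. indicator {0..} s * \<phi> (exp (- s))) \<in> borel_measurable lborel"
    proof -
      have "continuous_on {0..} (\<lambda>s::real. \<phi> (exp (- s)))"
        by (rule continuous_on_compose2[OF \<phi>]) (auto intro!: continuous_intros)
      then show ?thesis
        using borel_measurable_continuous_on_indicator[of "{0..}" "\<lambda>s. \<phi> (exp (- s))"] by simp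
    qed
    have "integrable lborel (\<lambda>s. h s * (indicator {0..} s * \<phi> (exp (- s))))"
    proof (rule Bochner_Integration.integrable_bound)
      show "integrable lborel (\<lambda>s. K * h s)" using h_int by simp
      show "(\<lambda>s. h s * (indicator {0..} s * \<phi> (exp (- s)))) \<in> borel_measurable lborel"
        using m borel_measurable_integrable[OF h_int] by simp
      have "0 \<le> K" using K[of 0] by (auto intro: order_trans[OF abs_ge_zero])
      then have "norm (h s * (indicator {0..} s * \<phi> (exp (- s)))) \<le> norm (K * h s)" for s
        using K[of "exp (- s)"]
        by (auto simp: indicator_def abs_mult mult.commute[of K] intro!: mult_left_mono)
      then show "AE s in lborel. norm (h s * (indicator {0..} s * \<phi> (exp (- s)))) \<le> norm (K * h s)"
        by simp
    qed
    also have "(\<lambda>s. h s * (indicator {0..} s * \<phi> (exp (- s)))) = (\<lambda>s. h s * \<phi> (exp (- s)))"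
      by (auto simp: h_def indicator_def)
    finally show ?thesis .
  qed
  have pow: "(\<integral>s. h s * exp (- s) ^ n \<partial>lborel) = 0" for n :: nat
  proof -
    have "exp (- s) ^ n = exp (- real n * s)" for s :: real
      using exp_of_nat_mult[of n "- s"] by simp
    then show ?thesis using zero[of n] by (simp only: h_def)
  qed
  have poly: "(\<integral>s. h s * q (exp (- s)) \<partial>lborel) = 0" if "real_polynomial_function q" for q
  proof -
    from that have "\<exists>a n. q = (\<lambda>x. \<Sum>i\<le>n. a i * x ^ i)"
      by (simp only: real_polynomial_function_iff_sum)
    then obtain a n where q: "q = (\<lambda>x. \<Sum>i\<le>n. a i * x ^ i)"
      by (elim exE)
    have "(\<integral>s. h s * q (exp (- s)) \<partial>lborel) = (\<integral>s. (\<Sum>i\<le>n. a i * (h s * exp (- s) ^ i)) \<partial>lborel)"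
      unfolding q by (simp add: sum_distrib_left mult_ac)
    also have "\<dots> = (\<Sum>i\<le>n. \<integral>s. a i * (h s * exp (- s) ^ i) \<partial>lborel)"
      by (intro Bochner_Integration.integral_sum integrable_mult_right prod_int) (auto intro!: continuous_intros)
    finally show ?thesis by (simp add: pow)
  qed
  have cont: "(\<integral>s. h s * \<phi> (exp (- s)) \<partial>lborel) = 0" if \<phi>: "continuous_on {0..1} \<phi>" for \<phi>
  proof -
    define H where "H = (\<integral>s. \<bar>h s\<bar> \<partial>lborel)"
    have H: "0 \<le> H" unfolding H_def by simp
    have le: "\<bar>\<integral>s. h s * \<phi> (exp (- s)) \<partial>lborel\<bar> \<le> e" if e: "0 < e" for e
    proof -
      \<comment> \<open>Gives \<open>e' * H \<le> e\<close> also when \<open>H = 0\<close>.\<close>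
      define e' where "e' = e / (H + 1)"
      have e': "0 < e'" using e H by (simp add: e'_def)
      obtain q where q: "real_polynomial_function q" "\<And>x. x \<in> {0..1} \<Longrightarrow> \<bar>\<phi> x - q x\<bar> < e'"
        using Stone_Weierstrass_real_polynomial_function[OF compact_Icc \<phi> e'] by blast
      have qc: "continuous_on {0..1} q"
        using q(1) by (intro continuous_on_polymonial_function) (simp add: real_polynomial_function_eq)
      have "(\<integral>s. h s * \<phi> (exp (- s)) \<partial>lborel) = (\<integral>s. h s * \<phi> (exp (- s)) \<partial>lborel) - (\<integral>s. h s * q (exp (- s)) \<partial>lborel)"
        using poly[OF q(1)] by simp
      also have "\<dots> = (\<integral>s. h s * (\<phi> (exp (- s)) - q (exp (- s))) \<partial>lborel)"
        unfolding right_diff_distrib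
        by (rule Bochner_Integration.integral_diff[OF prod_int[OF \<phi>] prod_int[OF qc], symmetric])
      also have "\<bar>\<dots>\<bar> \<le> (\<integral>s. e' * \<bar>h s\<bar> \<partial>lborel)"
      proof (rule order_trans[OF integral_abs_bound integral_mono])
        have "continuous_on {0..1} (\<lambda>x. \<phi> x - q x)" using \<phi> qc by (intro continuous_intros)
        then show "integrable lborel (\<lambda>s. \<bar>h s * (\<phi> (exp (- s)) - q (exp (- s)))\<bar>)"
          using prod_int by (intro integrable_abs)
        show "integrable lborel (\<lambda>s. e' * \<bar>h s\<bar>)" using h_int by simp
        show "\<bar>h s * (\<phi> (exp (- s)) - q (exp (- s)))\<bar> \<le> e' * \<bar>h s\<bar>" for s
          using q(2)[of "exp (- s)"]
          by (cases "0 \<le> s") (auto simp: h_def abs_mult mult.commute[of e'] intro!: mult_left_mono)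
      qed
      also have "\<dots> = e' * H" by (simp add: H_def)
      also have "\<dots> \<le> e" using e H unfolding e'_def by (simp add: field_simps)
      finally show ?thesis .
    qed
    then have "\<bar>\<integral>s. h s * \<phi> (exp (- s)) \<partial>lborel\<bar> \<le> 0" by (rule field_le_epsilon[of _ 0, simplified])
    then show ?thesis by simp
  qed
  have "eventually (\<lambda>s. 0 < g s) (at_right s0)"
    using order_tendstoD(1)[OF rc[unfolded continuous_within] gpos] by simp
  then obtain b where b: "s0 < b" "\<And>s. s0 < s \<Longrightarrow> s < b \<Longrightarrow> 0 < g s"
    by (auto simp: eventually_at_right_field)
  \<comment> \<open>In \<open>x = exp (- s)\<close> the product is positive exactly between its two
    roots, so the truncated bump is positive for \<open>s0 < s < b\<close> and zero for all other
    \<open>s\<close>.\<close>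
  define \<phi> where "\<phi> x = max 0 ((x - exp (- b)) * (exp (- s0) - x))" for x :: real
  have \<phi>c: "continuous_on {0..1} \<phi>" unfolding \<phi>_def by (intro continuous_intros)
  have \<phi>pos: "0 < \<phi> (exp (- s))" if "s0 < s" "s < b" for s
    using that unfolding \<phi>_def by (simp add: less_max_iff_disj)
  have \<phi>zero: "\<phi> (exp (- s)) = 0" if "\<not> (s0 < s \<and> s < b)" for s
  proof -
    have "(exp (- s) - exp (- b)) * (exp (- s0) - exp (- s)) \<le> 0"
    proof (cases "s \<le> s0")
      case True
      then show ?thesis using b(1) by (intro mult_nonneg_nonpos) auto
    next
      case False
      then show ?thesis using that by (intro mult_nonpos_nonneg) auto
    qed
    then show ?thesis unfolding \<phi>_def by simp
  qed
  have hpos: "0 < h s * \<phi> (exp (- s))" if "s0 < s" "s < b" for s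
    using \<phi>pos[OF that] b(2)[OF that] s0 that by (simp add: h_def)
  have "AE s in lborel. 0 = h s * \<phi> (exp (- s))"
  proof -
    have "0 \<le> h s * \<phi> (exp (- s))" for s
      using hpos[of s] \<phi>zero[of s] by (cases "s0 < s \<and> s < b") (auto simp: less_imp_le)
    then have "AE s in lborel. h s * \<phi> (exp (- s)) = 0"
      using integral_nonneg_eq_0_iff_AE[OF prod_int[OF \<phi>c]] cont[OF \<phi>c] by simp
    then show ?thesis by eventually_elim simp
  qed
  then have "AE s in lborel. s \<notin> {s0<..<b}"
    by eventually_elim (use hpos in force)
  then have "emeasure lborel {s0<..<b} = 0"
    by (subst (asm) AE_iff_measurable[of "{s0<..<b}"]) auto
  then show False using b(1) by simp
qed

lemma laplace_unique:
  fixes g :: "real \<Rightarrow> real"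
  assumes int: "integrable lborel (\<lambda>s. indicator {0..} s * g s)"
    and zero: "\<And>n::nat. (\<integral>s. indicator {0..} s * g s * exp (- real n * s) \<partial>lborel) = 0"
    and s0: "0 \<le> s0" and rc: "continuous (at_right s0) g"
  shows "g s0 = 0"
proof -
  have "\<not> 0 < - g s0"
    by (rule laplace_unique_pos[where g="\<lambda>s. - g s"])
      (use assms in \<open>auto intro!: continuous_intros\<close>)
  with laplace_unique_pos[OF assms] show ?thesis by simp
qed

section \<open>The Levy exponent of the stable subordinator\<close>

lemma nn_integral_powr_tail:
  fixes y \<beta> :: real
  assumes y: "0 < y" and b: "0 < \<beta>"
  shows "(\<integral>\<^sup>+x. ennreal (\<beta> * x powr (- 1 - \<beta>)) * indicator {y..} x \<partial>lborel) = ennreal (y powr (- \<beta>))"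
proof -
  have "(\<integral>\<^sup>+x. ennreal (\<beta> * x powr (- 1 - \<beta>)) * indicator {y..} x \<partial>lborel) =
      ennreal (0 - - (y powr (- \<beta>)))"
  proof (rule nn_integral_FTC_atLeast[where F="\<lambda>x. - (x powr (- \<beta>))"])
    show "DERIV (\<lambda>x. - (x powr (- \<beta>))) x :> \<beta> * x powr (- 1 - \<beta>)" if "y \<le> x" for x
    proof -
      have e: "- \<beta> - 1 = - 1 - \<beta>" by simp
      show ?thesis
        using that y by (auto intro!: derivative_eq_intros simp: e)
    qed
    show "((\<lambda>x. - (x powr (- \<beta>))) \<longlongrightarrow> 0) at_top"
      using tendsto_minus[OF tendsto_neg_powr[OF _ filterlim_ident], of "- \<beta>"] b by simp
  qed (use b in auto)
  then show ?thesis by simp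
qed

lemma nn_integral_exp_Icc:
  fixes u x :: real
  assumes u: "0 < u" and x: "0 \<le> x"
  shows "(\<integral>\<^sup>+y. ennreal (u * exp (- u * y)) * indicator {0..x} y \<partial>lborel) = ennreal (1 - exp (- u * x))"
proof -
  have "(\<integral>\<^sup>+y. ennreal (u * exp (- u * y)) * indicator {0..x} y \<partial>lborel) =
    ennreal (- exp (- u * x) - - exp (- u * 0))"
    by (rule nn_integral_FTC_Icc[where F="\<lambda>y. - exp (- u * y)"])
      (use u x in \<open>auto intro!: derivative_eq_intros\<close>)
  then show ?thesis by simp
qed

text \<open>Writing \<open>1 - exp (- u * x)\<close> as the integral of
  \<open>u * exp (- u * y)\<close> over \<open>{0..x}\<close> and exchanging the integrals exposes
  the tail \<open>y powr (- \<beta>) / Gamma (1 - \<beta>)\<close> of the Levy measure. What remains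
  is a \<open>Gamma\<close> integral that cancels the normalising constant.\<close>

lemma stable_levy_exponent:
  fixes \<beta> u :: real
  assumes b: "0 < \<beta>" "\<beta> < 1" and u: "0 < u"
  shows "(\<integral>x. 1 - exp (- u * x) \<partial>stable_levy_measure \<beta>) = u powr \<beta>"
proof -
  define C where "C = 1 / Gamma (1 - \<beta>)"
  have C: "0 < C" using b unfolding C_def by (simp add: Gamma_real_pos)
  define d where "d x = (if 0 < x then \<beta> / Gamma (1 - \<beta>) * x powr (- 1 - \<beta>) else 0)" for x :: real
  have d_eq: "d x = (if 0 < x then C * (\<beta> * x powr (- 1 - \<beta>)) else 0)" for x
    by (simp add: d_def C_def)
  have d_nonneg: "0 \<le> d x" for x using b C unfolding d_eq by simp
  have d_meas [measurable]: "d \<in> borel_measurable borel" unfolding d_def by measurable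
  have "(\<integral>\<^sup>+x. ennreal (d x * (1 - exp (- u * x))) \<partial>lborel) =
      (\<integral>\<^sup>+x. \<integral>\<^sup>+y. ennreal (d x) * (ennreal (u * exp (- u * y)) * indicator {0..x} y) \<partial>lborel \<partial>lborel)"
  proof (rule nn_integral_cong)
    fix x :: real
    show "ennreal (d x * (1 - exp (- u * x))) =
      (\<integral>\<^sup>+y. ennreal (d x) * (ennreal (u * exp (- u * y)) * indicator {0..x} y) \<partial>lborel)"
    proof (cases "0 < x")
      case True
      then show ?thesis
        using d_nonneg[of x]
        using nn_integral_exp_Icc[OF u, of x]
        by (subst nn_integral_cmult) (auto simp: ennreal_mult')
    next
      case False
      then show ?thesis by (simp add: d_def)
    qed
  qed
  also have "\<dots> = (\<integral>\<^sup>+y. \<integral>\<^sup>+x. ennreal (d x) * (ennreal (u * exp (- u * y)) * indicator {0..x} y) \<partial>lborel \<partial>lborel)"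
  proof (rule lborel_pair.Fubini'[symmetric])
    \<comment> \<open>The set in \<open>indicator {0..x} y\<close> moves with \<open>x\<close>;
      measurability is read off after rewriting it as the indicator of one set of pairs.\<close>
    have "(\<lambda>(x, y). ennreal (d x) * (ennreal (u * exp (- u * y)) * indicator {z. 0 \<le> snd z \<and> snd z \<le> fst z} (x, y)))
      \<in> borel_measurable (lborel \<Otimes>\<^sub>M lborel)"
      by measurable
    also have "(\<lambda>(x, y). ennreal (d x) * (ennreal (u * exp (- u * y)) * indicator {z. 0 \<le> snd z \<and> snd z \<le> fst z} (x, y)))
      = (\<lambda>(x, y). ennreal (d x) * (ennreal (u * exp (- u * y)) * indicator {0..x} y))"
      by (auto simp: indicator_def)
    finally show "(\<lambda>(x, y). ennreal (d x) * (ennreal (u * exp (- u * y)) * indicator {0..x} y))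
      \<in> borel_measurable (lborel \<Otimes>\<^sub>M lborel)" .
  qed
  also have "\<dots> = (\<integral>\<^sup>+y. ennreal (C * u) * ennreal (indicator {0..} y * (y powr (- \<beta>) * exp (- u * y))) \<partial>lborel)"
  proof (rule nn_integral_cong_AE)
    \<comment> \<open>At \<open>y = 0\<close> the inner integral is \<open>u\<close> times the
      infinite total mass of the Levy measure, whereas \<open>0 powr (- \<beta>)\<close> is
      \<open>0\<close>.\<close>
    have "AE y in lborel. y \<noteq> (0::real)" by (rule AE_lborel_singleton)
    then show "AE y in lborel. (\<integral>\<^sup>+x. ennreal (d x) * (ennreal (u * exp (- u * y)) * indicator {0..x} y) \<partial>lborel) =
      ennreal (C * u) * ennreal (indicator {0..} y * (y powr (- \<beta>) * exp (- u * y)))"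
    proof eventually_elim
      case (elim y)
      show ?case
      proof (cases "0 < y")
        case True
        have "(\<integral>\<^sup>+x. ennreal (d x) * (ennreal (u * exp (- u * y)) * indicator {0..x} y) \<partial>lborel) =
          (\<integral>\<^sup>+x. ennreal (C * (u * exp (- u * y))) * (ennreal (\<beta> * x powr (- 1 - \<beta>)) * indicator {y..} x) \<partial>lborel)"
          using True C u b by (intro nn_integral_cong)
            (auto simp: d_eq indicator_def ennreal_mult'[symmetric] mult_ac)
        also have "\<dots> = ennreal (C * (u * exp (- u * y))) * ennreal (y powr (- \<beta>))"
          by (subst nn_integral_cmult) (auto simp: nn_integral_powr_tail[OF True b(1)])
        also have "\<dots> = ennreal (C * u) * ennreal (indicator {0..} y * (y powr (- \<beta>) * exp (- u * y)))"
          using True C u by (simp add: ennreal_mult'[symmetric] mult_ac)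
        finally show ?thesis .
      next
        case False
        then show ?thesis using elim by simp
      qed
    qed
  qed
  also have "\<dots> = ennreal (C * u) * ennreal (Gamma (- \<beta> + 1) / u powr (- \<beta> + 1))"
    using nn_integral_powr_exp[of "- \<beta>" u] b u by (subst nn_integral_cmult) auto
  also have "\<dots> = ennreal (C * u * (Gamma (- \<beta> + 1) / u powr (- \<beta> + 1)))"
    using C u by (subst ennreal_mult') auto
  also have "C * u * (Gamma (- \<beta> + 1) / u powr (- \<beta> + 1)) = u powr \<beta>"
  proof -
    have "0 < Gamma (1 - \<beta>)" using b by (simp add: Gamma_real_pos)
    moreover have "u powr \<beta> * u powr (1 - \<beta>) = u"
      using powr_add[of u \<beta> "1 - \<beta>"] u by simp
    ultimately show ?thesis using u unfolding C_def by (simp add: field_simps)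
  qed
  finally have nn: "(\<integral>\<^sup>+x. ennreal (d x * (1 - exp (- u * x))) \<partial>lborel) = ennreal (u powr \<beta>)" .
  have pos: "0 \<le> d x * (1 - exp (- u * x))" for x
    using mult_nonneg_nonneg[OF d_nonneg, of "1 - exp (- u * x)" x] u
    by (cases "0 < x") (simp_all add: d_def)
  have "has_bochner_integral lborel (\<lambda>x. d x * (1 - exp (- u * x))) (u powr \<beta>)"
    by (rule has_bochner_integral_nn_integral) (use nn pos in auto)
  moreover have "(\<integral>x. 1 - exp (- u * x) \<partial>stable_levy_measure \<beta>) = (\<integral>x. d x * (1 - exp (- u * x)) \<partial>lborel)"
    unfolding stable_levy_measure_def d_def[symmetric]
    by (subst integral_density) (use d_nonneg in auto)
  ultimately show ?thesis by (simp add: has_bochner_integral_iff)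
qed

section \<open>A Beta integral\<close>

lemma nn_integral_Beta:
  fixes a b t :: real
  assumes a: "0 < a" and b: "0 < b" and t: "0 < t"
  shows "(\<integral>\<^sup>+s. ennreal (indicator {0..t} s * (s powr (a - 1) * (t - s) powr (b - 1))) \<partial>lborel) =
    ennreal (t powr (a + b - 1) * Beta a b)"
proof -
  have "(\<integral>\<^sup>+s. ennreal (indicator {0..t} s * (s powr (a - 1) * (t - s) powr (b - 1))) \<partial>lborel) =
    ennreal \<bar>t\<bar> * (\<integral>\<^sup>+x. ennreal (indicator {0..t} (0 + t * x) * ((0 + t * x) powr (a - 1) * (t - (0 + t * x)) powr (b - 1))) \<partial>lborel)"
    by (rule nn_integral_real_affine) (use t in auto)
  also have "(\<integral>\<^sup>+x. ennreal (indicator {0..t} (0 + t * x) * ((0 + t * x) powr (a - 1) * (t - (0 + t * x)) powr (b - 1))) \<partial>lborel)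
    = (\<integral>\<^sup>+x. ennreal (t powr (a - 1) * t powr (b - 1)) * (ennreal (x powr (a - 1) * (1 - x) powr (b - 1)) * indicator {0..1} x) \<partial>lborel)"
  proof (rule nn_integral_cong)
    fix x :: real
    have "t - t * x = t * (1 - x)" by (simp add: algebra_simps)
    then show "ennreal (indicator {0..t} (0 + t * x) * ((0 + t * x) powr (a - 1) * (t - (0 + t * x)) powr (b - 1)))
      = ennreal (t powr (a - 1) * t powr (b - 1)) * (ennreal (x powr (a - 1) * (1 - x) powr (b - 1)) * indicator {0..1} x)"
      using t by (auto simp: indicator_def powr_mult zero_le_mult_iff ennreal_mult'[symmetric] mult_ac)
  qed
  also have "\<dots> = ennreal (t powr (a - 1) * t powr (b - 1)) * ennreal (Beta a b)"
    by (subst nn_integral_cmult)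
      (use nn_integral_has_integral_lebesgue'[OF _ has_integral_Beta_real[OF a b]] in auto)
  also have "ennreal \<bar>t\<bar> * \<dots> = ennreal (t * (t powr (a - 1) * t powr (b - 1)) * Beta a b)"
    using t by (simp only: ennreal_mult'[symmetric] mult.assoc powr_ge_zero zero_le_mult_iff abs_of_pos less_imp_le)
      (simp add: ennreal_mult' mult.assoc)
  also have "t * (t powr (a - 1) * t powr (b - 1)) = t powr (a + b - 1)"
    using t by (simp add: powr_add powr_diff)
  finally show ?thesis .
qed

text \<open>\<open>Beta \<nu> (\<beta> * r + 1)\<close> is \<open>Gamma \<nu> * Gamma (\<beta> * r +
  1) / Gamma (\<beta> * r + \<nu> + 1)\<close>: its middle factor cancels the coefficient of the
  first series and its denominator is the coefficient of the second.\<close>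

lemma mittag_leffler_Beta_convolution:
  fixes \<nu> \<beta> \<theta> t :: real
  assumes nu: "0 < \<nu>" and b: "0 < \<beta>" and t: "0 < t"
  shows "has_bochner_integral lborel
    (\<lambda>s. indicator {0..t} s * (s powr (\<nu> - 1) * mittag_leffler \<beta> 1 (\<theta> * (t - s) powr \<beta>)))
    (Gamma \<nu> * t powr \<nu> * mittag_leffler \<beta> (\<nu> + 1) (\<theta> * t powr \<beta>))"
proof -
  define a where "a r = \<theta> ^ r / Gamma (\<beta> * real r + 1)" for r :: nat
  define f where "f r s = indicator {0..t} s * (s powr (\<nu> - 1) * (t - s) powr (\<beta> * real r))" for r :: nat and s :: real
  define c where "c r = t powr (\<nu> + \<beta> * real r) * Beta \<nu> (\<beta> * real r + 1)" for r :: nat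
  have gp: "0 < Gamma (\<beta> * real r + 1)" for r :: nat
    using b by (intro Gamma_real_pos add_nonneg_pos) auto
  have gp2: "0 < Gamma (\<beta> * real r + (\<nu> + 1))" for r :: nat
    using b nu by (intro Gamma_real_pos add_nonneg_pos) auto
  have gnu: "0 < Gamma \<nu>" using nu by (intro Gamma_real_pos)
  have ceq: "c r = Gamma \<nu> * t powr \<nu> * ((t powr \<beta>) ^ r * Gamma (\<beta> * real r + 1) / Gamma (\<beta> * real r + (\<nu> + 1)))" for r
  proof -
    have "t powr (\<nu> + \<beta> * real r) = t powr \<nu> * (t powr \<beta>) ^ r"
      using t by (simp add: powr_add powr_powr[symmetric] powr_realpow)
    then show ?thesis unfolding c_def Beta_def by (simp add: add_ac mult_ac)
  qed
  have c_nonneg: "0 \<le> c r" for r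
    unfolding ceq using gp[of r] gp2[of r] gnu by simp
  have int: "has_bochner_integral lborel (f r) (c r)" for r
  proof (rule has_bochner_integral_nn_integral)
    have "0 < \<beta> * real r + 1" using b by (intro add_nonneg_pos) auto
    then show "(\<integral>\<^sup>+x. ennreal (f r x) \<partial>lborel) = ennreal (c r)"
      using nn_integral_Beta[OF nu _ t, of "\<beta> * real r + 1"]
      by (simp add: f_def c_def add_diff_eq[symmetric])
    show "f r \<in> borel_measurable lborel" unfolding f_def by measurable
  qed (use c_nonneg in \<open>auto simp: f_def\<close>)
  have ac: "a r * c r = (Gamma \<nu> * t powr \<nu>) * ((\<theta> * t powr \<beta>) ^ r / Gamma (\<beta> * real r + (\<nu> + 1)))" for r
    unfolding a_def ceq power_mult_distrib using gp[of r] by simp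
  have aa: "\<bar>a r\<bar> = \<bar>\<theta>\<bar> ^ r / Gamma (\<beta> * real r + 1)" for r
    unfolding a_def using gp[of r] by (simp add: abs_divide power_abs)
  have aac: "\<bar>a r\<bar> * c r = (Gamma \<nu> * t powr \<nu>) * (\<bar>\<theta> * t powr \<beta>\<bar> ^ r / Gamma (\<beta> * real r + (\<nu> + 1)))" for r
    unfolding aa ceq abs_mult power_mult_distrib using gp[of r] by simp
  have d1: "1 \<le> \<nu> + 1" using nu by simp
  have sum_abs: "summable (\<lambda>r. \<bar>a r\<bar> * f r s)" for s
  proof (cases "0 \<le> s \<and> s < t")
    case True
    then have ts: "0 < t - s" by simp
    have "\<bar>a r\<bar> * f r s = s powr (\<nu> - 1) * (\<bar>\<theta> * (t - s) powr \<beta>\<bar> ^ r / Gamma (\<beta> * real r + 1))" for r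
      using True unfolding aa f_def by (simp add: power_mult_powr[OF ts] abs_mult)
    then show ?thesis
      using summable_mult[OF summable_mittag_leffler_abs[OF b order_refl, of "\<theta> * (t - s) powr \<beta>"]] by simp
  next
    case False
    then have "\<bar>a r\<bar> * f r s = 0" for r
      by (cases "s = t") (auto simp: f_def)
    then show ?thesis by (simp only: summable_zero)
  qed
  have main: "has_bochner_integral lborel (\<lambda>s. \<Sum>r. a r * f r s) (\<Sum>r. a r * c r)"
  proof (rule has_bochner_integral_suminf_mult[OF int _ sum_abs])
    show "0 \<le> f r x" for r x unfolding f_def by simp
    show "summable (\<lambda>r. \<bar>a r\<bar> * c r)"
      unfolding aac by (intro summable_mult summable_mittag_leffler_abs[OF b d1])
  qed
  have "summable (\<lambda>r. (\<theta> * t powr \<beta>) ^ r / Gamma (\<beta> * real r + (\<nu> + 1)))"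
    by (rule summable_mittag_leffler[OF b d1])
  then have val: "(\<Sum>r. a r * c r) = Gamma \<nu> * t powr \<nu> * mittag_leffler \<beta> (\<nu> + 1) (\<theta> * t powr \<beta>)"
    unfolding ac mittag_leffler_def by (rule suminf_mult)
  have meas: "mittag_leffler \<beta> 1 \<in> borel_measurable borel"
    using b by (intro mittag_leffler_measurable) auto
  \<comment> \<open>At \<open>s = t\<close> the convention \<open>0 powr 0 = 0\<close> makes the
    term \<open>r = 0\<close> vanish, although the Mittag-Leffler function is \<open>1\<close>
    there.\<close>
  have "AE s in lborel. s \<noteq> t" by (rule AE_lborel_singleton)
  then have ae: "AE s in lborel. (\<Sum>r. a r * f r s) =
      indicator {0..t} s * (s powr (\<nu> - 1) * mittag_leffler \<beta> 1 (\<theta> * (t - s) powr \<beta>))"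
  proof eventually_elim
    case (elim s)
    show ?case
    proof (cases "0 \<le> s \<and> s < t")
      case True
      then have ts: "0 < t - s" by simp
      have "a r * f r s = s powr (\<nu> - 1) * ((\<theta> * (t - s) powr \<beta>) ^ r / Gamma (\<beta> * real r + 1))" for r
        using True unfolding a_def f_def by (simp only: power_mult_powr[OF ts]) simp
      moreover have "summable (\<lambda>r. (\<theta> * (t - s) powr \<beta>) ^ r / Gamma (\<beta> * real r + 1))"
        by (rule summable_mittag_leffler[OF b order_refl])
      ultimately show ?thesis
        using True by (simp only: suminf_mult mittag_leffler_def) simp
    qed (use elim in \<open>auto simp: f_def\<close>)
  qed
  have m1: "(\<lambda>s. \<Sum>r. a r * f r s) \<in> borel_measurable lborel"
    using main by (auto simp: has_bochner_integral_iff)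
  have m2: "(\<lambda>s. indicator {0..t} s * (s powr (\<nu> - 1) * mittag_leffler \<beta> 1 (\<theta> * (t - s) powr \<beta>))) \<in> borel_measurable lborel"
    by (intro borel_measurable_times measurable_compose[OF _ meas]) auto
  show ?thesis
    using main unfolding val by (rule iffD1[OF has_bochner_integral_cong_AE[OF m1 m2 ae]])
qed

section \<open>A right-constant process at an independent random time\<close>

text \<open>Eventual agreement is pointwise convergence of indicators. The limit event is thereby
  proved measurable rather than assumed so, and dominated convergence by \<open>1\<close> gives the
  probabilities.\<close>

lemma (in prob_space) prob_tendsto_of_eventually_eq:
  fixes P :: "nat \<Rightarrow> 'a \<Rightarrow> bool" and Q :: "'a \<Rightarrow> bool"
  assumes Pm: "\<And>n. {\<omega>\<in>space M. P n \<omega>} \<in> events"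
    and ev: "\<And>\<omega>. \<omega> \<in> space M \<Longrightarrow> eventually (\<lambda>n. P n \<omega> = Q \<omega>) sequentially"
  shows "{\<omega>\<in>space M. Q \<omega>} \<in> events"
    and "(\<lambda>n. prob {\<omega>\<in>space M. P n \<omega>}) \<longlonglongrightarrow> prob {\<omega>\<in>space M. Q \<omega>}"
proof -
  let ?f = "\<lambda>n. indicator {\<omega>\<in>space M. P n \<omega>} :: 'a \<Rightarrow> real"
  let ?g = "indicator {\<omega>\<in>space M. Q \<omega>} :: 'a \<Rightarrow> real"
  have lim: "(\<lambda>n. ?f n \<omega>) \<longlonglongrightarrow> ?g \<omega>" if "\<omega> \<in> space M" for \<omega>
    by (rule tendsto_eventually, rule eventually_mono[OF ev[OF that]]) (auto simp: indicator_def)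
  have fm: "?f n \<in> borel_measurable M" for n using Pm by auto
  have "?g \<in> borel_measurable M"
    by (rule borel_measurable_LIMSEQ_real[OF lim fm])
  then show Q: "{\<omega>\<in>space M. Q \<omega>} \<in> events"
    by (subst (asm) borel_measurable_indicator_iff) (auto simp: Int_absorb2)
  have "(\<lambda>n. \<integral>\<omega>. ?f n \<omega> \<partial>M) \<longlonglongrightarrow> (\<integral>\<omega>. ?g \<omega> \<partial>M)"
    by (rule integral_dominated_convergence[where w="\<lambda>_. 1"]) (use Pm Q lim in auto)
  then show "(\<lambda>n. prob {\<omega>\<in>space M. P n \<omega>}) \<longlonglongrightarrow> prob {\<omega>\<in>space M. Q \<omega>}"
    using Pm Q by simp
qed

lemma (in prob_space) continuous_at_right_prob:
  fixes Q :: "real \<Rightarrow> 'a \<Rightarrow> bool"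
  assumes Qm: "\<And>s. 0 \<le> s \<Longrightarrow> {\<omega>\<in>space M. Q s \<omega>} \<in> events"
    and Qr: "\<And>\<omega> s. \<omega> \<in> space M \<Longrightarrow> 0 \<le> s \<Longrightarrow> eventually (\<lambda>u. Q u \<omega> = Q s \<omega>) (at_right s)"
    and t: "0 \<le> t"
  shows "continuous (at_right t) (\<lambda>s. prob {\<omega>\<in>space M. Q s \<omega>})"
  unfolding continuous_within
proof (rule tendsto_at_right_sequentially[where b="t + 1"])
  fix S :: "nat \<Rightarrow> real"
  assume S: "\<And>n. t < S n" "S \<longlonglongrightarrow> t"
  then have flt: "filterlim S (at_right t) sequentially"
    by (auto simp: filterlim_at less_imp_neq[symmetric])
  show "(\<lambda>n. prob {\<omega>\<in>space M. Q (S n) \<omega>}) \<longlonglongrightarrow> prob {\<omega>\<in>space M. Q t \<omega>}"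
  proof (rule prob_tendsto_of_eventually_eq(2))
    show "{\<omega> \<in> space M. Q (S n) \<omega>} \<in> events" for n
      using S(1)[of n] t by (intro Qm) linarith
    show "eventually (\<lambda>n. Q (S n) \<omega> = Q t \<omega>) sequentially" if "\<omega> \<in> space M" for \<omega>
      using eventually_compose_filterlim[OF Qr[OF that t] flt] .
  qed
qed simp

text \<open>The right endpoint of the grid cell of mesh \<open>1 / Suc n\<close> that contains
  \<open>x\<close>. It lies strictly above \<open>x\<close>, as right limits at \<open>x\<close>
  require, and within one mesh of it.\<close>

lemma filterlim_floor_at_right:
  fixes x :: real
  assumes x: "0 \<le> x"
  shows "filterlim (\<lambda>n. (real (nat \<lfloor>real (Suc n) * x\<rfloor>) + 1) / real (Suc n)) (at_right x) sequentially"
proof -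
  let ?f = "\<lambda>n. (real (nat \<lfloor>real (Suc n) * x\<rfloor>) + 1) / real (Suc n)"
  have lt: "x < ?f n" and le: "?f n \<le> x + inverse (real (Suc n))" for n
  proof -
    let ?j = "real (nat \<lfloor>real (Suc n) * x\<rfloor>)"
    have "0 \<le> real (Suc n) * x" using x by simp
    then have "?j = of_int \<lfloor>real (Suc n) * x\<rfloor>" by simp
    then have j: "?j \<le> real (Suc n) * x" "real (Suc n) * x < ?j + 1" by linarith+
    then show "x < ?f n" by (simp add: field_simps del: of_nat_Suc)
    have "?j / real (Suc n) \<le> x" using j(1) by (simp add: field_simps del: of_nat_Suc)
    then show "?f n \<le> x + inverse (real (Suc n))"
      by (simp add: add_divide_distrib inverse_eq_divide del: of_nat_Suc)
  qed
  have "?f \<longlonglongrightarrow> x"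
  proof (rule tendsto_sandwich[where f="\<lambda>_. x" and h="\<lambda>n. x + inverse (real (Suc n))"])
    show "(\<lambda>n. x + inverse (real (Suc n))) \<longlonglongrightarrow> x"
      using tendsto_add[OF tendsto_const LIMSEQ_inverse_real_of_nat, of x] by simp
  qed (use lt le in \<open>auto simp: less_imp_le simp del: of_nat_Suc\<close>)
  then show ?thesis using lt by (auto simp: filterlim_at less_imp_neq[symmetric] simp del: of_nat_Suc)
qed

text \<open>
  For \<open>R\<close> with countably many values the claim is a sum over those values. In general \<open>R\<close> is
  approximated strictly from above, where right-constancy of the paths passes to the limit.
\<close>

lemma (in prob_space) prob_at_independent_time:
  fixes Q :: "real \<Rightarrow> 'a \<Rightarrow> bool" and R :: "'a \<Rightarrow> real"
  defines "g \<equiv> \<lambda>s. prob {\<omega>\<in>space M. Q s \<omega>}"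
  assumes Qm: "\<And>s. 0 \<le> s \<Longrightarrow> {\<omega>\<in>space M. Q s \<omega>} \<in> events"
    and Qr: "\<And>\<omega> s. \<omega> \<in> space M \<Longrightarrow> 0 \<le> s \<Longrightarrow> eventually (\<lambda>u. Q u \<omega> = Q s \<omega>) (at_right s)"
    and Rm: "random_variable borel R"
    and R0: "\<And>\<omega>. \<omega> \<in> space M \<Longrightarrow> 0 \<le> R \<omega>"
    and ind: "\<And>s a. 0 \<le> s \<Longrightarrow> 0 < a \<Longrightarrow>
      prob {\<omega>\<in>space M. Q s \<omega> \<and> R \<omega> < a} = prob {\<omega>\<in>space M. Q s \<omega>} * prob {\<omega>\<in>space M. R \<omega> < a}"
  shows "{\<omega>\<in>space M. Q (R \<omega>) \<omega>} \<in> events"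
    and "(\<lambda>\<omega>. g (R \<omega>)) \<in> borel_measurable M"
    and "prob {\<omega>\<in>space M. Q (R \<omega>) \<omega>} = (\<integral>\<omega>. g (R \<omega>) \<partial>M)"
proof -
  note [measurable] = Rm
  define J where "J n \<omega> = nat \<lfloor>real (Suc n) * R \<omega>\<rfloor>" for n \<omega>
  define r where "r n j = (real j + 1) / real (Suc n)" for n j :: nat
  define I where "I n j = {\<omega>\<in>space M. J n \<omega> = j}" for n j
  have Jm [measurable]: "J n \<in> measurable M (count_space UNIV)" for n
    unfolding J_def by measurable
  have Im [measurable]: "I n j \<in> events" for n j unfolding I_def by measurable
  have rpos: "0 < r n j" for n j unfolding r_def by simp
  have J_iff: "J n \<omega> = j \<longleftrightarrow> real j / real (Suc n) \<le> R \<omega> \<and> R \<omega> < r n j"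
    if "\<omega> \<in> space M" for n j \<omega>
  proof -
    have "0 \<le> real (Suc n) * R \<omega>" using R0[OF that] by simp
    then have "J n \<omega> = j \<longleftrightarrow> real j \<le> real (Suc n) * R \<omega> \<and> real (Suc n) * R \<omega> < real j + 1"
      unfolding J_def by (simp add: nat_eq_iff floor_eq_iff conj_commute)
    also have "\<dots> \<longleftrightarrow> real j / real (Suc n) \<le> R \<omega> \<and> R \<omega> < r n j"
      unfolding r_def by (simp add: field_simps del: of_nat_Suc)
    finally show ?thesis .
  qed
  have g01: "0 \<le> g s" "g s \<le> 1" for s unfolding g_def by auto
  have cells: "prob {\<omega>\<in>space M. Q (r n j) \<omega> \<and> J n \<omega> = j} = g (r n j) * prob (I n j)" for n j
  proof -
    let ?a = "real j / real (Suc n)"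
    let ?s = "r n j"
    have I_eq: "I n j = {\<omega>\<in>space M. \<not> R \<omega> < ?a \<and> R \<omega> < ?s}"
      unfolding I_def by (rule Collect_cong) (metis J_iff not_less)
    have le: "?a \<le> ?s" unfolding r_def by (simp add: divide_right_mono)
    \<comment> \<open>A cell is a difference of two events \<open>R < a\<close>. The leftmost cell
      has lower end \<open>a = 0\<close>, which \<open>ind\<close> does not cover; there both events
      are empty as \<open>R\<close> is nonnegative.\<close>
    have indlt: "prob {\<omega>\<in>space M. Q ?s \<omega> \<and> R \<omega> < a} = g ?s * prob {\<omega>\<in>space M. R \<omega> < a}"
      if "0 \<le> a" for a
    proof (cases "a = 0")
      case True
      then have "{\<omega>\<in>space M. R \<omega> < a} = {}" "{\<omega>\<in>space M. Q ?s \<omega> \<and> R \<omega> < a} = {}"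
        using R0 by (auto simp: not_less)
      then show ?thesis by (simp only: measure_empty mult_zero_right)
    next
      case False
      then show ?thesis unfolding g_def using that rpos[of n j] by (intro ind) auto
    qed
    have m1: "{\<omega>\<in>space M. Q ?s \<omega> \<and> R \<omega> < a} \<in> events" for a
    proof -
      have "{\<omega>\<in>space M. Q ?s \<omega>} \<inter> {\<omega>\<in>space M. R \<omega> < a} \<in> events"
        using Qm[of ?s] rpos[of n j] by (intro sets.Int) auto
      also have "{\<omega>\<in>space M. Q ?s \<omega>} \<inter> {\<omega>\<in>space M. R \<omega> < a} = {\<omega>\<in>space M. Q ?s \<omega> \<and> R \<omega> < a}" by auto
      finally show ?thesis .
    qed
    have "{\<omega>\<in>space M. Q ?s \<omega> \<and> J n \<omega> = j} =
      {\<omega>\<in>space M. Q ?s \<omega> \<and> R \<omega> < ?s} - {\<omega>\<in>space M. Q ?s \<omega> \<and> R \<omega> < ?a}"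
    proof -
      have "{\<omega>\<in>space M. Q ?s \<omega> \<and> J n \<omega> = j} = {\<omega>\<in>space M. Q ?s \<omega> \<and> \<omega> \<in> I n j}"
        by (auto simp: I_def)
      then show ?thesis unfolding I_eq by auto
    qed
    then have "prob {\<omega>\<in>space M. Q ?s \<omega> \<and> J n \<omega> = j} =
      prob {\<omega>\<in>space M. Q ?s \<omega> \<and> R \<omega> < ?s} - prob {\<omega>\<in>space M. Q ?s \<omega> \<and> R \<omega> < ?a}"
      using le m1 by (simp only:) (intro finite_measure_Diff, auto)
    also have "\<dots> = g ?s * (prob {\<omega>\<in>space M. R \<omega> < ?s} - prob {\<omega>\<in>space M. R \<omega> < ?a})"
      using rpos[of n j] by (simp add: indlt right_diff_distrib del: of_nat_Suc)
    also have "prob {\<omega>\<in>space M. R \<omega> < ?s} - prob {\<omega>\<in>space M. R \<omega> < ?a} =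
      prob ({\<omega>\<in>space M. R \<omega> < ?s} - {\<omega>\<in>space M. R \<omega> < ?a})"
      using le by (intro finite_measure_Diff[symmetric]) auto
    also have "{\<omega>\<in>space M. R \<omega> < ?s} - {\<omega>\<in>space M. R \<omega> < ?a} = I n j"
      unfolding I_eq by auto
    finally show ?thesis .
  qed
  have cells_m: "{\<omega>\<in>space M. Q (r n j) \<omega> \<and> J n \<omega> = j} \<in> events" for n j
  proof -
    have "{\<omega>\<in>space M. Q (r n j) \<omega>} \<inter> I n j \<in> events"
      using Qm[of "r n j"] rpos[of n j] by (intro sets.Int) auto
    also have "{\<omega>\<in>space M. Q (r n j) \<omega>} \<inter> I n j = {\<omega>\<in>space M. Q (r n j) \<omega> \<and> J n \<omega> = j}"
      by (auto simp: I_def)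
    finally show ?thesis .
  qed
  have An: "{\<omega>\<in>space M. Q (r n (J n \<omega>)) \<omega>} = (\<Union>j. {\<omega>\<in>space M. Q (r n j) \<omega> \<and> J n \<omega> = j})" for n
    by auto
  have An_m: "{\<omega>\<in>space M. Q (r n (J n \<omega>)) \<omega>} \<in> events" for n
    unfolding An using cells_m by (intro sets.countable_UN) auto
  have disc: "has_bochner_integral M (\<lambda>\<omega>. g (r n (J n \<omega>))) (prob {\<omega>\<in>space M. Q (r n (J n \<omega>)) \<omega>})" for n
  proof -
    have sums1: "(\<lambda>j. prob {\<omega>\<in>space M. Q (r n j) \<omega> \<and> J n \<omega> = j}) sums prob {\<omega>\<in>space M. Q (r n (J n \<omega>)) \<omega>}"
      unfolding An using cells_m by (intro finite_measure_UNION) (auto simp: disjoint_family_on_def)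
    \<comment> \<open>On \<open>space M\<close> exactly one term of this series carries a nonzero
      indicator, the one with \<open>j = J n \<omega>\<close>, so the series is
      \<open>g (r n (J n \<omega>))\<close>.\<close>
    have "has_bochner_integral M (\<lambda>\<omega>. \<Sum>j. g (r n j) * indicator (I n j) \<omega>) (\<Sum>j. g (r n j) * prob (I n j))"
    proof (rule has_bochner_integral_suminf_mult)
      show "has_bochner_integral M (indicator (I n j)) (prob (I n j))" for j
        using Im[of n j] by (intro has_bochner_integral_real_indicator) (auto simp: emeasure_eq_measure)
      show "summable (\<lambda>j. \<bar>g (r n j)\<bar> * indicator (I n j) x)" for x
        by (rule summable_finite[of "{J n x}"]) (auto simp: I_def)
      show "summable (\<lambda>j. \<bar>g (r n j)\<bar> * prob (I n j))"
        using sums1 g01 unfolding cells by (simp add: sums_iff)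
    qed auto
    also have "(\<Sum>j. g (r n j) * prob (I n j)) = prob {\<omega>\<in>space M. Q (r n (J n \<omega>)) \<omega>}"
      using sums1 unfolding cells by (simp add: sums_iff)
    finally have "has_bochner_integral M (\<lambda>\<omega>. \<Sum>j. g (r n j) * indicator (I n j) \<omega>)
      (prob {\<omega>\<in>space M. Q (r n (J n \<omega>)) \<omega>})" .
    moreover have "(\<Sum>j. g (r n j) * indicator (I n j) \<omega>) = g (r n (J n \<omega>))" if "\<omega> \<in> space M" for \<omega>
      using that by (subst suminf_finite[of "{J n \<omega>}"]) (auto simp: I_def)
    ultimately show ?thesis
      by (subst has_bochner_integral_cong[OF refl _ refl]) auto
  qed
  have flt: "filterlim (\<lambda>n. r n (J n \<omega>)) (at_right (R \<omega>)) sequentially" if "\<omega> \<in> space M" for \<omega>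
    unfolding r_def J_def by (rule filterlim_floor_at_right[OF R0[OF that]])
  have gr: "continuous (at_right s) g" if "0 \<le> s" for s
    unfolding g_def by (rule continuous_at_right_prob[OF Qm Qr that])
  have glim: "(\<lambda>n. g (r n (J n \<omega>))) \<longlonglongrightarrow> g (R \<omega>)" if "\<omega> \<in> space M" for \<omega>
    using filterlim_compose[OF gr[OF R0[OF that], unfolded continuous_within] flt[OF that]] .
  have gm: "(\<lambda>\<omega>. g (r n (J n \<omega>))) \<in> borel_measurable M" for n
    using disc[of n] by (auto simp: has_bochner_integral_iff)
  show gRm: "(\<lambda>\<omega>. g (R \<omega>)) \<in> borel_measurable M"
    by (rule borel_measurable_LIMSEQ_real[OF glim gm])
  have ev: "eventually (\<lambda>n. Q (r n (J n \<omega>)) \<omega> = Q (R \<omega>) \<omega>) sequentially" if "\<omega> \<in> space M" for \<omega>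
    using eventually_compose_filterlim[OF Qr[OF that R0[OF that]] flt[OF that]] .
  show "{\<omega>\<in>space M. Q (R \<omega>) \<omega>} \<in> events"
    by (rule prob_tendsto_of_eventually_eq(1)[OF An_m ev])
  have lim1: "(\<lambda>n. prob {\<omega>\<in>space M. Q (r n (J n \<omega>)) \<omega>}) \<longlonglongrightarrow> prob {\<omega>\<in>space M. Q (R \<omega>) \<omega>}"
    by (rule prob_tendsto_of_eventually_eq(2)[OF An_m ev])
  have "(\<lambda>n. \<integral>\<omega>. g (r n (J n \<omega>)) \<partial>M) \<longlonglongrightarrow> (\<integral>\<omega>. g (R \<omega>) \<partial>M)"
    by (rule integral_dominated_convergence[where w="\<lambda>_. 1"]) (use gRm gm glim g01 in auto)
  then have lim2: "(\<lambda>n. prob {\<omega>\<in>space M. Q (r n (J n \<omega>)) \<omega>}) \<longlonglongrightarrow> (\<integral>\<omega>. g (R \<omega>) \<partial>M)"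
    using disc by (simp add: has_bochner_integral_iff)
  show "prob {\<omega>\<in>space M. Q (R \<omega>) \<omega>} = (\<integral>\<omega>. g (R \<omega>) \<partial>M)"
    by (rule LIMSEQ_unique[OF lim1 lim2])
qed

section \<open>The Yule process\<close>

text \<open>A sum of independent exponentials of rates \<open>l, 2 * l, ..., k * l\<close> is
  distributed as the maximum of \<open>k\<close> independent exponentials of rate \<open>l\<close>.
  The proof is by induction, integrating over the last holding time; the \<open>k + 1\<close> in its
  rate turns the integrand into an exact derivative.\<close>

lemma (in prob_space) yule_passage_cdf:
  fixes S :: "nat \<Rightarrow> 'a \<Rightarrow> real" and l :: real
  assumes l: "0 < l"
    and ind: "indep_vars (\<lambda>_. borel) S {1..}"
    and dist: "\<And>k. 1 \<le> k \<Longrightarrow> distributed M lborel (S k) (\<lambda>x. ennreal (exponential_density (l * real k) x))"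
    and pos: "\<And>k \<omega>. 1 \<le> k \<Longrightarrow> \<omega> \<in> space M \<Longrightarrow> 0 < S k \<omega>"
    and r: "0 \<le> r"
  shows "prob {\<omega>\<in>space M. (\<Sum>i=1..k. S i \<omega>) \<le> r} = (1 - exp (- l * r)) ^ k"
  using r
proof (induction k arbitrary: r)
  case 0
  then show ?case by (simp add: prob_space)
next
  case (Suc k)
  let ?T = "S (Suc k)"
  let ?Z = "\<lambda>\<omega>. \<Sum>i=1..k. S i \<omega>"
  let ?d = "\<lambda>x. ennreal (exponential_density (l * real (Suc k)) x)"
  have Sm: "random_variable borel (S i)" if "1 \<le> i" for i
    using ind that unfolding indep_vars_def by auto
  then have Zm [measurable]: "random_variable borel ?Z" by (intro borel_measurable_sum) auto
  have Tm [measurable]: "random_variable borel ?T" by (rule Sm) simp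
  have iv: "indep_var borel ?T borel ?Z"
    by (rule indep_vars_sum) (auto intro: indep_vars_subset[OF ind])
  have half_plane: "{p :: real \<times> real. fst p + snd p \<le> r} \<in> sets (borel \<Otimes>\<^sub>M borel)"
  proof -
    have "{p \<in> space (borel \<Otimes>\<^sub>M borel). fst p + snd p \<le> r} \<in> sets (borel \<Otimes>\<^sub>M (borel :: real measure))"
      by measurable
    then show ?thesis by (simp add: space_pair_measure)
  qed
  have pair: "(\<lambda>\<omega>. (?T \<omega>, ?Z \<omega>)) \<in> M \<rightarrow>\<^sub>M borel \<Otimes>\<^sub>M borel"
    by (intro measurable_Pair Tm Zm)
  have "emeasure M {\<omega>\<in>space M. (\<Sum>i=1..Suc k. S i \<omega>) \<le> r} =
    emeasure (distr M (borel \<Otimes>\<^sub>M borel) (\<lambda>\<omega>. (?T \<omega>, ?Z \<omega>))) {p. fst p + snd p \<le> r}"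
    by (subst emeasure_distr[OF pair half_plane]) (auto intro!: arg_cong[where f="emeasure M"] simp: add.commute)
  also have "\<dots> = emeasure (distr M borel ?T \<Otimes>\<^sub>M distr M borel ?Z) {p. fst p + snd p \<le> r}"
    using iv by (simp add: indep_var_distribution_eq)
  also have "\<dots> = (\<integral>\<^sup>+x. emeasure (distr M borel ?Z) (Pair x -` {p. fst p + snd p \<le> r}) \<partial>distr M borel ?T)"
  proof (rule sigma_finite_measure.emeasure_pair_measure_alt)
    show "sigma_finite_measure (distr M borel ?Z)"
      by (intro prob_space_imp_sigma_finite prob_space_distr Zm)
    show "{p. fst p + snd p \<le> r} \<in> sets (distr M borel ?T \<Otimes>\<^sub>M distr M borel ?Z)"
      using half_plane by (simp cong: sets_pair_measure_cong)
  qed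
  also have "distr M borel ?T = density lborel ?d"
    using distributed_distr_eq_density[OF dist[of "Suc k"]]
    by (simp cong: distr_cong)
  also have "(\<integral>\<^sup>+x. emeasure (distr M borel ?Z) (Pair x -` {p. fst p + snd p \<le> r}) \<partial>density lborel ?d)
    = (\<integral>\<^sup>+x. emeasure M {\<omega>\<in>space M. ?Z \<omega> \<le> r - x} \<partial>density lborel ?d)"
  proof (rule nn_integral_cong)
    fix x :: real
    have e: "Pair x -` {p. fst p + snd p \<le> r} = {..r - x}" by (auto simp: algebra_simps)
    show "emeasure (distr M borel ?Z) (Pair x -` {p. fst p + snd p \<le> r}) = emeasure M {\<omega>\<in>space M. ?Z \<omega> \<le> r - x}"
      unfolding e by (subst emeasure_distr[OF Zm]) (auto intro!: arg_cong[where f="emeasure M"])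
  qed
  also have "\<dots> = (\<integral>\<^sup>+x. ?d x * emeasure M {\<omega>\<in>space M. ?Z \<omega> \<le> r - x} \<partial>lborel)"
  proof (rule nn_integral_density)
    \<comment> \<open>A monotone function is Borel, and the distribution function read at
      \<open>r - x\<close> decreases in \<open>x\<close>; hence the two minus signs.\<close>
    have "mono (\<lambda>x. - prob {\<omega>\<in>space M. ?Z \<omega> \<le> r - x})"
      using Zm by (auto intro!: monoI finite_measure_mono)
    then have "(\<lambda>x. - (- prob {\<omega>\<in>space M. ?Z \<omega> \<le> r - x})) \<in> borel_measurable borel"
      by (intro borel_measurable_uminus borel_measurable_mono)
    then show "(\<lambda>x. emeasure M {\<omega>\<in>space M. ?Z \<omega> \<le> r - x}) \<in> borel_measurable lborel"
      by (simp add: emeasure_eq_measure)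
  qed auto
  also have "\<dots> = (\<integral>\<^sup>+x. ennreal (real (Suc k) * (exp (- l * x) - exp (- l * r)) ^ k * (l * exp (- l * x))) * indicator {0..r} x \<partial>lborel)"
  proof (rule nn_integral_cong)
    fix x :: real
    have Z0: "0 \<le> ?Z \<omega>" if "\<omega> \<in> space M" for \<omega>
      using pos that by (intro sum_nonneg) (auto intro: less_imp_le)
    consider "x < 0" | "r < x" "0 \<le> x" | "0 \<le> x" "x \<le> r" by linarith
    then show "?d x * emeasure M {\<omega>\<in>space M. ?Z \<omega> \<le> r - x} =
      ennreal (real (Suc k) * (exp (- l * x) - exp (- l * r)) ^ k * (l * exp (- l * x))) * indicator {0..r} x"
    proof cases
      case 1
      then show ?thesis by (simp add: exponential_density_def)
    next
      case 2
      then have e: "{\<omega>\<in>space M. ?Z \<omega> \<le> r - x} = {}" using Z0 by force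
      show ?thesis unfolding e using 2 by simp
    next
      case 3
      have ex: "exp (- l * x) * (1 - exp (- l * (r - x))) = exp (- l * x) - exp (- l * r)"
        by (simp add: right_diff_distrib exp_add[symmetric] algebra_simps)
      have "exp (- (l * real (Suc k)) * x) = exp (- l * x) * exp (- l * x) ^ k"
        using exp_of_nat_mult[of "Suc k" "- l * x"] by (simp add: algebra_simps)
      then have "exponential_density (l * real (Suc k)) x * (1 - exp (- l * (r - x))) ^ k =
        real (Suc k) * (exp (- l * x) * (1 - exp (- l * (r - x)))) ^ k * (l * exp (- l * x))"
        using 3 by (simp add: exponential_density_def power_mult_distrib mult_ac del: of_nat_Suc)
      then have "exponential_density (l * real (Suc k)) x * (1 - exp (- l * (r - x))) ^ k =
        real (Suc k) * (exp (- l * x) - exp (- l * r)) ^ k * (l * exp (- l * x))"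
        unfolding ex .
      moreover have "emeasure M {\<omega>\<in>space M. ?Z \<omega> \<le> r - x} = ennreal ((1 - exp (- l * (r - x))) ^ k)"
        using Suc.IH[of "r - x"] 3 by (simp add: emeasure_eq_measure)
      moreover have "0 \<le> exponential_density (l * real (Suc k)) x"
        using l by (intro exponential_density_nonneg) auto
      ultimately show ?thesis using 3 by (simp add: ennreal_mult'[symmetric])
    qed
  qed
  \<comment> \<open>The antiderivative is
    \<open>- ((exp (- l * x) - exp (- l * r)) ^ Suc k)\<close>, which vanishes at
    \<open>x = r\<close>.\<close>
  also have "\<dots> = ennreal (- ((exp (- l * r) - exp (- l * r)) ^ Suc k) - - ((exp (- l * 0) - exp (- l * r)) ^ Suc k))"
  proof (rule nn_integral_FTC_Icc)
    fix x assume "x \<in> {0..r}"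
    then have x: "0 \<le> x" "x \<le> r" by auto
    have "DERIV (\<lambda>x. exp (- l * x) - exp (- l * r)) x :> - (l * exp (- l * x))"
      by (auto intro!: derivative_eq_intros)
    from DERIV_minus[OF DERIV_power_Suc[OF this, of k]]
    show "DERIV (\<lambda>x. - ((exp (- l * x) - exp (- l * r)) ^ Suc k)) x :>
      real (Suc k) * (exp (- l * x) - exp (- l * r)) ^ k * (l * exp (- l * x))"
      by (rule DERIV_cong) (simp add: mult_ac)
    show "0 \<le> real (Suc k) * (exp (- l * x) - exp (- l * r)) ^ k * (l * exp (- l * x))"
      using x l by (intro mult_nonneg_nonneg zero_le_power) auto
  qed (use Suc.prems in auto)
  also have "\<dots> = ennreal ((1 - exp (- l * r)) ^ Suc k)" by simp
  finally show ?case
    using l Suc.prems unfolding emeasure_eq_measure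
    by (subst (asm) ennreal_inj) (auto intro!: zero_le_power)
qed

text \<open>The hypothesis at \<open>k = Y t\<close> says \<open>t < Z (Y t)\<close>, and no jump
  can occur in between: \<open>Z (Y t)\<close> is the time at which the path first exceeds its
  current value.\<close>

lemma right_constant_of_passage_times:
  fixes Y :: "real \<Rightarrow> nat" and Z :: "nat \<Rightarrow> real"
  assumes iff: "\<And>t k. 0 \<le> t \<Longrightarrow> k < Y t \<longleftrightarrow> Z k \<le> t" and t: "0 \<le> t"
  shows "eventually (\<lambda>s. Y s = Y t) (at_right t)"
proof -
  have lt: "t < Z (Y t)" using iff[OF t, of "Y t"] by simp
  have "eventually (\<lambda>s. s \<in> {t<..<Z (Y t)}) (at_right t)"
    by (rule eventually_at_right_real[OF lt])
  then show ?thesis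
  proof eventually_elim
    case (elim s)
    then have s: "0 \<le> s" "t \<le> s" "s < Z (Y t)" using t by auto
    have "k < Y s \<longleftrightarrow> k < Y t" for k
    proof
      assume "k < Y t"
      then show "k < Y s" using iff[OF t, of k] iff[OF s(1), of k] s(2) by simp
    next
      assume "k < Y s"
      moreover have "Y s \<le> Y t" using iff[OF s(1), of "Y t"] s(3) by simp
      ultimately show "k < Y t" by simp
    qed
    then show ?case by (metis linorder_neqE_nat less_irrefl)
  qed
qed

lemma (in prob_space) yule_process:
  fixes l :: real
  assumes l: "0 < l" and Y: "pure_birth_process M (\<lambda>k. l * real k) Y"
  shows "\<And>\<omega> t. \<omega> \<in> space M \<Longrightarrow> 0 \<le> t \<Longrightarrow> eventually (\<lambda>s. Y s \<omega> = Y t \<omega>) (at_right t)"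
    and "\<And>r k. 0 \<le> r \<Longrightarrow> prob {\<omega>\<in>space M. k < Y r \<omega>} = (1 - exp (- l * r)) ^ k"
proof -
  obtain S where S: "indep_vars (\<lambda>_. borel) S {1..}"
    "\<And>k. 1 \<le> k \<Longrightarrow> distributed M lborel (S k) (\<lambda>x. ennreal (exponential_density (l * real k) x))"
    "\<And>k \<omega>. 1 \<le> k \<Longrightarrow> \<omega> \<in> space M \<Longrightarrow> 0 < S k \<omega>"
    "\<And>t \<omega> k. 0 \<le> t \<Longrightarrow> \<omega> \<in> space M \<Longrightarrow> k < Y t \<omega> \<longleftrightarrow> (\<Sum>i=1..k. S i \<omega>) \<le> t"
    using Y unfolding pure_birth_process_def by blast
  show "eventually (\<lambda>s. Y s \<omega> = Y t \<omega>) (at_right t)" if "\<omega> \<in> space M" "0 \<le> t" for \<omega> t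
    by (rule right_constant_of_passage_times[where Z="\<lambda>k. \<Sum>i=1..k. S i \<omega>"]) (use that S(4) in auto)
  show "prob {\<omega>\<in>space M. k < Y r \<omega>} = (1 - exp (- l * r)) ^ k" if "0 \<le> r" for r k
  proof -
    have "{\<omega>\<in>space M. k < Y r \<omega>} = {\<omega>\<in>space M. (\<Sum>i=1..k. S i \<omega>) \<le> r}"
      using S(4)[OF that] by auto
    then show ?thesis using yule_passage_cdf[OF l S(1-3) that] by simp
  qed
qed

section \<open>Events of a process\<close>

lemma process_events_sigma_algebra: "sigma_algebra (space M) (process_events M S X)"
  unfolding process_events_def
proof (intro sigma_algebra_sigma_sets UN_least subsetI PowI)
  fix t A \<omega> assume "A \<in> sets (vimage_algebra (space M) (X t) S)" "\<omega> \<in> A"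
  then show "\<omega> \<in> space M" using sets.sets_into_space[of A "vimage_algebra (space M) (X t) S"] by auto
qed

lemma process_events_Collect:
  assumes t: "0 \<le> t" and P: "{x. P x} \<in> sets S" and S: "space S = UNIV"
  shows "{\<omega>\<in>space M. P (X t \<omega>)} \<in> process_events M S X"
proof -
  have "X t -` {x. P x} \<inter> space M \<in> sets (vimage_algebra (space M) (X t) S)"
    using P by (rule in_vimage_algebra)
  also have "X t -` {x. P x} \<inter> space M = {\<omega>\<in>space M. P (X t \<omega>)}" by auto
  finally show ?thesis
    unfolding process_events_def using t by (intro sigma_sets.Basic) auto
qed

section \<open>The inverse of a right-continuous increasing path\<close>

text \<open>Unlike \<^const>\<open>inverse_process\<close>, this has the value \<open>0\<close> when the path never exceeds \<open>s\<close>.\<close>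

definition inverse_time :: "(real \<Rightarrow> 'a \<Rightarrow> real) \<Rightarrow> real \<Rightarrow> 'a \<Rightarrow> real" where
  "inverse_time D s \<omega> = (if \<exists>r\<ge>0. s < D r \<omega> then inverse_process D s \<omega> else 0)"

lemma inverse_process_nonneg:
  assumes "\<exists>r\<ge>0. s < D r \<omega>"
  shows "0 \<le> inverse_process D s \<omega>"
  unfolding inverse_process_def using assms by (intro cInf_greatest) auto

lemma inverse_process_le:
  assumes "0 \<le> r" "s < D r \<omega>"
  shows "inverse_process D s \<omega> \<le> r"
  unfolding inverse_process_def using assms by (intro cInf_lower bdd_belowI[of _ 0]) auto

text \<open>Strict on the left because the infimum need not be attained: at \<open>r\<close> equal
  to the inverse itself, \<open>s < D r \<omega>\<close> can fail.\<close>

lemma inverse_process_less_iff: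
  assumes ex: "\<exists>r\<ge>0. s < D r \<omega>"
  shows "inverse_process D s \<omega> < a \<longleftrightarrow> (\<exists>r. 0 \<le> r \<and> r < a \<and> s < D r \<omega>)"
proof
  assume "inverse_process D s \<omega> < a"
  then obtain r where "r \<in> {r. 0 \<le> r \<and> s < D r \<omega>}" "r < a"
    unfolding inverse_process_def using cInf_lessD[of "{r. 0 \<le> r \<and> s < D r \<omega>}" a] ex by auto
  then show "\<exists>r. 0 \<le> r \<and> r < a \<and> s < D r \<omega>" by auto
next
  assume "\<exists>r. 0 \<le> r \<and> r < a \<and> s < D r \<omega>"
  then show "inverse_process D s \<omega> < a"
    using inverse_process_le le_less_trans by metis
qed

lemma inverse_process_mono:
  assumes "s \<le> u" "\<exists>r\<ge>0. u < D r \<omega>"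
  shows "inverse_process D s \<omega> \<le> inverse_process D u \<omega>"
  unfolding inverse_process_def using assms
  by (intro cInf_superset_mono bdd_belowI[of _ 0]) auto

text \<open>Right continuity of the inverse, in quantified form. A witness \<open>r < a\<close> with
  \<open>s < D r \<omega>\<close> remains a witness for every \<open>u\<close> below
  \<open>D r \<omega>\<close>.\<close>

lemma inverse_process_right:
  assumes ex: "\<exists>r\<ge>0. s < D r \<omega>" and a: "inverse_process D s \<omega> < a"
  shows "eventually (\<lambda>u. inverse_process D u \<omega> \<in> {inverse_process D s \<omega>..<a} \<and> (\<exists>r\<ge>0. u < D r \<omega>)) (at_right s)"
proof -
  obtain r where r: "0 \<le> r" "r < a" "s < D r \<omega>"
    using a inverse_process_less_iff[of s D \<omega> a, OF ex] by auto
  have "eventually (\<lambda>u. u \<in> {s<..<D r \<omega>}) (at_right s)"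
    by (rule eventually_at_right_real[OF r(3)])
  then show ?thesis
  proof eventually_elim
    case (elim u)
    then have u: "s \<le> u" "u < D r \<omega>" by auto
    then have "\<exists>r\<ge>0. u < D r \<omega>" using r by auto
    then show ?case
      using inverse_process_mono[of s u D \<omega>] inverse_process_le[of r u D \<omega>] u r by auto
  qed
qed

text \<open>
  This holds even for paths that stay bounded: once the defining set of the inverse is empty it
  remains so, and the inverse keeps the junk value \<open>Inf {}\<close>.
\<close>

lemma right_constant_compose_inverse_process:
  fixes Y :: "real \<Rightarrow> 'b"
  assumes Y: "\<And>r. 0 \<le> r \<Longrightarrow> eventually (\<lambda>u. Y u = Y r) (at_right r)"
  shows "eventually (\<lambda>u. Y (inverse_process D u \<omega>) = Y (inverse_process D s \<omega>)) (at_right s)"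
proof (cases "\<exists>r\<ge>0. s < D r \<omega>")
  case True
  let ?E = "inverse_process D s \<omega>"
  obtain b where b: "?E < b" "\<And>u. ?E < u \<Longrightarrow> u < b \<Longrightarrow> Y u = Y ?E"
    using Y[OF inverse_process_nonneg[of s D \<omega>, OF True]] by (auto simp: eventually_at_right_field)
  show ?thesis
    using inverse_process_right[of s D \<omega>, OF True b(1)]
    by eventually_elim (use b(2) in \<open>auto simp: le_less\<close>)
next
  case False
  have "eventually (\<lambda>u. s < u) (at_right s)" by (simp add: eventually_at_right_less)
  then show ?thesis
  proof eventually_elim
    case (elim u)
    then have "{r. 0 \<le> r \<and> u < D r \<omega>} = {r. 0 \<le> r \<and> s < D r \<omega>}"
      using False by (auto simp: not_less)
    then show ?case by (simp add: inverse_process_def)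
  qed
qed

text \<open>Holds for every outcome, which \<open>Inf {}\<close> would not guarantee on the null set
  of bounded paths; \<open>prob_at_independent_time\<close> needs a nonnegative time
  everywhere.\<close>

lemma inverse_time_nonneg: "0 \<le> inverse_time D s \<omega>"
  by (simp add: inverse_time_def inverse_process_nonneg)

text \<open>Monotone paths reduce the two existential statements to countably many times: some
  \<open>r < a\<close> may be moved up to a rational, an arbitrary \<open>r\<close> up to a natural
  number. Paths that never exceed \<open>s\<close> belong to the event, since their value
  \<open>0\<close> is below \<open>a\<close>.\<close>

lemma inverse_time_less_events:
  assumes mono: "\<And>\<omega>. \<omega> \<in> space M \<Longrightarrow> mono_on {0..} (\<lambda>r. D r \<omega>)" and a: "0 < a"
  shows "{\<omega>\<in>space M. inverse_time D s \<omega> < a} \<in> process_events M borel D"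
proof -
  interpret PE: sigma_algebra "space M" "process_events M borel D"
    by (rule process_events_sigma_algebra)
  let ?L = "\<lambda>r. {\<omega>\<in>space M. s < D r \<omega>}"
  have L: "?L r \<in> process_events M borel D" if "0 \<le> r" for r
    using process_events_Collect[where P="\<lambda>x. s < x" and S="borel :: real measure" and X=D] that by simp
  have ex: "(\<exists>r\<ge>0. s < D r \<omega>) \<longleftrightarrow> (\<exists>n::nat. s < D (real n) \<omega>)" if "\<omega> \<in> space M" for \<omega>
  proof
    assume "\<exists>r\<ge>0. s < D r \<omega>"
    then obtain r where r: "0 \<le> r" "s < D r \<omega>" by auto
    obtain n :: nat where "r \<le> real n" using real_arch_simple by auto
    then have "D r \<omega> \<le> D (real n) \<omega>"
      using mono_onD[OF mono[OF that], of r "real n"] r by auto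
    with r show "\<exists>n::nat. s < D (real n) \<omega>" by (auto intro: less_le_trans)
  next
    assume "\<exists>n::nat. s < D (real n) \<omega>"
    then show "\<exists>r\<ge>0. s < D r \<omega>" using of_nat_0_le_iff by blast
  qed
  have exa: "(\<exists>r. 0 \<le> r \<and> r < a \<and> s < D r \<omega>) \<longleftrightarrow> (\<exists>q\<in>\<rat> \<inter> {0..<a}. s < D q \<omega>)" if "\<omega> \<in> space M" for \<omega>
  proof
    assume "\<exists>r. 0 \<le> r \<and> r < a \<and> s < D r \<omega>"
    then obtain r where r: "0 \<le> r" "r < a" "s < D r \<omega>" by auto
    obtain q where q: "q \<in> \<rat>" "r < q" "q < a" using Rats_dense_in_real[OF r(2)] by auto
    then have "D r \<omega> \<le> D q \<omega>"
      using mono_onD[OF mono[OF that], of r q] r by auto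
    with r q show "\<exists>q\<in>\<rat> \<inter> {0..<a}. s < D q \<omega>" by (auto intro!: bexI[of _ q])
  qed auto
  have "{\<omega>\<in>space M. inverse_time D s \<omega> < a} =
    (space M - (\<Union>n::nat. ?L (real n))) \<union> (\<Union>q\<in>\<rat> \<inter> {0..<a}. ?L q)"
  proof (rule set_eqI)
    fix \<omega>
    show "\<omega> \<in> {\<omega>\<in>space M. inverse_time D s \<omega> < a} \<longleftrightarrow>
      \<omega> \<in> (space M - (\<Union>n::nat. ?L (real n))) \<union> (\<Union>q\<in>\<rat> \<inter> {0..<a}. ?L q)"
    proof (cases "\<omega> \<in> space M")
      case True
      have "inverse_time D s \<omega> < a \<longleftrightarrow>
        \<not> (\<exists>n::nat. s < D (real n) \<omega>) \<or> (\<exists>q\<in>\<rat> \<inter> {0..<a}. s < D q \<omega>)"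
        using a inverse_process_less_iff[of s D \<omega> a]
        by (auto simp: inverse_time_def ex[OF True, symmetric] exa[OF True, symmetric])
      then show ?thesis using True by auto
    qed auto
  qed
  also have "\<dots> \<in> process_events M borel D"
  proof (intro PE.Un PE.Diff PE.top PE.countable_UN PE.countable_UN')
    show "countable (\<rat> \<inter> {0..<a})" by (intro countable_Int1 countable_rat)
  qed (use L in auto)
  finally show ?thesis .
qed

section \<open>The inverse stable subordinator\<close>

text \<open>Approximation of the time by grid points strictly to its right gives countably many
  measurable pieces for each mesh. The joint measurability is what Fubini requires in
  \<open>laplace_inverse_time\<close>; \<open>max 0\<close> extends the process to negative
  times.\<close>

lemma measurable_right_continuous_process:
  fixes X :: "real \<Rightarrow> 'a \<Rightarrow> real"
  assumes Xm: "\<And>r. 0 \<le> r \<Longrightarrow> X r \<in> borel_measurable M"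
    and Xr: "\<And>\<omega> r. \<omega> \<in> space M \<Longrightarrow> 0 \<le> r \<Longrightarrow> continuous (at_right r) (\<lambda>r. X r \<omega>)"
  shows "(\<lambda>(r, \<omega>). X (max 0 r) \<omega>) \<in> borel_measurable (borel \<Otimes>\<^sub>M M)"
proof (rule borel_measurable_LIMSEQ_real)
  let ?j = "\<lambda>n (p :: real \<times> 'a). nat \<lfloor>real (Suc n) * max 0 (fst p)\<rfloor>"
  let ?f = "\<lambda>n p. X ((real (?j n p) + 1) / real (Suc n)) (snd p)"
  show "?f n \<in> borel_measurable (borel \<Otimes>\<^sub>M M)" for n
  proof (rule measurable_compose_countable[where g="?j n"])
    show "(\<lambda>p. X ((real i + 1) / real (Suc n)) (snd p)) \<in> borel_measurable (borel \<Otimes>\<^sub>M M)" for i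
      by (rule measurable_compose[OF measurable_snd Xm]) simp
    show "?j n \<in> measurable (borel \<Otimes>\<^sub>M M) (count_space UNIV)" by measurable
  qed
  fix p :: "real \<times> 'a" assume "p \<in> space (borel \<Otimes>\<^sub>M M)"
  then have \<omega>: "snd p \<in> space M" by (auto simp: space_pair_measure)
  have "(\<lambda>n. ?f n p) \<longlonglongrightarrow> X (max 0 (fst p)) (snd p)"
    by (rule filterlim_compose[OF Xr[OF \<omega>, unfolded continuous_within] filterlim_floor_at_right]) auto
  then show "(\<lambda>n. ?f n p) \<longlonglongrightarrow> (case p of (r, \<omega>) \<Rightarrow> X (max 0 r) \<omega>)"
    by (simp add: case_prod_beta)
qed

context prob_space
begin

lemma stable_subordinator_laplace:
  assumes b: "0 < \<beta>" "\<beta> < 1" and D: "subordinator M 0 (stable_levy_measure \<beta>) D"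
    and t: "0 \<le> t" and u: "0 < u"
  shows "(\<integral>\<omega>. exp (- u * D t \<omega>) \<partial>M) = exp (- t * u powr \<beta>)"
  using D t u stable_levy_exponent[OF b u] unfolding subordinator_def by simp

lemma stable_subordinator_paths:
  assumes D: "subordinator M 0 (stable_levy_measure \<beta>) D"
  shows "\<And>t. 0 \<le> t \<Longrightarrow> D t \<in> borel_measurable M"
    and "\<And>\<omega>. \<omega> \<in> space M \<Longrightarrow> mono_on {0..} (\<lambda>r. D r \<omega>)"
    and "\<And>\<omega> t. \<omega> \<in> space M \<Longrightarrow> 0 \<le> t \<Longrightarrow> continuous (at_right t) (\<lambda>r. D r \<omega>)"
    and "\<And>\<omega> t. \<omega> \<in> space M \<Longrightarrow> 0 \<le> t \<Longrightarrow> 0 \<le> D t \<omega>"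
proof -
  show m: "mono_on {0..} (\<lambda>r. D r \<omega>)" if "\<omega> \<in> space M" for \<omega>
    using D that unfolding subordinator_def by auto
  show "0 \<le> D t \<omega>" if "\<omega> \<in> space M" "0 \<le> t" for \<omega> t
  proof -
    have "D 0 \<omega> = 0" using D that unfolding subordinator_def by auto
    then show ?thesis using mono_onD[OF m[OF that(1)], of 0 t] that(2) by auto
  qed
qed (use D in \<open>auto simp: subordinator_def\<close>)

text \<open>An exponential Markov bound: where \<open>D n\<close> stays below \<open>m\<close>,
  \<open>exp m * exp (- D n)\<close> is at least \<open>1\<close>, and its expectation is
  \<open>exp m * exp (- n)\<close>, because at \<open>u = 1\<close> the Laplace exponent is
  \<open>1\<close>. Letting \<open>n\<close> grow shows that staying below \<open>m\<close> forever
  is null.\<close>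

lemma stable_subordinator_unbounded:
  assumes b: "0 < \<beta>" "\<beta> < 1" and D: "subordinator M 0 (stable_levy_measure \<beta>) D"
  shows "AE \<omega> in M. \<forall>s. \<exists>r\<ge>0. s < D r \<omega>"
proof -
  note [measurable] = stable_subordinator_paths(1)[OF D]
  have "AE \<omega> in M. \<exists>n::nat. real m < D (real n) \<omega>" for m :: nat
  proof -
    let ?N = "{\<omega>\<in>space M. \<forall>n::nat. D (real n) \<omega> \<le> real m}"
    have N: "?N \<in> events" by measurable
    have le: "prob ?N \<le> exp (real m) * exp (- real n)" for n :: nat
    proof -
      have i: "integrable M (\<lambda>\<omega>. exp (- D (real n) \<omega>))"
        by (rule integrable_const_bound[of _ 1]) (use stable_subordinator_paths(4)[OF D] in auto)
      have "prob ?N = (\<integral>\<omega>. indicator ?N \<omega> \<partial>M)" using N by simp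
      also have "\<dots> \<le> (\<integral>\<omega>. exp (real m) * exp (- D (real n) \<omega>) \<partial>M)"
      proof (rule integral_mono)
        show "integrable M (indicator ?N :: 'a \<Rightarrow> real)"
          using N by (auto simp: emeasure_eq_measure)
        show "indicator ?N \<omega> \<le> exp (real m) * exp (- D (real n) \<omega>)" for \<omega>
          by (auto simp: indicator_def exp_add[symmetric])
      qed (use i in auto)
      also have "\<dots> = exp (real m) * exp (- real n)"
        using stable_subordinator_laplace[OF b D, of "real n" 1] by simp
      finally show ?thesis .
    qed
    have "(\<lambda>n. exp (real m) * exp (- real n)) \<longlonglongrightarrow> exp (real m) * 0"
      by (intro tendsto_mult tendsto_const filterlim_compose[OF exp_at_bot])
        (auto intro: filterlim_compose[OF filterlim_uminus_at_bot_at_top filterlim_real_sequentially])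
    then have "prob ?N \<le> 0"
      using le by (intro LIMSEQ_le_const[of "\<lambda>n. exp (real m) * exp (- real n)" 0 "prob ?N"]) (simp_all only: mult_zero_right, blast)
    then have "prob ?N = 0" by (simp add: measure_le_0_iff)
    then have "?N \<in> null_sets M" using N by (simp add: null_sets_def emeasure_eq_measure)
    then show ?thesis by (rule AE_I') (auto simp: not_less)
  qed
  then have "AE \<omega> in M. \<forall>m::nat. \<exists>n::nat. real m < D (real n) \<omega>"
    by (simp add: AE_all_countable)
  then show ?thesis
  proof eventually_elim
    case (elim \<omega>)
    show ?case
    proof
      fix s :: real
      obtain m :: nat where "s \<le> real m" using real_arch_simple by auto
      moreover obtain n :: nat where "real m < D (real n) \<omega>" using elim by auto
      ultimately show "\<exists>r\<ge>0. s < D r \<omega>" by (intro exI[of _ "real n"]) auto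
    qed
  qed
qed

lemma inverse_time_measurable:
  assumes D: "subordinator M 0 (stable_levy_measure \<beta>) D"
  shows "inverse_time D s \<in> borel_measurable M"
proof (rule borel_measurableI_less)
  fix a :: real
  have sub: "process_events M borel D \<subseteq> events"
    unfolding process_events_def
  proof (rule sets.sigma_sets_subset, safe)
    fix t :: real and A assume "0 \<le> t" "A \<in> sets (vimage_algebra (space M) (D t) borel)"
    then show "A \<in> events"
      using sets_image_in_sets[OF refl stable_subordinator_paths(1)[OF D, of t]] by auto
  qed
  show "{\<omega>\<in>space M. inverse_time D s \<omega> < a} \<in> events"
  proof (cases "0 < a")
    case True
    then show ?thesis
      using inverse_time_less_events[of M D a s, OF stable_subordinator_paths(2)[OF D]] sub by auto
  next
    case False
    then have "{\<omega>\<in>space M. inverse_time D s \<omega> < a} = {}"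
      using inverse_time_nonneg[of D s] by (auto simp: not_less intro: order_trans)
    then show ?thesis by (simp only: sets.empty_sets)
  qed
qed

lemma nn_integral_exp_atLeast:
  fixes c x :: real
  assumes "0 < c"
  shows "(\<integral>\<^sup>+r. ennreal (c * exp (- c * r)) * indicator {x..} r \<partial>lborel) = ennreal (exp (- c * x))"
proof -
  have "(\<integral>\<^sup>+r. ennreal (c * exp (- c * r)) * indicator {x..} r \<partial>lborel) = ennreal (0 - - exp (- c * x))"
  proof (rule nn_integral_FTC_atLeast[where F="\<lambda>r. - exp (- c * r)"])
    show "((\<lambda>r. - exp (- c * r)) \<longlongrightarrow> 0) at_top"
      using assms by real_asymp
  qed (use assms in \<open>auto intro!: derivative_eq_intros\<close>)
  then show ?thesis by simp
qed

text \<open>\<open>exp (- \<theta> * E)\<close> is the integral of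
  \<open>\<theta> * exp (- \<theta> * r)\<close> over \<open>r \<ge> E\<close>. Since
  \<open>E \<le> r\<close> means \<open>s < D r\<close> up to a single \<open>r\<close>, integrating
  over \<open>s\<close> first leaves \<open>(1 - exp (- u * D r)) / u\<close>, whose expectation is
  known from the Laplace exponent.\<close>

lemma laplace_inverse_time:
  fixes \<theta> u :: real
  assumes b: "0 < \<beta>" "\<beta> < 1" and D: "subordinator M 0 (stable_levy_measure \<beta>) D"
    and th: "0 < \<theta>" and u: "0 < u"
  defines "\<psi> \<equiv> \<lambda>s. \<integral>\<omega>. exp (- \<theta> * inverse_time D s \<omega>) \<partial>M"
  shows "has_bochner_integral lborel (\<lambda>s. indicator {0..} s * (exp (- u * s) * \<psi> s))
    (u powr (\<beta> - 1) / (u powr \<beta> + \<theta>))"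
proof -
  define c where "c = u powr \<beta>"
  have c: "0 < c" using u by (simp add: c_def)
  define d where "d r \<omega> = D (max 0 r) \<omega>" for r \<omega>
  have d_meas [measurable]: "case_prod d \<in> borel_measurable (borel \<Otimes>\<^sub>M M)"
    using measurable_right_continuous_process[OF stable_subordinator_paths(1,3)[OF D]]
    by (simp add: d_def[abs_def])
  \<comment> \<open>One nonnegative integrand for all three variables, so that every exchange below
    is Tonelli's and the value of the integral yields integrability at the end.\<close>
  define F where "F s r \<omega> = ennreal (indicator {0..} r * (\<theta> * exp (- \<theta> * r))) *
    (ennreal (indicator {0..} s * exp (- u * s)) * (if s < d r \<omega> then 1 else 0))" for s r \<omega>
  have good: "AE \<omega> in M. (\<integral>\<^sup>+r. F s r \<omega> \<partial>lborel) =
      ennreal (indicator {0..} s * (exp (- u * s) * exp (- \<theta> * inverse_time D s \<omega>)))" for s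
    using stable_subordinator_unbounded[OF b D] AE_space
  proof eventually_elim
    case (elim \<omega>)
    note \<omega> = elim(2)
    from elim have ex: "\<exists>r\<ge>0. s < D r \<omega>" by auto
    let ?E = "inverse_process D s \<omega>"
    have E: "inverse_time D s \<omega> = ?E" "0 \<le> ?E"
      using ex by (auto simp: inverse_time_def inverse_process_nonneg)
    have "(\<integral>\<^sup>+r. F s r \<omega> \<partial>lborel) = (\<integral>\<^sup>+r. ennreal (indicator {0..} s * exp (- u * s)) *
      (ennreal (\<theta> * exp (- \<theta> * r)) * indicator {?E..} r) \<partial>lborel)"
    proof (rule nn_integral_cong_AE)
      \<comment> \<open>At \<open>r = ?E\<close> the infimum may fail to be attained, so
        \<open>s < D r \<omega>\<close> and \<open>?E \<le> r\<close> can differ there.\<close>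
      have "AE r in lborel. r \<noteq> ?E" by (rule AE_lborel_singleton)
      then show "AE r in lborel. F s r \<omega> = ennreal (indicator {0..} s * exp (- u * s)) *
        (ennreal (\<theta> * exp (- \<theta> * r)) * indicator {?E..} r)"
      proof eventually_elim
        case (elim r)
        show ?case
        proof (cases "0 \<le> r")
          case r: True
          have "s < D r \<omega> \<longleftrightarrow> ?E \<le> r"
          proof
            assume "s < D r \<omega>"
            then show "?E \<le> r" by (rule inverse_process_le[OF r])
          next
            assume "?E \<le> r"
            with elim have "?E < r" by simp
            then obtain q where "0 \<le> q" "q < r" "s < D q \<omega>"
              using inverse_process_less_iff[of s D \<omega> r, OF ex] by auto
            moreover from this have "D q \<omega> \<le> D r \<omega>"
              using mono_onD[OF stable_subordinator_paths(2)[OF D \<omega>], of q r] by auto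
            ultimately show "s < D r \<omega>" by simp
          qed
          then show ?thesis using r by (simp add: F_def d_def mult_ac indicator_def)
        next
          case False
          then show ?thesis using E(2) by (simp add: F_def)
        qed
      qed
    qed
    also have "\<dots> = ennreal (indicator {0..} s * exp (- u * s)) * ennreal (exp (- \<theta> * ?E))"
      using nn_integral_exp_atLeast[OF th, of ?E] by (subst nn_integral_cmult) auto
    finally show ?case by (simp add: E ennreal_mult'[symmetric] mult.assoc)
  qed
  define \<Psi> where "\<Psi> s = (\<integral>\<^sup>+\<omega>. \<integral>\<^sup>+r. F s r \<omega> \<partial>lborel \<partial>M)" for s
  have \<Psi>_meas [measurable]: "\<Psi> \<in> borel_measurable borel"
    unfolding \<Psi>_def F_def by measurable
  note [measurable] = inverse_time_measurable[OF D]
  have int: "integrable M (\<lambda>\<omega>. exp (- \<theta> * inverse_time D s \<omega>))" for s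
    by (rule integrable_const_bound[of _ 1]) (use inverse_time_nonneg[of D s] th in auto)
  have \<Psi>: "\<Psi> s = ennreal (indicator {0..} s * (exp (- u * s) * \<psi> s))" for s
  proof -
    have "\<Psi> s = (\<integral>\<^sup>+\<omega>. ennreal (indicator {0..} s * (exp (- u * s) * exp (- \<theta> * inverse_time D s \<omega>))) \<partial>M)"
      unfolding \<Psi>_def by (rule nn_integral_cong_AE[OF good])
    also have "\<dots> = ennreal (\<integral>\<omega>. indicator {0..} s * (exp (- u * s) * exp (- \<theta> * inverse_time D s \<omega>)) \<partial>M)"
      using int by (intro nn_integral_eq_integral) auto
    finally show ?thesis by (simp add: \<psi>_def)
  qed
  have \<psi>_nonneg: "0 \<le> \<psi> s" for s unfolding \<psi>_def by simp
  have "(\<integral>\<^sup>+s. ennreal (indicator {0..} s * (exp (- u * s) * \<psi> s)) \<partial>lborel) = (\<integral>\<^sup>+s. \<integral>\<^sup>+\<omega>. \<integral>\<^sup>+r. F s r \<omega> \<partial>lborel \<partial>M \<partial>lborel)"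
    unfolding \<Psi>[symmetric] \<Psi>_def ..
  \<comment> \<open>Three exchanges of neighbouring integrals bring \<open>s\<close> innermost and
    \<open>r\<close> outermost.\<close>
  also have "\<dots> = (\<integral>\<^sup>+s. \<integral>\<^sup>+r. \<integral>\<^sup>+\<omega>. F s r \<omega> \<partial>M \<partial>lborel \<partial>lborel)"
  proof (rule nn_integral_cong)
    fix s :: real
    interpret P: pair_sigma_finite lborel M ..
    show "(\<integral>\<^sup>+\<omega>. \<integral>\<^sup>+r. F s r \<omega> \<partial>lborel \<partial>M) = (\<integral>\<^sup>+r. \<integral>\<^sup>+\<omega>. F s r \<omega> \<partial>M \<partial>lborel)"
      by (rule P.Fubini') (unfold F_def, measurable)
  qed
  also have "\<dots> = (\<integral>\<^sup>+r. \<integral>\<^sup>+s. \<integral>\<^sup>+\<omega>. F s r \<omega> \<partial>M \<partial>lborel \<partial>lborel)"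
    by (rule lborel_pair.Fubini'[symmetric]) (unfold F_def, measurable)
  also have "\<dots> = (\<integral>\<^sup>+r. \<integral>\<^sup>+\<omega>. \<integral>\<^sup>+s. F s r \<omega> \<partial>lborel \<partial>M \<partial>lborel)"
  proof (rule nn_integral_cong)
    fix r :: real
    interpret P: pair_sigma_finite lborel M ..
    show "(\<integral>\<^sup>+s. \<integral>\<^sup>+\<omega>. F s r \<omega> \<partial>M \<partial>lborel) = (\<integral>\<^sup>+\<omega>. \<integral>\<^sup>+s. F s r \<omega> \<partial>lborel \<partial>M)"
      by (rule P.Fubini'[symmetric]) (unfold F_def, measurable)
  qed
  also have "\<dots> = (\<integral>\<^sup>+r. ennreal (\<theta> * exp (- \<theta> * r) * ((1 - exp (- c * r)) / u)) * indicator {0..} r \<partial>lborel)"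
  proof (rule nn_integral_cong)
    fix r :: real
    show "(\<integral>\<^sup>+\<omega>. \<integral>\<^sup>+s. F s r \<omega> \<partial>lborel \<partial>M) =
      ennreal (\<theta> * exp (- \<theta> * r) * ((1 - exp (- c * r)) / u)) * indicator {0..} r"
    proof (cases "0 \<le> r")
      case r: True
      have inner: "(\<integral>\<^sup>+s. F s r \<omega> \<partial>lborel) = ennreal (\<theta> * exp (- \<theta> * r) * ((1 - exp (- u * D r \<omega>)) / u))"
        if \<omega>: "\<omega> \<in> space M" for \<omega>
      proof -
        have D0: "0 \<le> D r \<omega>" by (rule stable_subordinator_paths(4)[OF D \<omega> r])
        have "(\<integral>\<^sup>+s. F s r \<omega> \<partial>lborel) = (\<integral>\<^sup>+s. ennreal (\<theta> * exp (- \<theta> * r) / u) *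
          (ennreal (u * exp (- u * s)) * indicator {0..D r \<omega>} s) \<partial>lborel)"
        proof (rule nn_integral_cong_AE)
          \<comment> \<open>\<open>F\<close> uses the strict inequality
            \<open>s < D r \<omega>\<close>, the exponential integral a closed interval.\<close>
          have "AE s in lborel. s \<noteq> D r \<omega>" by (rule AE_lborel_singleton)
          then show "AE s in lborel. F s r \<omega> = ennreal (\<theta> * exp (- \<theta> * r) / u) *
            (ennreal (u * exp (- u * s)) * indicator {0..D r \<omega>} s)"
            by eventually_elim (use r th u in \<open>auto simp: F_def d_def indicator_def ennreal_mult'[symmetric]\<close>)
        qed
        also have "\<dots> = ennreal (\<theta> * exp (- \<theta> * r) / u) * ennreal (1 - exp (- u * D r \<omega>))"
          using nn_integral_exp_Icc[OF u D0] by (subst nn_integral_cmult) auto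
        also have "\<dots> = ennreal (\<theta> * exp (- \<theta> * r) / u * (1 - exp (- u * D r \<omega>)))"
          using th u by (intro ennreal_mult'[symmetric]) auto
        finally show ?thesis by simp
      qed
      have i: "integrable M (\<lambda>\<omega>. exp (- u * D r \<omega>))"
        by (rule integrable_const_bound[of _ 1])
          (use stable_subordinator_paths(1,4)[OF D] r u in auto)
      have "(\<integral>\<^sup>+\<omega>. \<integral>\<^sup>+s. F s r \<omega> \<partial>lborel \<partial>M) =
        (\<integral>\<^sup>+\<omega>. ennreal (\<theta> * exp (- \<theta> * r) * ((1 - exp (- u * D r \<omega>)) / u)) \<partial>M)"
        by (rule nn_integral_cong[OF inner])
      also have "\<dots> = ennreal (\<integral>\<omega>. \<theta> * exp (- \<theta> * r) * ((1 - exp (- u * D r \<omega>)) / u) \<partial>M)"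
        using i th u stable_subordinator_paths(4)[OF D] r by (intro nn_integral_eq_integral) auto
      also have "(\<integral>\<omega>. \<theta> * exp (- \<theta> * r) * ((1 - exp (- u * D r \<omega>)) / u) \<partial>M) =
        \<theta> * exp (- \<theta> * r) * ((1 - exp (- r * u powr \<beta>)) / u)"
        using i stable_subordinator_laplace[OF b D r u] by (simp add: prob_space)
      finally show ?thesis using r by (simp add: c_def mult.commute)
    next
      case False
      then show ?thesis by (simp add: F_def)
    qed
  qed
  \<comment> \<open>The limit of the antiderivative at infinity minus its value at \<open>0\<close>;
    the second exponential has rate \<open>\<theta> + c\<close> because
    \<open>exp (- \<theta> * r)\<close> meets \<open>exp (- c * r)\<close>.\<close>
  also have "\<dots> = ennreal (0 - (- exp (- \<theta> * 0) + \<theta> / (\<theta> + c) * exp (- (\<theta> + c) * 0)) / u)"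
  proof (rule nn_integral_FTC_atLeast)
    fix r :: real assume r: "0 \<le> r"
    define K where "K = \<theta> + c"
    have "DERIV (\<lambda>r. (- exp (- \<theta> * r) + \<theta> / K * exp (- K * r)) / u) r :>
      (\<theta> * exp (- \<theta> * r) - \<theta> / K * K * exp (- K * r)) / u"
      using u by (auto intro!: derivative_eq_intros)
    moreover have "\<theta> / K * K = \<theta>" using th c by (simp add: K_def)
    moreover have "exp (- K * r) = exp (- \<theta> * r) * exp (- c * r)"
      by (simp add: K_def exp_add[symmetric] algebra_simps)
    then have "(\<theta> * exp (- \<theta> * r) - \<theta> * exp (- K * r)) / u = \<theta> * exp (- \<theta> * r) * ((1 - exp (- c * r)) / u)"
      by (simp add: right_diff_distrib)
    ultimately show "DERIV (\<lambda>r. (- exp (- \<theta> * r) + \<theta> / (\<theta> + c) * exp (- (\<theta> + c) * r)) / u) r :>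
      \<theta> * exp (- \<theta> * r) * ((1 - exp (- c * r)) / u)"
      by (simp only: K_def)
    show "0 \<le> \<theta> * exp (- \<theta> * r) * ((1 - exp (- c * r)) / u)"
      using th c u r by simp
  next
    show "((\<lambda>r. (- exp (- \<theta> * r) + \<theta> / (\<theta> + c) * exp (- (\<theta> + c) * r)) / u) \<longlongrightarrow> 0) at_top"
    proof -
      have lim: "((\<lambda>r. exp (- K * r)) \<longlongrightarrow> 0) at_top" if "0 < K" for K :: real
        using that by real_asymp
      have "((\<lambda>r. (- exp (- \<theta> * r) + \<theta> / (\<theta> + c) * exp (- (\<theta> + c) * r)) / u) \<longlongrightarrow>
        (- 0 + \<theta> / (\<theta> + c) * 0) / u) at_top"
        using th c u by (intro tendsto_intros lim) auto
      then show ?thesis by simp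
    qed
  qed auto
  also have "0 - (- exp (- \<theta> * 0) + \<theta> / (\<theta> + c) * exp (- (\<theta> + c) * 0)) / u = u powr (\<beta> - 1) / (u powr \<beta> + \<theta>)"
  proof -
    have "u powr (\<beta> - 1) = c / u" using u by (simp add: c_def powr_diff)
    moreover have "1 - \<theta> / (\<theta> + c) = c / (c + \<theta>)" using th c by (simp add: divide_simps)
    ultimately show ?thesis
      unfolding c_def[symmetric] by (simp add: minus_divide_left)
  qed
  finally have nn: "(\<integral>\<^sup>+s. ennreal (indicator {0..} s * (exp (- u * s) * \<psi> s)) \<partial>lborel) =
    ennreal (u powr (\<beta> - 1) / (u powr \<beta> + \<theta>))" .
  show ?thesis
  proof (rule has_bochner_integral_nn_integral[OF _ _ _ nn])
    \<comment> \<open>Measurability of \<open>\<psi>\<close> in \<open>s\<close> is inherited from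
      \<open>\<Psi>\<close>, an iterated integral of a jointly measurable function.\<close>
    have "(\<lambda>s. enn2real (\<Psi> s)) \<in> borel_measurable lborel" by measurable
    then show "(\<lambda>s. indicator {0..} s * (exp (- u * s) * \<psi> s)) \<in> borel_measurable lborel"
      using \<psi>_nonneg by (simp add: \<Psi>)
  qed (use \<psi>_nonneg th in auto)
qed

end

text \<open>Both sides have the same transform at every \<open>u\<close> with
  \<open>\<theta> < u powr \<beta>\<close> and both are right-continuous in \<open>s\<close>, so
  \<open>laplace_unique\<close> identifies them at each \<open>s\<close>, not just almost
  everywhere.\<close>

lemma (in prob_space) inverse_time_laplace_mittag_leffler:
  fixes \<theta> s :: real
  assumes b: "0 < \<beta>" "\<beta> < 1" and D: "subordinator M 0 (stable_levy_measure \<beta>) D"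
    and th: "0 < \<theta>" and s: "0 \<le> s"
  shows "(\<integral>\<omega>. exp (- \<theta> * inverse_time D s \<omega>) \<partial>M) = mittag_leffler \<beta> 1 (- \<theta> * s powr \<beta>)"
proof -
  define \<psi> where "\<psi> s = (\<integral>\<omega>. exp (- \<theta> * inverse_time D s \<omega>) \<partial>M)" for s
  define m where "m s = mittag_leffler \<beta> 1 (- \<theta> * s powr \<beta>)" for s
  \<comment> \<open>From \<open>N\<close> on, every frequency lies in the range of
    \<open>laplace_mittag_leffler\<close>.\<close>
  obtain N :: nat where N: "\<theta> powr (1 / \<beta>) < real N" using reals_Archimedean2 by auto
  have "0 < real N" using N powr_ge_zero[of \<theta> "1 / \<beta>"] by linarith
  have large: "\<theta> < u powr \<beta>" if "real N \<le> u" for u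
  proof -
    have "\<theta> = (\<theta> powr (1 / \<beta>)) powr \<beta>" using b th by (simp add: powr_powr)
    also have "\<dots> < u powr \<beta>" using N that b by (intro powr_less_mono2) auto
    finally show ?thesis .
  qed
  have diff: "has_bochner_integral lborel (\<lambda>s. indicator {0..} s * (exp (- u * s) * (\<psi> s - m s))) 0"
    if "real N \<le> u" for u
  proof -
    have u: "0 < u" using that \<open>0 < real N\<close> by simp
    from has_bochner_integral_diff[OF laplace_inverse_time[OF b D th u] laplace_mittag_leffler[OF b(1) th u large[OF that]]]
    show ?thesis
      unfolding \<psi>_def m_def by (simp add: right_diff_distrib)
  qed
  \<comment> \<open>The weight turns frequency \<open>n\<close> for \<open>g\<close> into
    \<open>N + n\<close> for \<open>\<psi> - m\<close>; it never vanishes, so \<open>g s = 0\<close>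
    suffices.\<close>
  define g where "g s = exp (- real N * s) * (\<psi> s - m s)" for s
  have "g s = 0"
  proof (rule laplace_unique[OF _ _ s])
    show "integrable lborel (\<lambda>s. indicator {0..} s * g s)"
      using diff[of "real N"] unfolding g_def by (simp add: has_bochner_integral_iff)
    show "(\<integral>s. indicator {0..} s * g s * exp (- real n * s) \<partial>lborel) = 0" for n :: nat
    proof -
      have "indicator {0..} s * g s * exp (- real n * s) =
        indicator {0..} s * (exp (- (real N + real n) * s) * (\<psi> s - m s))" for s
        unfolding g_def by (simp add: exp_add[symmetric] algebra_simps)
      then show ?thesis
        using diff[of "real N + real n"] by (simp only: has_bochner_integral_iff)
    qed
    have "continuous (at_right s) \<psi>"
      unfolding continuous_within
    proof (rule tendsto_at_right_sequentially[where b="s + 1"])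
      fix S :: "nat \<Rightarrow> real"
      assume S: "\<And>n. s < S n" "S \<longlonglongrightarrow> s"
      then have flt: "filterlim S (at_right s) sequentially"
        by (auto simp: filterlim_at less_imp_neq[symmetric])
      show "(\<lambda>n. \<psi> (S n)) \<longlonglongrightarrow> \<psi> s"
        unfolding \<psi>_def
      proof (rule integral_dominated_convergence[where w="\<lambda>_. 1"])
        show "AE \<omega> in M. (\<lambda>n. exp (- \<theta> * inverse_time D (S n) \<omega>)) \<longlonglongrightarrow> exp (- \<theta> * inverse_time D s \<omega>)"
          using stable_subordinator_unbounded[OF b D]
        proof eventually_elim
          case (elim \<omega>)
          then have eq: "inverse_time D u \<omega> = inverse_process D u \<omega>" for u
            by (auto simp: inverse_time_def)
          have "((\<lambda>u. inverse_process D u \<omega>) \<longlongrightarrow> inverse_process D s \<omega>) (at_right s)"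
          proof (rule order_tendstoI)
            fix a assume "a < inverse_process D s \<omega>"
            then show "eventually (\<lambda>u. a < inverse_process D u \<omega>) (at_right s)"
              using inverse_process_right[of s D \<omega> "inverse_process D s \<omega> + 1"] elim
              by (auto elim!: eventually_mono)
          next
            fix a assume "inverse_process D s \<omega> < a"
            then show "eventually (\<lambda>u. inverse_process D u \<omega> < a) (at_right s)"
              using inverse_process_right[of s D \<omega> a] elim
              by (auto elim!: eventually_mono)
          qed
          then have "(\<lambda>n. inverse_process D (S n) \<omega>) \<longlonglongrightarrow> inverse_process D s \<omega>"
            using flt by (rule filterlim_compose)
          then show ?case unfolding eq by (intro tendsto_intros)
        qed
        show "AE \<omega> in M. norm (exp (- \<theta> * inverse_time D (S n) \<omega>)) \<le> 1" for n
          using th inverse_time_nonneg[of D "S n"] by simp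
      qed (use inverse_time_measurable[OF D] in auto)
    qed simp
    moreover have "continuous (at_right s) m"
      unfolding m_def[abs_def] by (rule continuous_mittag_leffler_powr[OF b(1) order_refl s])
    ultimately show "continuous (at_right s) g"
      unfolding g_def[abs_def] by (intro continuous_intros)
  qed
  then show ?thesis unfolding g_def \<psi>_def m_def by simp
qed

section \<open>The fractional Yule process\<close>

text \<open>The geometric tails differ by \<open>e * (1 - e) ^ (k - 1)\<close> with
  \<open>e = exp (- l * R)\<close>; the binomial expansion of the power, shifted by the leading
  \<open>e\<close>, gives the index \<open>j\<close> and the coefficient
  \<open>(k - 1) choose (j - 1)\<close>. Measurability of \<open>X s\<close> is a hypothesis because
  \<open>X s\<close> matches \<open>Y\<close> at \<open>R\<close> only almost surely, and a set that
  differs from an event inside a null set need not be an event.\<close>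

lemma (in prob_space) fractional_yule_process:
  fixes l \<beta> :: real
  assumes l: "0 < l" and b: "0 < \<beta>" "\<beta> < 1"
    and X: "fractional_birth_process M \<beta> (\<lambda>k. l * real k) X"
  shows "\<And>\<omega> s. \<omega> \<in> space M \<Longrightarrow> 0 \<le> s \<Longrightarrow> eventually (\<lambda>u. X u \<omega> = X s \<omega>) (at_right s)"
    and "\<And>s k. 0 \<le> s \<Longrightarrow> 1 \<le> k \<Longrightarrow> {\<omega>\<in>space M. X s \<omega> = k} \<in> events \<Longrightarrow>
      prob {\<omega>\<in>space M. X s \<omega> = k} =
      (\<Sum>j=1..k. real ((k - 1) choose (j - 1)) * (-1) ^ (j - 1) * mittag_leffler \<beta> 1 (- l * real j * s powr \<beta>))"
proof -
  obtain Y D where Y: "pure_birth_process M (\<lambda>k. l * real k) Y"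
    and D: "subordinator M 0 (stable_levy_measure \<beta>) D"
    and ind: "indep_set (process_events M (count_space UNIV) Y) (process_events M borel D)"
    and X_eq: "\<And>t \<omega>. 0 \<le> t \<Longrightarrow> \<omega> \<in> space M \<Longrightarrow> X t \<omega> = Y (inverse_process D t \<omega>) \<omega>"
    using X unfolding fractional_birth_process_def by blast
  show "eventually (\<lambda>u. X u \<omega> = X s \<omega>) (at_right s)" if \<omega>: "\<omega> \<in> space M" and s: "0 \<le> s" for \<omega> s
  proof -
    have "eventually (\<lambda>u. Y (inverse_process D u \<omega>) \<omega> = Y (inverse_process D s \<omega>) \<omega>) (at_right s)"
      by (rule right_constant_compose_inverse_process[where Y="\<lambda>u. Y u \<omega>"])
        (rule yule_process(1)[OF l Y \<omega>])
    moreover have "eventually (\<lambda>u. s < u) (at_right s)" by (simp add: eventually_at_right_less)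
    ultimately show ?thesis
      by eventually_elim (use X_eq[OF _ \<omega>] s in auto)
  qed
  fix s :: real and k :: nat
  assume s: "0 \<le> s" and k: "1 \<le> k" and Xm: "{\<omega>\<in>space M. X s \<omega> = k} \<in> events"
  define R where "R = inverse_time D s"
  have Rm [measurable]: "R \<in> borel_measurable M"
    unfolding R_def by (rule inverse_time_measurable[OF D])
  have R0: "0 \<le> R \<omega>" for \<omega> by (simp add: R_def inverse_time_nonneg)
  define e where "e \<omega> = exp (- l * R \<omega>)" for \<omega>
  have em [measurable]: "e \<in> borel_measurable M" unfolding e_def by measurable
  have e01: "0 \<le> e \<omega>" "e \<omega> \<le> 1" for \<omega> using l R0[of \<omega>] by (auto simp: e_def)
  have tail: "{\<omega>\<in>space M. n < Y (R \<omega>) \<omega>} \<in> events \<and>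
    prob {\<omega>\<in>space M. n < Y (R \<omega>) \<omega>} = (\<integral>\<omega>. (1 - e \<omega>) ^ n \<partial>M)" for n
  proof -
    have Yev: "{\<omega>\<in>space M. n < Y r \<omega>} \<in> process_events M (count_space UNIV) Y" if "0 \<le> r" for r
      using process_events_Collect[where P="\<lambda>y. n < y" and S="count_space UNIV" and X=Y, OF that] by simp
    have Rev: "{\<omega>\<in>space M. R \<omega> < a} \<in> process_events M borel D" if "0 < a" for a
      unfolding R_def by (rule inverse_time_less_events[OF stable_subordinator_paths(2)[OF D] that])
    have Qm: "{\<omega>\<in>space M. n < Y r \<omega>} \<in> events" if "0 \<le> r" for r
      using Yev[OF that] indep_setD_ev1[OF ind] by auto
    have Qr: "eventually (\<lambda>u. (n < Y u \<omega>) = (n < Y r \<omega>)) (at_right r)" if "\<omega> \<in> space M" "0 \<le> r" for \<omega> r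
      using yule_process(1)[OF l Y that] by eventually_elim simp
    have indQ: "prob {\<omega>\<in>space M. n < Y r \<omega> \<and> R \<omega> < a} = prob {\<omega>\<in>space M. n < Y r \<omega>} * prob {\<omega>\<in>space M. R \<omega> < a}"
      if "0 \<le> r" "0 < a" for r a
    proof -
      have "{\<omega>\<in>space M. n < Y r \<omega> \<and> R \<omega> < a} = {\<omega>\<in>space M. n < Y r \<omega>} \<inter> {\<omega>\<in>space M. R \<omega> < a}" by auto
      then show ?thesis using indep_setD[OF ind Yev[OF that(1)] Rev[OF that(2)]] by simp
    qed
    note L = prob_at_independent_time[where Q="\<lambda>r \<omega>. n < Y r \<omega>" and R=R, OF Qm Qr Rm R0 indQ]
    have "prob {\<omega>\<in>space M. n < Y (R \<omega>) \<omega>} = (\<integral>\<omega>. (1 - e \<omega>) ^ n \<partial>M)"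
      using L(3) by (simp add: yule_process(2)[OF l Y R0] e_def)
    with L(1) show ?thesis by simp
  qed
  \<comment> \<open>Only here is \<open>inverse_process\<close> replaced by
    \<open>inverse_time\<close>: they agree on the unbounded paths, which have full measure.\<close>
  have "AE \<omega> in M. \<omega> \<in> {\<omega>\<in>space M. X s \<omega> = k} \<longleftrightarrow> \<omega> \<in> {\<omega>\<in>space M. Y (R \<omega>) \<omega> = k}"
    using stable_subordinator_unbounded[OF b D]
    by eventually_elim (use X_eq[OF s] in \<open>auto simp: R_def inverse_time_def\<close>)
  moreover have eq: "{\<omega>\<in>space M. Y (R \<omega>) \<omega> = k} =
      {\<omega>\<in>space M. k - 1 < Y (R \<omega>) \<omega>} - {\<omega>\<in>space M. k < Y (R \<omega>) \<omega>}"
    using k by auto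
  moreover have "{\<omega>\<in>space M. Y (R \<omega>) \<omega> = k} \<in> events"
    unfolding eq using tail by blast
  ultimately have "prob {\<omega>\<in>space M. X s \<omega> = k} = prob {\<omega>\<in>space M. Y (R \<omega>) \<omega> = k}"
    using Xm by (intro measure_eq_AE)
  also have "\<dots> = prob {\<omega>\<in>space M. k - 1 < Y (R \<omega>) \<omega>} - prob {\<omega>\<in>space M. k < Y (R \<omega>) \<omega>}"
    unfolding eq using tail by (intro finite_measure_Diff) auto
  also have "\<dots> = (\<integral>\<omega>. (1 - e \<omega>) ^ (k - 1) - (1 - e \<omega>) ^ k \<partial>M)"
  proof -
    have "integrable M (\<lambda>\<omega>. (1 - e \<omega>) ^ n)" for n
      by (rule integrable_const_bound[of _ 1]) (use e01 in \<open>auto intro!: power_le_one simp: power_abs\<close>)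
    then show ?thesis using tail by simp
  qed
  also have "\<dots> = (\<integral>\<omega>. (\<Sum>j=1..k. real ((k - 1) choose (j - 1)) * (-1) ^ (j - 1) * exp (- (l * real j) * R \<omega>)) \<partial>M)"
  proof (rule Bochner_Integration.integral_cong[OF refl])
    fix \<omega>
    obtain n where n: "k = Suc n" using k by (cases k) auto
    have "(1 - e \<omega>) ^ (k - 1) - (1 - e \<omega>) ^ k = e \<omega> * (- e \<omega> + 1) ^ n"
      by (simp add: n algebra_simps)
    also have "\<dots> = (\<Sum>i\<le>n. real (n choose i) * (-1) ^ i * (e \<omega> ^ i * e \<omega>))"
      unfolding binomial_ring sum_distrib_left
      by (intro sum.cong refl) (simp add: power_minus[of "e \<omega>"] mult_ac)
    also have "\<dots> = (\<Sum>i\<le>n. real (n choose i) * (-1) ^ i * exp (- (l * real (Suc i)) * R \<omega>))"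
    proof (intro sum.cong refl)
      fix i
      have "e \<omega> ^ i * e \<omega> = exp (- (l * real (Suc i)) * R \<omega>)"
        using exp_of_nat_mult[of "Suc i" "- l * R \<omega>"] by (simp add: e_def algebra_simps)
      then show "real (n choose i) * (-1) ^ i * (e \<omega> ^ i * e \<omega>) = real (n choose i) * (-1) ^ i * exp (- (l * real (Suc i)) * R \<omega>)"
        by simp
    qed
    finally show "(1 - e \<omega>) ^ (k - 1) - (1 - e \<omega>) ^ k =
      (\<Sum>j=1..k. real ((k - 1) choose (j - 1)) * (-1) ^ (j - 1) * exp (- (l * real j) * R \<omega>))"
      by (simp add: n sum.atLeast1_atMost_eq lessThan_Suc_atMost del: of_nat_Suc sum.cl_ivl_Suc)
  qed
  also have "\<dots> = (\<Sum>j=1..k. real ((k - 1) choose (j - 1)) * (-1) ^ (j - 1) * (\<integral>\<omega>. exp (- (l * real j) * R \<omega>) \<partial>M))"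
  proof -
    have "integrable M (\<lambda>\<omega>. exp (- (l * real j) * R \<omega>))" for j :: nat
      by (rule integrable_const_bound[of _ 1]) (use l R0 in auto)
    then show ?thesis by (subst Bochner_Integration.integral_sum) auto
  qed
  also have "\<dots> = (\<Sum>j=1..k. real ((k - 1) choose (j - 1)) * (-1) ^ (j - 1) * mittag_leffler \<beta> 1 (- l * real j * s powr \<beta>))"
  proof (intro sum.cong refl)
    fix j assume "j \<in> {1..k}"
    then have "0 < l * real j" using l by auto
    from inverse_time_laplace_mittag_leffler[OF b D this s]
    show "real ((k - 1) choose (j - 1)) * (-1) ^ (j - 1) * (\<integral>\<omega>. exp (- (l * real j) * R \<omega>) \<partial>M) =
      real ((k - 1) choose (j - 1)) * (-1) ^ (j - 1) * mittag_leffler \<beta> 1 (- l * real j * s powr \<beta>)"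
      by (simp add: R_def)
  qed
  finally show "prob {\<omega>\<in>space M. X s \<omega> = k} =
    (\<Sum>j=1..k. real ((k - 1) choose (j - 1)) * (-1) ^ (j - 1) * mittag_leffler \<beta> 1 (- l * real j * s powr \<beta>))" .
qed

section \<open>The genera process\<close>

text \<open>The mean of a binomial law, from
  \<open>j * (m choose j) = m * (m - 1 choose (j - 1))\<close>. The factor \<open>x + y\<close> on
  the left replaces the exponent \<open>m - 1\<close> by \<open>m\<close>, which also makes sense at
  \<open>m = 0\<close>.\<close>

lemma sum_binomial_mean:
  fixes x y :: real
  shows "(\<Sum>j\<le>m. real j * (real (m choose j) * x ^ j * y ^ (m - j))) * (x + y) = real m * x * (x + y) ^ m"
proof (cases m)
  case (Suc n)
  have "(\<Sum>j\<le>m. real j * (real (m choose j) * x ^ j * y ^ (m - j))) =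
    (\<Sum>i\<le>n. real (Suc i * (Suc n choose Suc i)) * (x ^ Suc i * y ^ (n - i)))"
    unfolding Suc sum.atMost_Suc_shift of_nat_mult
    by (simp only: of_nat_0 mult_zero_left add_0 diff_Suc_Suc mult.assoc)
  also have "\<dots> = real m * x * (\<Sum>i\<le>n. real (n choose i) * x ^ i * y ^ (n - i))"
    unfolding Suc_times_binomial sum_distrib_left Suc by (intro sum.cong refl) (simp add: algebra_simps)
  also have "\<dots> = real m * x * (x + y) ^ n" by (simp only: binomial_ring)
  finally show ?thesis by (simp add: Suc)
qed simp

text \<open>A weak inequality \<open>f t \<le> f s\<close> suffices, since equality gives the claim
  at once. This covers clocks that stand still, such as \<open>W \<omega> * q s\<close> when
  \<open>W \<omega> = 0\<close>.\<close>

lemma right_constant_compose: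
  fixes V :: "real \<Rightarrow> 'b" and f :: "real \<Rightarrow> real"
  assumes V: "eventually (\<lambda>v. V v = V (f t)) (at_right (f t))"
    and f: "(f \<longlongrightarrow> f t) (at_right t)" and mono: "eventually (\<lambda>s. f t \<le> f s) (at_right t)"
  shows "eventually (\<lambda>s. V (f s) = V (f t)) (at_right t)"
proof -
  obtain b where b: "f t < b" "\<And>v. f t < v \<Longrightarrow> v < b \<Longrightarrow> V v = V (f t)"
    using V by (auto simp: eventually_at_right_field)
  show ?thesis
    using order_tendstoD(2)[OF f b(1)] mono by eventually_elim (use b(2) in \<open>auto simp: le_less\<close>)
qed

context prob_space
begin

lemma poisson_process_paths:
  assumes N: "poisson_process M \<rho> N"
  shows "\<And>t k. 0 \<le> t \<Longrightarrow> {\<omega>\<in>space M. N t \<omega> = k} \<in> events"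
    and "\<And>\<omega>. \<omega> \<in> space M \<Longrightarrow> N 0 \<omega> = 0"
    and "\<And>\<omega>. \<omega> \<in> space M \<Longrightarrow> mono_on {0..} (\<lambda>t. N t \<omega>)"
    and "\<And>\<omega> t. \<omega> \<in> space M \<Longrightarrow> 0 \<le> t \<Longrightarrow> eventually (\<lambda>s. N s \<omega> = N t \<omega>) (at_right t)"
proof -
  show "{\<omega>\<in>space M. N t \<omega> = k} \<in> events" if "0 \<le> t" for t k
  proof -
    have [measurable]: "N t \<in> measurable M (count_space UNIV)"
      using N that unfolding poisson_process_def by auto
    show ?thesis by measurable
  qed
  show "eventually (\<lambda>s. N s \<omega> = N t \<omega>) (at_right t)" if "\<omega> \<in> space M" "0 \<le> t" for \<omega> t
    using N that unfolding poisson_process_def continuous_within tendsto_discrete by blast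
qed (use N in \<open>auto simp: poisson_process_def\<close>)

lemma poisson_process_joint:
  assumes N: "poisson_process M 1 N" and a: "0 < a" "a < b" and j: "j \<le> m"
  shows "prob {\<omega>\<in>space M. N a \<omega> = j \<and> N b \<omega> = m} =
    a ^ j / fact j * exp (- a) * ((b - a) ^ (m - j) / fact (m - j) * exp (- (b - a)))"
proof -
  have Nm: "N t \<in> measurable M (count_space UNIV)" if "0 \<le> t" for t
    using N that unfolding poisson_process_def by auto
  have le: "N s \<omega> \<le> N t \<omega>" if "\<omega> \<in> space M" "0 \<le> s" "s \<le> t" for s t \<omega>
    using mono_onD[OF poisson_process_paths(3)[OF N that(1)], of s t] that by auto
  have inc: "prob {\<omega>\<in>space M. N t \<omega> - N s \<omega> = k} = (t - s) ^ k / fact k * exp (- (t - s))"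
    if "0 \<le> s" "s < t" for s t k
  proof -
    have [measurable]: "N s \<in> measurable M (count_space UNIV)" "N t \<in> measurable M (count_space UNIV)"
      using Nm that by auto
    have m: "(\<lambda>\<omega>. N t \<omega> - N s \<omega>) \<in> measurable M (count_space UNIV)" by measurable
    have "prob {\<omega>\<in>space M. N t \<omega> - N s \<omega> = k} = measure (distr M (count_space UNIV) (\<lambda>\<omega>. N t \<omega> - N s \<omega>)) {k}"
      by (subst measure_distr[OF m]) (auto intro!: arg_cong[where f=prob])
    also have "distr M (count_space UNIV) (\<lambda>\<omega>. N t \<omega> - N s \<omega>) = measure_pmf (poisson_pmf (1 * (t - s)))"
      using N that unfolding poisson_process_def by blast
    finally show ?thesis using that by (simp add: measure_pmf_single)
  qed
  \<comment> \<open>\<open>indep_increments\<close> speaks of infinite time sequences: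
    \<open>0, a, b, b, ...\<close> makes the first two increments those of interest.\<close>
  define \<tau> where "\<tau> i = (if i = 0 then 0 else if i = 1 then a else b)" for i :: nat
  have "mono \<tau>" using a by (auto intro!: monoI simp: \<tau>_def)
  moreover have "\<tau> 0 = 0" by (simp add: \<tau>_def)
  moreover define Z where "Z i \<omega> = real (N (\<tau> (Suc i)) \<omega>) - real (N (\<tau> i) \<omega>)" for i \<omega>
  ultimately have iv: "indep_vars (\<lambda>_. borel) Z UNIV"
    using N unfolding poisson_process_def indep_increments_def by (simp add: Z_def[abs_def])
  define A where "A i = (if i = 0 then {real j} else {real (m - j)})" for i :: nat
  let ?E1 = "{\<omega>\<in>space M. N a \<omega> - N 0 \<omega> = j}" and ?E2 = "{\<omega>\<in>space M. N b \<omega> - N a \<omega> = m - j}"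
  have Z0: "Z 0 -` {real j} \<inter> space M = ?E1"
    using poisson_process_paths(2)[OF N] by (auto simp: \<tau>_def Z_def)
  have Z1: "Z (Suc 0) -` {real (m - j)} \<inter> space M = ?E2"
  proof -
    \<comment> \<open>The increments are real differences in one clause of the definition and
      truncated differences of naturals in another; monotone paths reconcile them.\<close>
    have "real (N b \<omega>) - real (N a \<omega>) = real (N b \<omega> - N a \<omega>)" if "\<omega> \<in> space M" for \<omega>
      using le[OF that, of a b] a by (simp add: of_nat_diff)
    then show ?thesis by (auto simp: \<tau>_def Z_def)
  qed
  have "prob (\<Inter>i\<in>{0, Suc 0}. Z i -` A i \<inter> space M) = (\<Prod>i\<in>{0, Suc 0}. prob (Z i -` A i \<inter> space M))"
    by (rule indep_varsD[OF iv]) (auto simp: A_def)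
  then have "prob (?E1 \<inter> ?E2) = prob ?E1 * prob ?E2"
    by (simp add: A_def Z0 Z1)
  also have "?E1 \<inter> ?E2 = {\<omega>\<in>space M. N a \<omega> = j \<and> N b \<omega> = m}"
  proof -
    have "N a \<omega> - N 0 \<omega> = j \<and> N b \<omega> - N a \<omega> = m - j \<longleftrightarrow> N a \<omega> = j \<and> N b \<omega> = m" if "\<omega> \<in> space M" for \<omega>
      using poisson_process_paths(2)[OF N that] le[OF that, of a b] a j by auto
    then show ?thesis by auto
  qed
  finally show ?thesis
    using a inc[of 0 a j] inc[of a b "m - j"] by simp
qed

text \<open>Given \<open>N b = m\<close>, the value \<open>N a\<close> is binomial with parameters
  \<open>m\<close> and \<open>a / b\<close>. The undivided form is linear in the joint
  probabilities, so it can be averaged over \<open>W\<close> afterwards.\<close>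

lemma poisson_process_conditional_mean:
  assumes N: "poisson_process M 1 N" and a: "0 < a" "a < b"
  shows "(\<Sum>j\<le>m. real j * prob {\<omega>\<in>space M. N a \<omega> = j \<and> N b \<omega> = m}) =
    a / b * real m * (\<Sum>j\<le>m. prob {\<omega>\<in>space M. N a \<omega> = j \<and> N b \<omega> = m})"
proof -
  define C where "C = exp (- b) / fact m"
  have p: "prob {\<omega>\<in>space M. N a \<omega> = j \<and> N b \<omega> = m} = C * (real (m choose j) * a ^ j * (b - a) ^ (m - j))"
    if "j \<le> m" for j
  proof -
    have "exp (- a) * exp (- (b - a)) = exp (- b)" by (simp add: exp_add[symmetric])
    moreover have "real (m choose j) = fact m / (fact j * fact (m - j))"
      using that by (rule binomial_fact)
    ultimately show ?thesis
      unfolding poisson_process_joint[OF N a that] C_def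
      by (simp add: field_simps)
  qed
  have "(\<Sum>j\<le>m. real j * prob {\<omega>\<in>space M. N a \<omega> = j \<and> N b \<omega> = m}) =
    C * (\<Sum>j\<le>m. real j * (real (m choose j) * a ^ j * (b - a) ^ (m - j)))"
    unfolding sum_distrib_left by (intro sum.cong refl) (simp add: p mult_ac)
  also have "(\<Sum>j\<le>m. real j * (real (m choose j) * a ^ j * (b - a) ^ (m - j))) = a / b * real m * b ^ m"
    using sum_binomial_mean[of m a "b - a"] a by (simp add: field_simps)
  also have "b ^ m = (\<Sum>j\<le>m. real (m choose j) * a ^ j * (b - a) ^ (m - j))"
    using binomial_ring[of a "b - a" m] by simp
  also have "C * (a / b * real m * (\<Sum>j\<le>m. real (m choose j) * a ^ j * (b - a) ^ (m - j))) =
    a / b * real m * (\<Sum>j\<le>m. C * (real (m choose j) * a ^ j * (b - a) ^ (m - j)))"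
    by (simp add: sum_distrib_left mult_ac)
  also have "(\<Sum>j\<le>m. C * (real (m choose j) * a ^ j * (b - a) ^ (m - j))) =
    (\<Sum>j\<le>m. prob {\<omega>\<in>space M. N a \<omega> = j \<and> N b \<omega> = m})"
    by (intro sum.cong refl) (simp add: p)
  finally show ?thesis .
qed

end

lemma (in prob_space) genera_process:
  fixes \<nu> \<mu> :: real
  assumes nu: "0 < \<nu>" and mu: "0 < \<mu>" and G: "genera_process M \<nu> \<mu> G"
  shows "\<And>\<omega>. \<omega> \<in> space M \<Longrightarrow> G 0 \<omega> = 0"
    and "\<And>\<omega>. \<omega> \<in> space M \<Longrightarrow> mono_on {0..} (\<lambda>t. G t \<omega>)"
    and "\<And>\<omega> t. \<omega> \<in> space M \<Longrightarrow> 0 \<le> t \<Longrightarrow> eventually (\<lambda>s. G s \<omega> = G t \<omega>) (at_right t)"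
    and "\<And>s t m. 0 \<le> s \<Longrightarrow> s \<le> t \<Longrightarrow> 0 < t \<Longrightarrow>
      (\<Sum>j\<le>m. real j * prob {\<omega>\<in>space M. G s \<omega> = j \<and> G t \<omega> = m}) =
      (s / t) powr \<nu> * real m * prob {\<omega>\<in>space M. G t \<omega> = m}"
    and "\<And>t. 0 < t \<Longrightarrow> 0 < prob {\<omega>\<in>space M. 1 \<le> G t \<omega>}"
proof -
  obtain N W where N: "poisson_process M 1 N"
    and W: "distributed M lborel W (\<lambda>w. ennreal (mixing_density \<nu> w))"
    and W0: "\<And>\<omega>. \<omega> \<in> space M \<Longrightarrow> 0 \<le> W \<omega>"
    and ind: "indep_set (process_events M (count_space UNIV) N) (sets (vimage_algebra (space M) W borel))"
    and G_eq: "\<And>t \<omega>. 0 \<le> t \<Longrightarrow> \<omega> \<in> space M \<Longrightarrow> G t \<omega> = N (W \<omega> * genera_clock \<nu> \<mu> t) \<omega>"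
    using G unfolding genera_process_def by blast
  have Wm [measurable]: "W \<in> borel_measurable M"
    using distributed_measurable[OF W] by simp
  define q where "q = genera_clock \<nu> \<mu>"
  have Gam: "0 < Gamma (1 + \<nu>)" using nu by (intro Gamma_real_pos) auto
  have q0: "0 \<le> q t" for t using mu Gam by (simp add: q_def genera_clock_def)
  have qpos: "0 < q t" if "0 < t" for t using mu Gam that by (simp add: q_def genera_clock_def)
  have q_le: "q s \<le> q t" if "0 \<le> s" "s \<le> t" for s t
    using mu Gam that nu unfolding q_def genera_clock_def
    by (intro divide_right_mono mult_left_mono powr_mono2) auto
  have q_less: "q s < q t" if "0 \<le> s" "s < t" for s t
    using mu Gam that nu unfolding q_def genera_clock_def
    by (intro divide_strict_right_mono mult_strict_left_mono powr_less_mono2) auto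
  have q_ratio: "q s / q t = (s / t) powr \<nu>" if "0 \<le> s" "0 < t" for s t
    using mu Gam that by (simp add: q_def genera_clock_def powr_divide)
  note G_eq = G_eq[folded q_def]
  show G0: "G 0 \<omega> = 0" if "\<omega> \<in> space M" for \<omega>
    using G_eq[OF order_refl that] poisson_process_paths(2)[OF N that]
    by (simp add: q_def genera_clock_def)
  show G_mono: "mono_on {0..} (\<lambda>t. G t \<omega>)" if "\<omega> \<in> space M" for \<omega>
  proof (rule mono_onI)
    fix s t :: real assume st: "s \<in> {0..}" "t \<in> {0..}" "s \<le> t"
    then have "W \<omega> * q s \<le> W \<omega> * q t" using W0[OF that] q_le by (intro mult_left_mono) auto
    then show "G s \<omega> \<le> G t \<omega>"
      using mono_onD[OF poisson_process_paths(3)[OF N that], of "W \<omega> * q s" "W \<omega> * q t"] st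
        W0[OF that] q0 G_eq[OF _ that] by auto
  qed
  show "eventually (\<lambda>s. G s \<omega> = G t \<omega>) (at_right t)" if \<omega>: "\<omega> \<in> space M" and t: "0 \<le> t" for \<omega> t
  proof -
    have "eventually (\<lambda>s. N (W \<omega> * q s) \<omega> = N (W \<omega> * q t) \<omega>) (at_right t)"
    proof (rule right_constant_compose[where f="\<lambda>s. W \<omega> * q s" and V="\<lambda>v. N v \<omega>"])
      show "eventually (\<lambda>v. N v \<omega> = N (W \<omega> * q t) \<omega>) (at_right (W \<omega> * q t))"
        using W0[OF \<omega>] q0 by (intro poisson_process_paths(4)[OF N \<omega>]) auto
      have "continuous_on {0..} (\<lambda>s. s powr \<nu>)"
        using nu by (intro continuous_on_powr') auto
      then have "((\<lambda>s. s powr \<nu>) \<longlongrightarrow> t powr \<nu>) (at t within {0..})"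
        using t by (simp add: continuous_on_def)
      then have "((\<lambda>s. s powr \<nu>) \<longlongrightarrow> t powr \<nu>) (at_right t)"
        by (rule tendsto_within_subset) (use t in auto)
      then show "((\<lambda>s. W \<omega> * q s) \<longlongrightarrow> W \<omega> * q t) (at_right t)"
        using Gam unfolding q_def genera_clock_def
        by (intro tendsto_mult tendsto_divide tendsto_const) auto
      have "eventually (\<lambda>s. t < s) (at_right t)" by (simp add: eventually_at_right_less)
      then show "eventually (\<lambda>s. W \<omega> * q t \<le> W \<omega> * q s) (at_right t)"
        by eventually_elim (use W0[OF \<omega>] q_le t in \<open>auto intro!: mult_left_mono\<close>)
    qed
    moreover have "eventually (\<lambda>s. t < s) (at_right t)" by (simp add: eventually_at_right_less)
    ultimately show ?thesis by eventually_elim (use G_eq[OF _ \<omega>] t in auto)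
  qed
  have W_ev: "{\<omega>\<in>space M. W \<omega> < a} \<in> sets (vimage_algebra (space M) W borel)" for a
  proof -
    have "W -` {..<a} \<inter> space M \<in> sets (vimage_algebra (space M) W borel)"
      by (rule in_vimage_algebra) simp
    also have "W -` {..<a} \<inter> space M = {\<omega>\<in>space M. W \<omega> < a}" by auto
    finally show ?thesis .
  qed
  interpret PE: sigma_algebra "space M" "process_events M (count_space UNIV) N"
    by (rule process_events_sigma_algebra)
  \<comment> \<open>\<open>W\<close> takes the role of the random time: for fixed \<open>w\<close>
    the event concerns \<open>N\<close> alone, so \<open>prob_at_independent_time\<close> with
    \<open>R = W\<close> expresses the law of \<open>G\<close> at two times as a mixture over
    \<open>w\<close>.\<close>
  let ?Q = "\<lambda>s t j m w \<omega>. N (w * q s) \<omega> = j \<and> N (w * q t) \<omega> = m"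
  let ?g = "\<lambda>s t j m w. prob {\<omega>\<in>space M. ?Q s t j m w \<omega>}"
  have joint: "(\<lambda>\<omega>. ?g s t j m (W \<omega>)) \<in> borel_measurable M \<and>
      {\<omega>\<in>space M. ?Q s t j m (W \<omega>) \<omega>} \<in> events \<and>
      prob {\<omega>\<in>space M. ?Q s t j m (W \<omega>) \<omega>} = (\<integral>\<omega>. ?g s t j m (W \<omega>) \<partial>M)"
    for s t j m
  proof -
    have ev: "{\<omega>\<in>space M. ?Q s t j m w \<omega>} \<in> process_events M (count_space UNIV) N" if "0 \<le> w" for w
    proof -
      have "{\<omega>\<in>space M. N (w * q s) \<omega> = j} \<in> process_events M (count_space UNIV) N"
        "{\<omega>\<in>space M. N (w * q t) \<omega> = m} \<in> process_events M (count_space UNIV) N"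
        using that q0 by (intro process_events_Collect[where P="\<lambda>x. x = _"]; simp)+
      then have "{\<omega>\<in>space M. N (w * q s) \<omega> = j} \<inter> {\<omega>\<in>space M. N (w * q t) \<omega> = m}
        \<in> process_events M (count_space UNIV) N" by (rule PE.Int)
      also have "{\<omega>\<in>space M. N (w * q s) \<omega> = j} \<inter> {\<omega>\<in>space M. N (w * q t) \<omega> = m} = {\<omega>\<in>space M. ?Q s t j m w \<omega>}"
        by auto
      finally show ?thesis .
    qed
    have Qm: "{\<omega>\<in>space M. ?Q s t j m w \<omega>} \<in> events" if "0 \<le> w" for w
      using ev[OF that] indep_setD_ev1[OF ind] by auto
    have scale: "eventually (\<lambda>v. N (v * q u) \<omega> = N (w * q u) \<omega>) (at_right w)"
      if "\<omega> \<in> space M" "0 \<le> w" for u w \<omega>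
    proof (rule right_constant_compose[where f="\<lambda>v. v * q u" and V="\<lambda>v. N v \<omega>"])
      show "eventually (\<lambda>v. N v \<omega> = N (w * q u) \<omega>) (at_right (w * q u))"
        using that q0 by (intro poisson_process_paths(4)[OF N that(1)]) auto
      show "((\<lambda>v. v * q u) \<longlongrightarrow> w * q u) (at_right w)" by (intro tendsto_intros)
      have "eventually (\<lambda>s. w < s) (at_right w)" by (simp add: eventually_at_right_less)
      then show "eventually (\<lambda>v. w * q u \<le> v * q u) (at_right w)"
        by eventually_elim (use q0 in \<open>auto intro!: mult_right_mono\<close>)
    qed
    have Qr: "eventually (\<lambda>v. ?Q s t j m v \<omega> = ?Q s t j m w \<omega>) (at_right w)"
      if "\<omega> \<in> space M" "0 \<le> w" for w \<omega>
      using scale[OF that, of s] scale[OF that, of t] by eventually_elim simp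
    have indQ: "prob {\<omega>\<in>space M. ?Q s t j m w \<omega> \<and> W \<omega> < a} =
      prob {\<omega>\<in>space M. ?Q s t j m w \<omega>} * prob {\<omega>\<in>space M. W \<omega> < a}" if "0 \<le> w" "0 < a" for w a
    proof -
      have "{\<omega>\<in>space M. ?Q s t j m w \<omega> \<and> W \<omega> < a} = {\<omega>\<in>space M. ?Q s t j m w \<omega>} \<inter> {\<omega>\<in>space M. W \<omega> < a}"
        by auto
      then show ?thesis using indep_setD[OF ind ev[OF that(1)] W_ev] by simp
    qed
    show ?thesis
      using prob_at_independent_time[where Q="?Q s t j m" and R=W, OF Qm Qr Wm W0 indQ] by blast
  qed
  have joint_int: "integrable M (\<lambda>\<omega>. ?g s t j m (W \<omega>))" for s t j m
    using joint by (intro integrable_const_bound[of _ 1]) auto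
  have GQ: "{\<omega>\<in>space M. G s \<omega> = j \<and> G t \<omega> = m} = {\<omega>\<in>space M. ?Q s t j m (W \<omega>) \<omega>}"
    if "0 \<le> s" "0 \<le> t" for s t j m
    using G_eq that by auto
  have G_ev: "{\<omega>\<in>space M. G t \<omega> = m} \<in> events" if "0 \<le> t" for t m
    using joint[of t m t m] GQ[OF that that, of m m] by simp
  show "(\<Sum>j\<le>m. real j * prob {\<omega>\<in>space M. G s \<omega> = j \<and> G t \<omega> = m}) =
      (s / t) powr \<nu> * real m * prob {\<omega>\<in>space M. G t \<omega> = m}"
    if s: "0 \<le> s" and st: "s \<le> t" and t: "0 < t" for s t m
  proof -
    let ?P = "\<lambda>j. prob {\<omega>\<in>space M. G s \<omega> = j \<and> G t \<omega> = m}"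
    have J_ev: "{\<omega>\<in>space M. G s \<omega> = j \<and> G t \<omega> = m} \<in> events" for j
      using joint GQ[OF s, of t] t by simp
    have total: "(\<Sum>j\<le>m. ?P j) = prob {\<omega>\<in>space M. G t \<omega> = m}"
    proof -
      have "(\<Sum>j\<le>m. ?P j) = prob (\<Union>j\<in>{..m}. {\<omega>\<in>space M. G s \<omega> = j \<and> G t \<omega> = m})"
        using J_ev by (intro finite_measure_finite_Union[symmetric]) (auto simp: disjoint_family_on_def)
      also have "(\<Union>j\<in>{..m}. {\<omega>\<in>space M. G s \<omega> = j \<and> G t \<omega> = m}) = {\<omega>\<in>space M. G t \<omega> = m}"
        using mono_onD[OF G_mono, of _ s t] s st by auto
      finally show ?thesis .
    qed
    \<comment> \<open>\<open>poisson_process_conditional_mean\<close> needs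
      \<open>0 < a < b\<close>. At \<open>s = 0\<close> nothing has been counted, and at
      \<open>s = t\<close> only \<open>j = m\<close> contributes.\<close>
    consider "s = 0" | "s = t" | "0 < s" "s < t" using s st by linarith
    then have "(\<Sum>j\<le>m. real j * ?P j) = (s / t) powr \<nu> * real m * (\<Sum>j\<le>m. ?P j)"
    proof cases
      case 1
      have "real j * ?P j = 0" for j
      proof (cases "j = 0")
        case False
        then have "{\<omega>\<in>space M. G s \<omega> = j \<and> G t \<omega> = m} = {}" using 1 G0 by auto
        then show ?thesis by (simp only: measure_empty mult_zero_right)
      qed simp
      then have "(\<Sum>j\<le>m. real j * ?P j) = 0" by (intro sum.neutral ballI)
      then show ?thesis using 1 by simp
    next
      case 2
      have "real j * ?P j = real m * ?P j" for j
      proof (cases "j = m")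
        case False
        then have "{\<omega>\<in>space M. G s \<omega> = j \<and> G t \<omega> = m} = {}" using 2 by auto
        then show ?thesis by (simp only: measure_empty mult_zero_right)
      qed simp
      then have "(\<Sum>j\<le>m. real j * ?P j) = (\<Sum>j\<le>m. real m * ?P j)" by (intro sum.cong refl)
      then show ?thesis using 2 t by (simp add: sum_distrib_left)
    next
      case 3
      have key: "(\<Sum>j\<le>m. real j * ?g s t j m w) = (s / t) powr \<nu> * real m * (\<Sum>j\<le>m. ?g s t j m w)"
        if "0 \<le> w" for w
      \<comment> \<open>A clock frozen at \<open>0\<close>: both counts are \<open>0\<close>, so the
        identity reduces to \<open>0 = 0\<close>. For positive \<open>w\<close> the factor
        \<open>w\<close> cancels from the clock ratio.\<close>
      proof (cases "w = 0")
        case True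
        then have e: "{\<omega>\<in>space M. ?Q s t j m w \<omega>} = (if j = 0 \<and> m = 0 then space M else {})" for j
          using poisson_process_paths(2)[OF N] by auto
        show ?thesis unfolding e by (cases "m = 0") (auto simp: if_distrib)
      next
        case False
        then have w: "0 < w * q s" "w * q s < w * q t"
          using that qpos[OF 3(1)] q_less[OF s 3(2)] by auto
        have "w * q s / (w * q t) = (s / t) powr \<nu>"
          using False q_ratio[OF s t] by simp
        with poisson_process_conditional_mean[OF N w, of m] show ?thesis by simp
      qed
      have "(\<Sum>j\<le>m. real j * ?P j) = (\<integral>\<omega>. (\<Sum>j\<le>m. real j * ?g s t j m (W \<omega>)) \<partial>M)"
        using joint_int joint GQ[OF s, of t] t by (simp add: Bochner_Integration.integral_sum)
      also have "\<dots> = (\<integral>\<omega>. (s / t) powr \<nu> * real m * (\<Sum>j\<le>m. ?g s t j m (W \<omega>)) \<partial>M)"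
        by (rule Bochner_Integration.integral_cong[OF refl]) (rule key[OF W0])
      also have "\<dots> = (s / t) powr \<nu> * real m * (\<Sum>j\<le>m. ?P j)"
        using joint_int joint GQ[OF s, of t] t by (simp add: Bochner_Integration.integral_sum)
      finally show ?thesis .
    qed
    then show ?thesis unfolding total .
  qed
  \<comment> \<open>Otherwise the mean of \<open>exp (- (W * q t))\<close> would be
    \<open>1\<close>. As the integrand is at most \<open>1\<close> and \<open>q t > 0\<close>, this
    forces \<open>W = 0\<close> almost surely, which a variable with a Lebesgue density cannot
    satisfy.\<close>
  show "0 < prob {\<omega>\<in>space M. 1 \<le> G t \<omega>}" if t: "0 < t" for t
  proof (rule ccontr)
    assume "\<not> 0 < prob {\<omega>\<in>space M. 1 \<le> G t \<omega>}"
    then have "prob {\<omega>\<in>space M. 1 \<le> G t \<omega>} = 0"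
      using measure_nonneg[of M "{\<omega>\<in>space M. 1 \<le> G t \<omega>}"] by linarith
    moreover have "{\<omega>\<in>space M. 1 \<le> G t \<omega>} = space M - {\<omega>\<in>space M. G t \<omega> = 0}" by auto
    ultimately have one: "prob {\<omega>\<in>space M. G t \<omega> = 0} = 1"
      using prob_compl[OF G_ev[of t 0]] t by simp
    have g0: "?g t t 0 0 w = exp (- (w * q t))" if "0 \<le> w" for w
    proof (cases "w = 0")
      case True
      then have "{\<omega>\<in>space M. ?Q t t 0 0 w \<omega>} = space M"
        using poisson_process_paths(2)[OF N] by auto
      then show ?thesis using True by (simp add: prob_space)
    next
      case False
      then have w: "0 < w * q t" using that qpos[OF t] by simp
      have Nm: "N 0 \<in> measurable M (count_space UNIV)" "N (w * q t) \<in> measurable M (count_space UNIV)"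
        using N w unfolding poisson_process_def by auto
      have m: "(\<lambda>\<omega>. N (w * q t) \<omega> - N 0 \<omega>) \<in> measurable M (count_space UNIV)"
        using Nm by measurable
      have "{\<omega>\<in>space M. ?Q t t 0 0 w \<omega>} = (\<lambda>\<omega>. N (w * q t) \<omega> - N 0 \<omega>) -` {0} \<inter> space M"
        using poisson_process_paths(2)[OF N] by auto
      then have "?g t t 0 0 w = measure (distr M (count_space UNIV) (\<lambda>\<omega>. N (w * q t) \<omega> - N 0 \<omega>)) {0}"
        by (simp add: measure_distr[OF m])
      also have "distr M (count_space UNIV) (\<lambda>\<omega>. N (w * q t) \<omega> - N 0 \<omega>) = measure_pmf (poisson_pmf (1 * (w * q t - 0)))"
        using N w unfolding poisson_process_def by blast
      finally show ?thesis using w by (simp add: measure_pmf_single)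
    qed
    have "(\<integral>\<omega>. ?g t t 0 0 (W \<omega>) \<partial>M) = 1"
      using joint[of t 0 t 0] GQ[of t t 0 0] t one by simp
    then have int1: "(\<integral>\<omega>. 1 - ?g t t 0 0 (W \<omega>) \<partial>M) = 0"
      using joint_int[of t 0 t 0] by (simp add: prob_space)
    have "AE \<omega> in M. 1 - ?g t t 0 0 (W \<omega>) = 0"
      using int1 joint_int[of t 0 t 0]
      by (subst integral_nonneg_eq_0_iff_AE[symmetric]) auto
    then have "AE \<omega> in M. W \<omega> = 0"
      using AE_space
    proof eventually_elim
      case (elim \<omega>)
      then show ?case using g0[OF W0[OF elim(2)]] qpos[OF t] by auto
    qed
    moreover have "AE \<omega> in M. W \<omega> \<noteq> 0"
    proof -
      have "AE w in lborel. 0 < ennreal (mixing_density \<nu> w) \<longrightarrow> w \<noteq> 0"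
        using AE_lborel_singleton[of "0 :: real"] by eventually_elim simp
      then show ?thesis by (subst distributed_AE2[OF W]) auto
    qed
    ultimately have "AE \<omega> in M. False" by eventually_elim simp
    then show False by (simp add: AE_False)
  qed
qed

section \<open>The law of the birth time of a uniformly chosen genus\<close>

text \<open>The law of \<open>t * U powr (1 / \<nu>)\<close> for \<open>U\<close> uniform on
  \<open>{0..1}\<close>.\<close>

definition power_law :: "real \<Rightarrow> real \<Rightarrow> real measure" where
  "power_law \<nu> t = density lborel (\<lambda>s. ennreal (indicator {0..t} s * (\<nu> * s powr (\<nu> - 1) / t powr \<nu>)))"

lemma emeasure_power_law:
  fixes \<nu> t b :: real
  assumes nu: "0 < \<nu>" and t: "0 < t" and b: "0 \<le> b" "b \<le> t"
  shows "emeasure (power_law \<nu> t) {..b} = ennreal ((b / t) powr \<nu>)"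
proof -
  \<comment> \<open>The factor \<open>(b - s) powr (1 - 1)\<close>, equal to \<open>1\<close> except
    at \<open>s = b\<close>, brings the integral into the shape of \<open>nn_integral_Beta\<close>
    with second parameter \<open>1\<close>.\<close>
  have "emeasure (power_law \<nu> t) {..b} =
    (\<integral>\<^sup>+s. ennreal (\<nu> / t powr \<nu>) * ennreal (indicator {0..b} s * (s powr (\<nu> - 1) * (b - s) powr (1 - 1))) \<partial>lborel)"
    unfolding power_law_def
  proof (subst emeasure_density)
    have "AE s in lborel. s \<noteq> b" by (rule AE_lborel_singleton)
    then show "(\<integral>\<^sup>+s. ennreal (indicator {0..t} s * (\<nu> * s powr (\<nu> - 1) / t powr \<nu>)) * indicator {..b} s \<partial>lborel) =
      (\<integral>\<^sup>+s. ennreal (\<nu> / t powr \<nu>) * ennreal (indicator {0..b} s * (s powr (\<nu> - 1) * (b - s) powr (1 - 1))) \<partial>lborel)"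
      by (intro nn_integral_cong_AE, eventually_elim)
        (use nu b in \<open>auto simp: indicator_def ennreal_mult'[symmetric] powr_zero_eq_one\<close>)
  qed auto
  also have "\<dots> = ennreal ((b / t) powr \<nu>)"
  proof (cases "b = 0")
    case True
    have "AE s in lborel. s \<noteq> (0 :: real)" by (rule AE_lborel_singleton)
    then have "(\<integral>\<^sup>+s. ennreal (\<nu> / t powr \<nu>) * ennreal (indicator {0..b} s * (s powr (\<nu> - 1) * (b - s) powr (1 - 1))) \<partial>lborel) =
      (\<integral>\<^sup>+s. 0 \<partial>(lborel :: real measure))"
      by (intro nn_integral_cong_AE, eventually_elim) (use True in \<open>auto simp: indicator_def\<close>)
    then show ?thesis using True by simp
  next
    case False
    then have b0: "0 < b" using b by simp
    have G: "0 < Gamma \<nu>" using nu by (rule Gamma_real_pos)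
    have "\<nu> \<notin> \<int>\<^sub>\<le>\<^sub>0" using nu nonpos_Ints_nonpos[of \<nu>] by auto
    then have "Gamma (\<nu> + 1) = \<nu> * Gamma \<nu>" by (rule Gamma_plus1)
    then have "Beta \<nu> 1 = 1 / \<nu>" using G by (simp add: Beta_def)
    then have val: "b powr (\<nu> + 1 - 1) * Beta \<nu> 1 = b powr \<nu> / \<nu>" by simp
    have "(\<integral>\<^sup>+s. ennreal (\<nu> / t powr \<nu>) * ennreal (indicator {0..b} s * (s powr (\<nu> - 1) * (b - s) powr (1 - 1))) \<partial>lborel) =
      ennreal (\<nu> / t powr \<nu>) * ennreal (b powr \<nu> / \<nu>)"
      unfolding nn_integral_Beta[OF nu zero_less_one b0, unfolded val, symmetric]
      by (rule nn_integral_cmult) auto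
    also have "\<dots> = ennreal ((b / t) powr \<nu>)"
      using nu b0 t by (simp add: ennreal_mult'[symmetric] powr_divide)
    finally show ?thesis .
  qed
  finally show ?thesis .
qed

lemma prob_space_power_law:
  assumes nu: "0 < \<nu>" and t: "0 < t"
  shows "prob_space (power_law \<nu> t)"
proof (rule prob_spaceI)
  have "emeasure (power_law \<nu> t) (space (power_law \<nu> t)) = emeasure (power_law \<nu> t) {..t}"
    unfolding power_law_def
    by (subst (1 2) emeasure_density) (auto simp: indicator_def intro!: nn_integral_cong)
  also have "\<dots> = 1" using emeasure_power_law[OF nu t, of t] t by simp
  finally show "emeasure (power_law \<nu> t) (space (power_law \<nu> t)) = 1" .
qed

lemma (in prob_space) distr_eq_power_law:
  assumes nu: "0 < \<nu>" and t: "0 < t" and T [measurable]: "T \<in> borel_measurable M"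
    and range: "\<And>\<omega>. \<omega> \<in> space M \<Longrightarrow> 0 \<le> T \<omega> \<and> T \<omega> \<le> t"
    and cdf_T: "\<And>b. 0 \<le> b \<Longrightarrow> b < t \<Longrightarrow> prob {\<omega>\<in>space M. T \<omega> \<le> b} = (b / t) powr \<nu>"
  shows "distr M borel T = power_law \<nu> t"
proof (rule cdf_unique)
  show "real_distribution (distr M borel T)" by (rule real_distribution_distr[OF T])
  interpret P: prob_space "power_law \<nu> t" by (rule prob_space_power_law[OF nu t])
  have sets_P: "sets (power_law \<nu> t) = sets borel" by (simp add: power_law_def)
  show "real_distribution (power_law \<nu> t)"
    by (intro real_distribution.intro real_distribution_axioms.intro P.prob_space_axioms)
      (simp_all add: power_law_def)
  show "cdf (distr M borel T) = cdf (power_law \<nu> t)"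
  proof
    fix b
    have left: "cdf (distr M borel T) b = prob {\<omega>\<in>space M. T \<omega> \<le> b}"
      unfolding cdf_def by (subst measure_distr) (auto intro!: arg_cong[where f=prob])
    consider "b < 0" | "0 \<le> b" "b < t" | "t \<le> b" by linarith
    then show "cdf (distr M borel T) b = cdf (power_law \<nu> t) b"
    proof cases
      case 1
      then have "{\<omega>\<in>space M. T \<omega> \<le> b} = {}" using range by force
      then have "cdf (distr M borel T) b = 0" unfolding left by (simp only: measure_empty)
      moreover have "measure (power_law \<nu> t) {..b} \<le> measure (power_law \<nu> t) {..0}"
        using 1 by (intro P.finite_measure_mono) (auto simp: sets_P)
      then have "measure (power_law \<nu> t) {..b} \<le> 0"
        using emeasure_power_law[OF nu t, of 0] t by (simp add: measure_def)
      ultimately show ?thesis by (simp add: cdf_def measure_le_0_iff)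
    next
      case 2
      then show ?thesis
        unfolding left using emeasure_power_law[OF nu t, of b] cdf_T[of b]
        by (simp add: cdf_def measure_def)
    next
      case 3
      then have e: "{\<omega>\<in>space M. T \<omega> \<le> b} = space M" using range by (auto intro: order_trans)
      have "measure (power_law \<nu> t) {..t} \<le> measure (power_law \<nu> t) {..b}"
        using 3 by (intro P.finite_measure_mono) (auto simp: sets_P)
      then have "1 \<le> measure (power_law \<nu> t) {..b}"
        using emeasure_power_law[OF nu t, of t] t by (simp add: measure_def)
      then show ?thesis unfolding left e using P.prob_le_1[of "{..b}"] by (simp add: cdf_def prob_space)
    qed
  qed
qed

text \<open>The convolution divided by the mass \<open>t powr \<nu> / \<nu>\<close>; the prefactor
  of the final formula arises here as
  \<open>\<nu> * Gamma \<nu> = Gamma (\<nu> + 1)\<close>.\<close>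

lemma integral_power_law_mittag_leffler:
  fixes \<nu> \<beta> \<theta> t :: real
  assumes nu: "0 < \<nu>" and b: "0 < \<beta>" and t: "0 < t"
  shows "has_bochner_integral (power_law \<nu> t) (\<lambda>s. mittag_leffler \<beta> 1 (\<theta> * (t - s) powr \<beta>))
    (Gamma (\<nu> + 1) * mittag_leffler \<beta> (\<nu> + 1) (\<theta> * t powr \<beta>))"
proof -
  have meas: "mittag_leffler \<beta> 1 \<in> borel_measurable borel"
    using b by (intro mittag_leffler_measurable) auto
  have m: "(\<lambda>s. mittag_leffler \<beta> 1 (\<theta> * (t - s) powr \<beta>)) \<in> borel_measurable lborel"
    by (intro measurable_compose[OF _ meas]) auto
  have "Gamma (\<nu> + 1) = \<nu> * Gamma \<nu>"
    using nu nonpos_Ints_nonpos[of \<nu>] by (intro Gamma_plus1) auto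
  then have val: "\<nu> / t powr \<nu> * (Gamma \<nu> * t powr \<nu> * mittag_leffler \<beta> (\<nu> + 1) (\<theta> * t powr \<beta>)) =
    Gamma (\<nu> + 1) * mittag_leffler \<beta> (\<nu> + 1) (\<theta> * t powr \<beta>)"
    using t by simp
  have "has_bochner_integral lborel (\<lambda>s. \<nu> / t powr \<nu> *
      (indicator {0..t} s * (s powr (\<nu> - 1) * mittag_leffler \<beta> 1 (\<theta> * (t - s) powr \<beta>))))
    (Gamma (\<nu> + 1) * mittag_leffler \<beta> (\<nu> + 1) (\<theta> * t powr \<beta>))"
    unfolding val[symmetric]
    by (rule has_bochner_integral_mult_right) (rule mittag_leffler_Beta_convolution[OF nu b t])
  then have "has_bochner_integral lborel (\<lambda>s. (indicator {0..t} s * (\<nu> * s powr (\<nu> - 1) / t powr \<nu>)) *\<^sub>R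
      mittag_leffler \<beta> 1 (\<theta> * (t - s) powr \<beta>))
    (Gamma (\<nu> + 1) * mittag_leffler \<beta> (\<nu> + 1) (\<theta> * t powr \<beta>))"
    by (simp add: mult_ac)
  then show ?thesis
    unfolding power_law_def
    by (intro has_bochner_integral_density) (use nu m in auto)
qed

section \<open>A uniformly chosen genus\<close>

lemma measurable_process:
  assumes sub: "process_events M (count_space UNIV) X \<subseteq> sets M" and t: "0 \<le> t"
  shows "X t \<in> measurable M (count_space UNIV)"
proof (rule measurableI)
  fix A :: "'b set"
  have "{\<omega>\<in>space M. X t \<omega> \<in> A} \<in> process_events M (count_space UNIV) X"
    using t by (intro process_events_Collect[where P="\<lambda>x. x \<in> A"]) auto
  moreover have "X t -` A \<inter> space M = {\<omega>\<in>space M. X t \<omega> \<in> A}" by auto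
  ultimately show "X t -` A \<inter> space M \<in> sets M" using sub by auto
qed simp

text \<open>A path below level \<open>i\<close> at \<open>b\<close> stays there on some interval to
  the right of \<open>b\<close>, so the infimum exceeds \<open>b\<close> strictly. That
  \<open>i \<le> G t \<omega>\<close> keeps the set in the infimum nonempty.\<close>

lemma passage_time_greater_iff:
  assumes mono: "mono_on {0..} (\<lambda>t. G t \<omega>)"
    and right: "eventually (\<lambda>s. G s \<omega> = G b \<omega>) (at_right b)"
    and b: "0 \<le> b" and t: "0 \<le> t" "i \<le> G t \<omega>"
  shows "b < passage_time G i \<omega> \<longleftrightarrow> G b \<omega> < i"
proof
  let ?S = "{s. 0 \<le> s \<and> i \<le> G s \<omega>}"
  have bdd: "bdd_below ?S" by (rule bdd_belowI[of _ 0]) auto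
  show "G b \<omega> < i" if "b < passage_time G i \<omega>"
  proof (rule ccontr)
    assume "\<not> G b \<omega> < i"
    then have "passage_time G i \<omega> \<le> b"
      unfolding passage_time_def using b bdd by (intro cInf_lower) auto
    with that show False by simp
  qed
  assume less: "G b \<omega> < i"
  obtain c where c: "b < c" "\<And>s. b < s \<Longrightarrow> s < c \<Longrightarrow> G s \<omega> = G b \<omega>"
    using right by (auto simp: eventually_at_right_field)
  have "c \<le> passage_time G i \<omega>"
    unfolding passage_time_def
  proof (rule cInf_greatest)
    show "?S \<noteq> {}" using t by auto
    fix s assume s: "s \<in> ?S"
    show "c \<le> s"
    proof (rule ccontr)
      assume "\<not> c \<le> s"
      then have "G s \<omega> \<le> G b \<omega>"
        using c(2)[of s] mono_onD[OF mono, of s b] s b by (cases "b < s") auto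
      with less s show False by simp
    qed
  qed
  with c(1) show "b < passage_time G i \<omega>" by simp
qed

lemma passage_time_bounds:
  assumes t: "0 \<le> t" "i \<le> G t \<omega>"
  shows "0 \<le> passage_time G i \<omega>" and "passage_time G i \<omega> \<le> t"
  unfolding passage_time_def using t
  by (auto intro!: cInf_greatest cInf_lower bdd_belowI[of _ 0])

context prob_space
begin

lemma uniform_index_prob:
  assumes J: "uniform_index M \<A> n J" and n: "n \<in> measurable M (count_space UNIV)"
    and i: "i \<in> {1..m}" and A: "A \<in> \<A>"
  shows "prob {\<omega>\<in>space M. J \<omega> = i \<and> \<omega> \<in> A \<and> n \<omega> = m} = 1 / real m * prob {\<omega>\<in>space M. \<omega> \<in> A \<and> n \<omega> = m}"
proof -
  note [measurable] = n
  let ?B = "{\<omega>\<in>space M. n \<omega> = m}"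
  have B: "?B \<in> events" by measurable
  from i have "1 \<le> m" by simp
  then have eq: "\<P>(\<omega> in M. J \<omega> = i \<and> \<omega> \<in> A \<bar> n \<omega> = m) = 1 / real m * \<P>(\<omega> in M. \<omega> \<in> A \<bar> n \<omega> = m)"
    using J i A unfolding uniform_index_def by blast
  show ?thesis
  \<comment> \<open>Conditioning on a null event divides by zero and yields \<open>0 = 0\<close>;
    there both probabilities vanish by monotonicity instead.\<close>
  proof (cases "prob ?B = 0")
    case True
    have "prob {\<omega>\<in>space M. J \<omega> = i \<and> \<omega> \<in> A \<and> n \<omega> = m} \<le> prob ?B"
      "prob {\<omega>\<in>space M. \<omega> \<in> A \<and> n \<omega> = m} \<le> prob ?B"
      using B by (auto intro!: finite_measure_mono)
    then show ?thesis using True by (simp add: measure_le_0_iff)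
  next
    case False
    then show ?thesis using eq by (simp add: cond_prob_def conj_assoc field_simps)
  qed
qed

text \<open>Splitting by the values of \<open>n\<close> and \<open>J\<close> replaces the random
  index by an average over \<open>i\<close>, with a family of events that may depend on
  \<open>i\<close>. The shift to \<open>Suc m\<close> leaves out \<open>n = 0\<close>, where no
  index is drawn.\<close>

lemma uniform_index_sums:
  fixes A :: "nat \<Rightarrow> 'a set"
  assumes J: "uniform_index M \<A> n J" and n: "n \<in> measurable M (count_space UNIV)"
    and \<A>: "\<A> \<subseteq> events" and A: "\<And>i. 1 \<le> i \<Longrightarrow> A i \<in> \<A>"
  shows "{\<omega>\<in>space M. 1 \<le> n \<omega> \<and> \<omega> \<in> A (J \<omega>)} \<in> events"
    and "(\<lambda>m. 1 / real (Suc m) * (\<Sum>i=1..Suc m. prob {\<omega>\<in>space M. \<omega> \<in> A i \<and> n \<omega> = Suc m}))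
      sums prob {\<omega>\<in>space M. 1 \<le> n \<omega> \<and> \<omega> \<in> A (J \<omega>)}"
proof -
  note [measurable] = n
  have Jm [measurable]: "J \<in> measurable M (count_space UNIV)"
    using J unfolding uniform_index_def by auto
  have Jr: "J \<omega> \<in> {1..n \<omega>}" if "\<omega> \<in> space M" "1 \<le> n \<omega>" for \<omega>
    using J that unfolding uniform_index_def by auto
  let ?C = "\<lambda>m i. {\<omega>\<in>space M. J \<omega> = i \<and> \<omega> \<in> A i \<and> n \<omega> = Suc m}"
  have C: "?C m i \<in> events" if "i \<in> {1..Suc m}" for m i
  proof -
    have "A i \<in> events" using A[of i] \<A> that by auto
    then have "A i \<inter> {\<omega>\<in>space M. J \<omega> = i \<and> n \<omega> = Suc m} \<in> events" by measurable
    also have "A i \<inter> {\<omega>\<in>space M. J \<omega> = i \<and> n \<omega> = Suc m} = ?C m i" by auto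
    finally show ?thesis .
  qed
  have eq: "{\<omega>\<in>space M. 1 \<le> n \<omega> \<and> \<omega> \<in> A (J \<omega>)} = (\<Union>m. \<Union>i\<in>{1..Suc m}. ?C m i)"
  proof (intro set_eqI iffI)
    fix \<omega> assume "\<omega> \<in> {\<omega>\<in>space M. 1 \<le> n \<omega> \<and> \<omega> \<in> A (J \<omega>)}"
    then show "\<omega> \<in> (\<Union>m. \<Union>i\<in>{1..Suc m}. ?C m i)"
      using Jr[of \<omega>] by (auto intro!: exI[of _ "n \<omega> - 1"])
  qed auto
  have U: "(\<Union>i\<in>{1..Suc m}. ?C m i) \<in> events" for m
    using C by (intro sets.finite_UN) auto
  then show "{\<omega>\<in>space M. 1 \<le> n \<omega> \<and> \<omega> \<in> A (J \<omega>)} \<in> events"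
    unfolding eq by (intro sets.countable_UN) auto
  have "(\<lambda>m. prob (\<Union>i\<in>{1..Suc m}. ?C m i)) sums prob {\<omega>\<in>space M. 1 \<le> n \<omega> \<and> \<omega> \<in> A (J \<omega>)}"
    unfolding eq using U by (intro finite_measure_UNION) (auto simp: disjoint_family_on_def)
  moreover have "prob (\<Union>i\<in>{1..Suc m}. ?C m i) =
    1 / real (Suc m) * (\<Sum>i=1..Suc m. prob {\<omega>\<in>space M. \<omega> \<in> A i \<and> n \<omega> = Suc m})" for m
  proof -
    have "prob (\<Union>i\<in>{1..Suc m}. ?C m i) = (\<Sum>i\<in>{1..Suc m}. prob (?C m i))"
      using C by (intro finite_measure_finite_Union) (auto simp: disjoint_family_on_def)
    also have "\<dots> = (\<Sum>i\<in>{1..Suc m}. 1 / real (Suc m) * prob {\<omega>\<in>space M. \<omega> \<in> A i \<and> n \<omega> = Suc m})"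
      by (intro sum.cong refl uniform_index_prob[OF J n] A) auto
    finally show ?thesis by (simp only: sum_distrib_left)
  qed
  ultimately show "(\<lambda>m. 1 / real (Suc m) * (\<Sum>i=1..Suc m. prob {\<omega>\<in>space M. \<omega> \<in> A i \<and> n \<omega> = Suc m}))
      sums prob {\<omega>\<in>space M. 1 \<le> n \<omega> \<and> \<omega> \<in> A (J \<omega>)}" by simp
qed

text \<open>\<open>X\<close> equals the number of \<open>i\<close> with
  \<open>1 \<le> i \<le> X\<close>. This turns the average over the uniform index into a mean of
  \<open>G c\<close>.\<close>

lemma sum_prob_le_eq_expectation:
  fixes X n :: "'a \<Rightarrow> nat"
  assumes X: "X \<in> measurable M (count_space UNIV)" and n: "n \<in> measurable M (count_space UNIV)"
    and le: "\<And>\<omega>. \<omega> \<in> space M \<Longrightarrow> X \<omega> \<le> n \<omega>"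
  shows "(\<Sum>i=1..m. prob {\<omega>\<in>space M. i \<le> X \<omega> \<and> n \<omega> = m}) =
    (\<Sum>j\<le>m. real j * prob {\<omega>\<in>space M. X \<omega> = j \<and> n \<omega> = m})"
proof -
  note [measurable] = X n
  let ?P = "\<lambda>j. prob {\<omega>\<in>space M. X \<omega> = j \<and> n \<omega> = m}"
  have "prob {\<omega>\<in>space M. i \<le> X \<omega> \<and> n \<omega> = m} = (\<Sum>j\<le>m. if i \<le> j then ?P j else 0)" for i
  proof -
    have "{\<omega>\<in>space M. i \<le> X \<omega> \<and> n \<omega> = m} = (\<Union>j\<in>{i..m}. {\<omega>\<in>space M. X \<omega> = j \<and> n \<omega> = m})"
      using le by auto
    also have "prob \<dots> = (\<Sum>j\<in>{i..m}. ?P j)"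
      by (intro finite_measure_finite_Union) (auto simp: disjoint_family_on_def)
    also have "\<dots> = (\<Sum>j\<le>m. if i \<le> j then ?P j else 0)"
      by (subst sum.inter_filter[symmetric]) (auto intro!: sum.cong)
    finally show ?thesis .
  qed
  then have "(\<Sum>i=1..m. prob {\<omega>\<in>space M. i \<le> X \<omega> \<and> n \<omega> = m}) =
    (\<Sum>i=1..m. \<Sum>j\<le>m. if i \<le> j then ?P j else 0)" by simp
  also have "\<dots> = (\<Sum>j\<le>m. \<Sum>i=1..m. if i \<le> j then ?P j else 0)" by (rule sum.swap)
  also have "\<dots> = (\<Sum>j\<le>m. real j * ?P j)"
  proof (intro sum.cong refl)
    fix j assume "j \<in> {..m}"
    then have "{i \<in> {1..m}. i \<le> j} = {1..j}" by auto
    then show "(\<Sum>i=1..m. if i \<le> j then ?P j else 0) = real j * ?P j"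
      by (subst sum.inter_filter[symmetric]) auto
  qed
  finally show ?thesis .
qed

end

section \<open>The generalized Yule model\<close>

theorem mainTheorem3:
  fixes M :: "'a measure"
    and \<nu> \<beta> \<mu> l t :: real
    and G :: "real \<Rightarrow> 'a \<Rightarrow> nat"
    and X :: "nat \<Rightarrow> real \<Rightarrow> 'a \<Rightarrow> nat"
    and J :: "'a \<Rightarrow> nat"
    and k :: nat
  assumes "prob_space M"
    and "0 < \<nu>" "\<nu> < 1" "0 < \<beta>" "\<beta> < 1" "0 < l" "0 < \<mu>"
    and "yule_model M \<nu> \<mu> \<beta> l G X"
    and "0 < t"
    and "uniform_index M (yule_events M G X) (G t) J"
    and "1 \<le> k"
  shows "\<P>(\<omega> in M. species_in_genus G X t (J \<omega>) \<omega> = k \<bar> 1 \<le> G t \<omega>) =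
    Gamma (\<nu> + 1) *
      (\<Sum>j=1..k. real ((k - 1) choose (j - 1)) * (-1) ^ (j - 1) *
         mittag_leffler \<beta> (\<nu> + 1) (- l * real j * t powr \<beta>))"
proof -
  interpret prob_space M by fact
  note nu = \<open>0 < \<nu>\<close> and b = \<open>0 < \<beta>\<close> \<open>\<beta> < 1\<close> and l = \<open>0 < l\<close> and mu = \<open>0 < \<mu>\<close> and t = \<open>0 < t\<close>
  note J = \<open>uniform_index M (yule_events M G X) (G t) J\<close>
  have G: "genera_process M \<nu> \<mu> G"
    and X: "\<And>i. 1 \<le> i \<Longrightarrow> fractional_birth_process M \<beta> (\<lambda>k. l * real k) (X i)"
    and ind: "indep_sets (\<lambda>i. process_events M (count_space UNIV) (if i = 0 then G else X i)) UNIV"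
    using \<open>yule_model M \<nu> \<mu> \<beta> l G X\<close> unfolding yule_model_def by auto
  let ?PG = "process_events M (count_space UNIV) G"
  let ?PX = "\<lambda>i. process_events M (count_space UNIV) (X i)"
  have sub_all: "process_events M (count_space UNIV) (if i = 0 then G else X i) \<subseteq> events" for i
    using ind unfolding indep_sets_def by blast
  have sub_G: "?PG \<subseteq> events" using sub_all[of 0] by simp
  have sub_X: "?PX i \<subseteq> events" if "1 \<le> i" for i using sub_all[of i] that by simp
  have indep_GX: "prob (A \<inter> E) = prob A * prob E" if "1 \<le> i" "A \<in> ?PX i" "E \<in> ?PG" for i A E
  proof -
    have "prob (\<Inter>j\<in>{0, i}. (if j = 0 then E else A)) = (\<Prod>j\<in>{0, i}. prob (if j = 0 then E else A))"
      by (rule indep_setsD[OF ind]) (use that in auto)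
    then show ?thesis using that(1) by (simp add: Int_commute mult.commute)
  qed
  have Gm: "G s \<in> measurable M (count_space UNIV)" if "0 \<le> s" for s
    by (rule measurable_process[OF sub_G that])
  have Xm: "X i s \<in> measurable M (count_space UNIV)" if "1 \<le> i" "0 \<le> s" for i s
    by (rule measurable_process[OF sub_X[OF that(1)] that(2)])
  have Gtm [measurable]: "G t \<in> measurable M (count_space UNIV)" using Gm t by simp
  have Jm [measurable]: "J \<in> measurable M (count_space UNIV)"
    using J unfolding uniform_index_def by auto
  have Jr: "1 \<le> J \<omega>" "J \<omega> \<le> G t \<omega>" if "\<omega> \<in> space M" "1 \<le> G t \<omega>" for \<omega>
    using J that unfolding uniform_index_def by auto
  have yule_sub: "yule_events M G X \<subseteq> events"
    unfolding yule_events_def by (rule sets.sigma_sets_subset) (use sub_G sub_X in auto)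
  interpret PG: sigma_algebra "space M" ?PG by (rule process_events_sigma_algebra)
  have yule_alg: "sigma_algebra (space M) (yule_events M G X)"
    unfolding yule_events_def
    by (rule sigma_algebra_sigma_sets, rule order_trans[OF _ sets.space_closed]) (use sub_G sub_X in auto)
  interpret YE: sigma_algebra "space M" "yule_events M G X" by (rule yule_alg)
  have G_yule: "E \<in> yule_events M G X" if "E \<in> ?PG" for E
    unfolding yule_events_def using that by (intro sigma_sets.Basic) auto
  have X_yule: "A \<in> yule_events M G X" if "1 \<le> i" "A \<in> ?PX i" for i A
    unfolding yule_events_def using that by (intro sigma_sets.Basic) auto
  have G_event: "{\<omega>\<in>space M. P (G s \<omega>)} \<in> ?PG" if "0 \<le> s" for P s
    by (rule process_events_Collect[OF that]) auto
  have X_event: "{\<omega>\<in>space M. P (X i s \<omega>)} \<in> ?PX i" if "0 \<le> s" for P i s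
    by (rule process_events_Collect[OF that]) auto
  note genera = genera_process[OF nu mu G]
  define p where "p s = (\<Sum>j=1..k. real ((k - 1) choose (j - 1)) * (-1) ^ (j - 1) *
    mittag_leffler \<beta> 1 (- l * real j * s powr \<beta>))" for s
  have X_prob: "prob {\<omega>\<in>space M. X i s \<omega> = k} = p s" if "1 \<le> i" "0 \<le> s" for i s
    unfolding p_def using X_event[OF that(2), of "\<lambda>x. x = k" i] sub_X[OF that(1)]
    by (intro fractional_yule_process(2)[OF l b X[OF that(1)] that(2) \<open>1 \<le> k\<close>]) auto
  have X_right: "eventually (\<lambda>u. X i u \<omega> = X i s \<omega>) (at_right s)"
    if "1 \<le> i" "\<omega> \<in> space M" "0 \<le> s" for i \<omega> s
    by (rule fractional_yule_process(1)[OF l b X[OF that(1)] that(2,3)])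
  let ?B = "{\<omega>\<in>space M. 1 \<le> G t \<omega>}"
  have B [measurable]: "?B \<in> events" by measurable
  have B_pos: "0 < prob ?B" by (rule genera(5)[OF t])
  note sums_J = uniform_index_sums[OF J Gtm yule_sub]
  \<comment> \<open>\<open>G c < J\<close> says that the chosen genus is born after
    \<open>c\<close>. For \<open>J = i\<close> the remaining condition involves \<open>G\<close>
    only and is independent of \<open>X i r\<close>; the factor \<open>p r\<close> is the same for
    every \<open>i\<close> and leaves the sum.\<close>
  have lessJ: "prob {\<omega>\<in>space M. 1 \<le> G t \<omega> \<and> X (J \<omega>) r \<omega> = k \<and> G c \<omega> < J \<omega>} =
      p r * prob {\<omega>\<in>space M. 1 \<le> G t \<omega> \<and> G c \<omega> < J \<omega>}" if r: "0 \<le> r" and c: "0 \<le> c" for r c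
  proof -
    let ?A = "\<lambda>i. {\<omega>\<in>space M. G c \<omega> < i}"
    let ?A' = "\<lambda>i. {\<omega>\<in>space M. X i r \<omega> = k} \<inter> ?A i"
    have A: "?A i \<in> yule_events M G X" for i using G_yule[OF G_event[OF c]] .
    have A': "?A' i \<in> yule_events M G X" if "1 \<le> i" for i
      using A X_yule[OF that X_event[OF r]] by (intro YE.Int)
    have split: "prob {\<omega>\<in>space M. \<omega> \<in> ?A' i \<and> G t \<omega> = m} = p r * prob {\<omega>\<in>space M. \<omega> \<in> ?A i \<and> G t \<omega> = m}"
      if i: "1 \<le> i" for i m
    proof -
      have E: "{\<omega>\<in>space M. G c \<omega> < i} \<inter> {\<omega>\<in>space M. G t \<omega> = m} \<in> ?PG"
        using G_event[OF c] G_event[of t] t by (intro PG.Int) auto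
      have "{\<omega>\<in>space M. \<omega> \<in> ?A' i \<and> G t \<omega> = m} =
        {\<omega>\<in>space M. X i r \<omega> = k} \<inter> ({\<omega>\<in>space M. G c \<omega> < i} \<inter> {\<omega>\<in>space M. G t \<omega> = m})" by auto
      moreover have "{\<omega>\<in>space M. \<omega> \<in> ?A i \<and> G t \<omega> = m} = {\<omega>\<in>space M. G c \<omega> < i} \<inter> {\<omega>\<in>space M. G t \<omega> = m}" by auto
      ultimately show ?thesis
        using indep_GX[OF i X_event[OF r, of "\<lambda>x. x = k"] E] X_prob[OF i r] by simp
    qed
    have s1: "(\<lambda>m. 1 / real (Suc m) * (\<Sum>i=1..Suc m. prob {\<omega>\<in>space M. \<omega> \<in> ?A i \<and> G t \<omega> = Suc m}))
      sums prob {\<omega>\<in>space M. 1 \<le> G t \<omega> \<and> \<omega> \<in> ?A (J \<omega>)}"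
      by (rule sums_J(2)) (rule A)
    have s2: "(\<lambda>m. 1 / real (Suc m) * (\<Sum>i=1..Suc m. prob {\<omega>\<in>space M. \<omega> \<in> ?A' i \<and> G t \<omega> = Suc m}))
      sums prob {\<omega>\<in>space M. 1 \<le> G t \<omega> \<and> \<omega> \<in> ?A' (J \<omega>)}"
      by (rule sums_J(2)) (rule A')
    have "1 / real (Suc m) * (\<Sum>i=1..Suc m. prob {\<omega>\<in>space M. \<omega> \<in> ?A' i \<and> G t \<omega> = Suc m}) =
      p r * (1 / real (Suc m) * (\<Sum>i=1..Suc m. prob {\<omega>\<in>space M. \<omega> \<in> ?A i \<and> G t \<omega> = Suc m}))" for m
    proof -
      have "(\<Sum>i=1..Suc m. prob {\<omega>\<in>space M. \<omega> \<in> ?A' i \<and> G t \<omega> = Suc m}) =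
        (\<Sum>i=1..Suc m. p r * prob {\<omega>\<in>space M. \<omega> \<in> ?A i \<and> G t \<omega> = Suc m})"
        by (intro sum.cong refl split) auto
      then show ?thesis by (simp only: sum_distrib_left[symmetric] mult.left_commute)
    qed
    then have "prob {\<omega>\<in>space M. 1 \<le> G t \<omega> \<and> \<omega> \<in> ?A' (J \<omega>)} = p r * prob {\<omega>\<in>space M. 1 \<le> G t \<omega> \<and> \<omega> \<in> ?A (J \<omega>)}"
      using sums_unique2[OF s2] sums_mult[OF s1, of "p r"] by simp
    moreover have "{\<omega>\<in>space M. 1 \<le> G t \<omega> \<and> \<omega> \<in> ?A' (J \<omega>)} =
        {\<omega>\<in>space M. 1 \<le> G t \<omega> \<and> X (J \<omega>) r \<omega> = k \<and> G c \<omega> < J \<omega>}"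
      and "{\<omega>\<in>space M. 1 \<le> G t \<omega> \<and> \<omega> \<in> ?A (J \<omega>)} = {\<omega>\<in>space M. 1 \<le> G t \<omega> \<and> G c \<omega> < J \<omega>}"
      by auto
    ultimately show ?thesis by simp
  qed
  \<comment> \<open>Summing \<open>i \<le> G c\<close> over the index counts the genera born by
    \<open>c\<close>; the \<open>Suc m\<close> in the mean given by \<open>genera(4)\<close> cancels
    the uniform weight.\<close>
  have birth_cdf: "prob {\<omega>\<in>space M. 1 \<le> G t \<omega> \<and> J \<omega> \<le> G c \<omega>} = (c / t) powr \<nu> * prob ?B"
    if c: "0 \<le> c" "c \<le> t" for c
  proof -
    let ?A = "\<lambda>i. {\<omega>\<in>space M. i \<le> G c \<omega>}"
    have "(\<lambda>m. 1 / real (Suc m) * (\<Sum>i=1..Suc m. prob {\<omega>\<in>space M. \<omega> \<in> ?A i \<and> G t \<omega> = Suc m}))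
      sums prob {\<omega>\<in>space M. 1 \<le> G t \<omega> \<and> \<omega> \<in> ?A (J \<omega>)}"
      by (rule sums_J(2)) (rule G_yule[OF G_event[OF c(1)]])
    moreover have "1 / real (Suc m) * (\<Sum>i=1..Suc m. prob {\<omega>\<in>space M. \<omega> \<in> ?A i \<and> G t \<omega> = Suc m}) =
      (c / t) powr \<nu> * prob {\<omega>\<in>space M. G t \<omega> = Suc m}" for m
    proof -
      have le: "G c \<omega> \<le> G t \<omega>" if "\<omega> \<in> space M" for \<omega>
        using mono_onD[OF genera(2)[OF that], of c t] c by auto
      have "(\<Sum>i=1..Suc m. prob {\<omega>\<in>space M. \<omega> \<in> ?A i \<and> G t \<omega> = Suc m}) =
        (\<Sum>i=1..Suc m. prob {\<omega>\<in>space M. i \<le> G c \<omega> \<and> G t \<omega> = Suc m})"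
        by (intro sum.cong refl arg_cong[where f=prob]) auto
      also have "\<dots> = (\<Sum>j\<le>Suc m. real j * prob {\<omega>\<in>space M. G c \<omega> = j \<and> G t \<omega> = Suc m})"
        by (rule sum_prob_le_eq_expectation[OF Gm[OF c(1)] Gtm le])
      also have "\<dots> = (c / t) powr \<nu> * real (Suc m) * prob {\<omega>\<in>space M. G t \<omega> = Suc m}"
        by (rule genera(4)[OF c t])
      finally show ?thesis by (simp del: of_nat_Suc)
    qed
    ultimately have s1: "(\<lambda>m. (c / t) powr \<nu> * prob {\<omega>\<in>space M. G t \<omega> = Suc m})
      sums prob {\<omega>\<in>space M. 1 \<le> G t \<omega> \<and> \<omega> \<in> ?A (J \<omega>)}" by simp
    have "(\<lambda>m. prob {\<omega>\<in>space M. G t \<omega> = Suc m}) sums prob (\<Union>m. {\<omega>\<in>space M. G t \<omega> = Suc m})"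
      by (intro finite_measure_UNION) (auto simp: disjoint_family_on_def)
    also have "(\<Union>m. {\<omega>\<in>space M. G t \<omega> = Suc m}) = ?B" by (auto dest: Suc_le_D)
    finally have "(\<lambda>m. prob {\<omega>\<in>space M. G t \<omega> = Suc m}) sums prob ?B" .
    from sums_unique2[OF s1 sums_mult[OF this]]
    have "prob {\<omega>\<in>space M. 1 \<le> G t \<omega> \<and> \<omega> \<in> ?A (J \<omega>)} = (c / t) powr \<nu> * prob ?B" .
    moreover have "{\<omega>\<in>space M. 1 \<le> G t \<omega> \<and> \<omega> \<in> ?A (J \<omega>)} = {\<omega>\<in>space M. 1 \<le> G t \<omega> \<and> J \<omega> \<le> G c \<omega>}" by auto
    ultimately show ?thesis by simp
  qed
  \<comment> \<open>The age of the chosen genus at time \<open>t\<close>, with default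
    \<open>0\<close> when no genus exists so that the age is nonnegative for every outcome.\<close>
  define R where "R \<omega> = (if 1 \<le> G t \<omega> then t - passage_time G (J \<omega>) \<omega> else 0)" for \<omega>
  have R_bounds: "0 \<le> R \<omega>" "R \<omega> \<le> t" if "\<omega> \<in> space M" for \<omega>
    using passage_time_bounds[of t "J \<omega>" G \<omega>] Jr[OF that] t by (auto simp: R_def)
  \<comment> \<open>An age below \<open>a\<close> means a birth after \<open>t - a\<close>. For
    \<open>a > t\<close> the truncation at \<open>0\<close> still gives the right answer, since
    \<open>G 0 = 0 < J\<close>.\<close>
  have R_less: "R \<omega> < a \<longleftrightarrow> G (max 0 (t - a)) \<omega> < J \<omega>"
    if \<omega>: "\<omega> \<in> space M" "1 \<le> G t \<omega>" and a: "0 < a" for \<omega> a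
  proof -
    have pt: "c < passage_time G (J \<omega>) \<omega> \<longleftrightarrow> G c \<omega> < J \<omega>" if "0 \<le> c" for c
      using Jr[OF \<omega>] t
      by (intro passage_time_greater_iff[where t=t] genera(2)[OF \<omega>(1)] genera(3)[OF \<omega>(1) that] that) auto
    show ?thesis
    proof (cases "a \<le> t")
      case True
      then show ?thesis using pt[of "t - a"] \<omega> by (auto simp: R_def)
    next
      case False
      then have "G (max 0 (t - a)) \<omega> < J \<omega>" using genera(1)[OF \<omega>(1)] Jr[OF \<omega>] by simp
      moreover have "R \<omega> < a" using R_bounds[OF \<omega>(1)] False by simp
      ultimately show ?thesis by simp
    qed
  qed
  have Rm [measurable]: "R \<in> borel_measurable M"
  proof (rule borel_measurableI_less)
    fix a :: real
    show "{\<omega>\<in>space M. R \<omega> < a} \<in> events"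
    proof (cases "0 < a")
      case True
      have [measurable]: "G (max 0 (t - a)) \<in> measurable M (count_space UNIV)" by (rule Gm) simp
      have "{\<omega>\<in>space M. R \<omega> < a} = {\<omega>\<in>space M. \<not> 1 \<le> G t \<omega> \<or> G (max 0 (t - a)) \<omega> < J \<omega>}"
      proof (intro Collect_cong conj_cong refl)
        fix \<omega> assume "\<omega> \<in> space M"
        then show "R \<omega> < a \<longleftrightarrow> \<not> 1 \<le> G t \<omega> \<or> G (max 0 (t - a)) \<omega> < J \<omega>"
          using R_less[of \<omega> a] True by (cases "1 \<le> G t \<omega>") (auto simp: R_def)
      qed
      also have "\<dots> = (space M - ?B) \<union> {\<omega>\<in>space M. real (G (max 0 (t - a)) \<omega>) < real (J \<omega>)}" by auto
      also have "\<dots> \<in> events" by measurable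
      finally show ?thesis .
    next
      case False
      then have "{\<omega>\<in>space M. R \<omega> < a} = {}" using R_bounds by force
      then show ?thesis by (simp only: sets.empty_sets)
    qed
  qed
  \<comment> \<open>Off the conditioning event \<open>J\<close> may be \<open>0\<close>, and nothing is known about \<open>X 0\<close>.\<close>
  define J' where "J' \<omega> = max 1 (J \<omega>)" for \<omega>
  have J'm [measurable]: "J' \<in> measurable M (count_space UNIV)" unfolding J'_def by measurable
  have J'1: "1 \<le> J' \<omega>" for \<omega> by (simp add: J'_def)
  have J'J: "J' \<omega> = J \<omega>" if "\<omega> \<in> space M" "1 \<le> G t \<omega>" for \<omega>
    using Jr[OF that] by (simp add: J'_def)
  \<comment> \<open>Under the conditional measure the chosen genus is one process with one-time law
    \<open>p\<close>, and its age is an independent time in the sense required by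
    \<open>prob_at_independent_time\<close>.\<close>
  define C where "C = uniform_measure M ?B"
  have B_emeasure: "emeasure M ?B \<noteq> 0" "emeasure M ?B \<noteq> \<infinity>"
    using B_pos by (auto simp: emeasure_eq_measure)
  interpret C: prob_space C
    unfolding C_def by (rule prob_space_uniform_measure[OF B_emeasure])
  have C_sets [measurable_cong]: "sets C = events" and C_space: "space C = space M" by (simp_all add: C_def)
  have C_prob: "C.prob A = prob (?B \<inter> A) / prob ?B" if "A \<in> events" for A
    unfolding C_def using B_emeasure that by simp
  have V_events: "{\<omega>\<in>space M. X (J' \<omega>) r \<omega> = k} \<in> events" if "0 \<le> r" for r
  proof -
    have "{\<omega>\<in>space M. X (J' \<omega>) r \<omega> = k} =
      (\<Union>i\<in>{1..}. {\<omega>\<in>space M. X i r \<omega> = k} \<inter> {\<omega>\<in>space M. J' \<omega> = i})"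
      using J'1 by auto
    also have "\<dots> \<in> events"
    proof (intro sets.countable_UN'' sets.Int)
      show "{\<omega>\<in>space M. X i r \<omega> = k} \<in> events" if "i \<in> {1..}" for i
        using X_event[OF \<open>0 \<le> r\<close>, of "\<lambda>x. x = k" i] sub_X[of i] that by auto
    qed auto
    finally show ?thesis .
  qed
  have C_less: "C.prob {\<omega>\<in>space C. R \<omega> < a} = prob {\<omega>\<in>space M. 1 \<le> G t \<omega> \<and> G (max 0 (t - a)) \<omega> < J \<omega>} / prob ?B"
    if "0 < a" for a
  proof -
    have "{\<omega>\<in>space M. R \<omega> < a} \<in> events" by measurable
    moreover have "?B \<inter> {\<omega>\<in>space M. R \<omega> < a} = {\<omega>\<in>space M. 1 \<le> G t \<omega> \<and> G (max 0 (t - a)) \<omega> < J \<omega>}"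
      using R_less that by auto
    ultimately show ?thesis by (simp add: C_prob C_space)
  qed
  have C_V_less: "C.prob {\<omega>\<in>space C. X (J' \<omega>) r \<omega> = k \<and> R \<omega> < a} = p r * C.prob {\<omega>\<in>space C. R \<omega> < a}"
    if "0 \<le> r" "0 < a" for r a
  proof -
    have "{\<omega>\<in>space M. X (J' \<omega>) r \<omega> = k \<and> R \<omega> < a} = {\<omega>\<in>space M. X (J' \<omega>) r \<omega> = k} \<inter> {\<omega>\<in>space M. R \<omega> < a}" by auto
    also have "\<dots> \<in> events" using V_events[OF that(1)] by (intro sets.Int) auto
    finally have "{\<omega>\<in>space M. X (J' \<omega>) r \<omega> = k \<and> R \<omega> < a} \<in> events" .
    moreover have "?B \<inter> {\<omega>\<in>space M. X (J' \<omega>) r \<omega> = k \<and> R \<omega> < a} =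
      {\<omega>\<in>space M. 1 \<le> G t \<omega> \<and> X (J \<omega>) r \<omega> = k \<and> G (max 0 (t - a)) \<omega> < J \<omega>}"
      using R_less[OF _ _ that(2)] J'J by auto
    ultimately show ?thesis
      unfolding C_less[OF that(2)] using lessJ[OF that(1), of "max 0 (t - a)"]
      by (simp add: C_prob C_space)
  qed
  have C_V: "C.prob {\<omega>\<in>space C. X (J' \<omega>) r \<omega> = k} = p r" if "0 \<le> r" for r
  proof -
    \<comment> \<open>Ages never exceed \<open>t\<close>, so \<open>a = t + 1\<close> removes the
      restriction on \<open>R\<close> and yields the marginal.\<close>
    have "{\<omega>\<in>space C. X (J' \<omega>) r \<omega> = k \<and> R \<omega> < t + 1} = {\<omega>\<in>space C. X (J' \<omega>) r \<omega> = k}"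
      and "{\<omega>\<in>space C. R \<omega> < t + 1} = space C"
      using R_bounds by (force simp: C_space)+
    then show ?thesis using C_V_less[OF that, of "t + 1"] t by (simp add: C.prob_space)
  qed
  have Qm: "{\<omega>\<in>space C. X (J' \<omega>) r \<omega> = k} \<in> C.events" if "0 \<le> r" for r
    using V_events[OF that] by (simp add: C_space C_sets)
  have Qr: "eventually (\<lambda>u. (X (J' \<omega>) u \<omega> = k) = (X (J' \<omega>) r \<omega> = k)) (at_right r)"
    if "\<omega> \<in> space C" "0 \<le> r" for \<omega> r
    using X_right[OF J'1 that(1)[unfolded C_space] that(2), of \<omega>] by eventually_elim simp
  have Rm_C: "C.random_variable borel R" by measurable
  have R0_C: "0 \<le> R \<omega>" if "\<omega> \<in> space C" for \<omega> using R_bounds that by (simp add: C_space)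
  have ind_C: "C.prob {\<omega>\<in>space C. X (J' \<omega>) r \<omega> = k \<and> R \<omega> < a} =
      C.prob {\<omega>\<in>space C. X (J' \<omega>) r \<omega> = k} * C.prob {\<omega>\<in>space C. R \<omega> < a}" if "0 \<le> r" "0 < a" for r a
    using C_V_less[OF that] C_V[OF that(1)] by simp
  note L = C.prob_at_independent_time[where Q="\<lambda>r \<omega>. X (J' \<omega>) r \<omega> = k" and R=R, OF Qm Qr Rm_C R0_C ind_C]
  have species_ev: "{\<omega>\<in>space M. X (J' \<omega>) (R \<omega>) \<omega> = k} \<in> events"
    using L(1) by (simp add: C_space C_sets)
  have "\<P>(\<omega> in M. species_in_genus G X t (J \<omega>) \<omega> = k \<bar> 1 \<le> G t \<omega>) =
    prob (?B \<inter> {\<omega>\<in>space M. X (J' \<omega>) (R \<omega>) \<omega> = k}) / prob ?B"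
  proof -
    have "{\<omega>\<in>space M. species_in_genus G X t (J \<omega>) \<omega> = k \<and> 1 \<le> G t \<omega>} =
      ?B \<inter> {\<omega>\<in>space M. X (J' \<omega>) (R \<omega>) \<omega> = k}"
      using J'J by (auto simp: species_in_genus_def R_def)
    then show ?thesis by (simp add: cond_prob_def)
  qed
  also have "\<dots> = C.prob {\<omega>\<in>space C. X (J' \<omega>) (R \<omega>) \<omega> = k}"
    using species_ev by (simp add: C_prob C_space)
  also have "\<dots> = (\<integral>\<omega>. C.prob {\<omega>'\<in>space C. X (J' \<omega>') (R \<omega>) \<omega>' = k} \<partial>C)"
    by (rule L(3))
  also have "\<dots> = (\<integral>\<omega>. p (R \<omega>) \<partial>C)"
    by (intro Bochner_Integration.integral_cong refl) (simp add: C_V R0_C)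
  \<comment> \<open>From the age to the birth time \<open>t - R\<close>, which is the variable with
    law \<open>power_law \<nu> t\<close>.\<close>
  also have "\<dots> = (\<integral>x. p (t - x) \<partial>distr C borel (\<lambda>\<omega>. t - R \<omega>))"
  proof -
    have "(\<lambda>z. mittag_leffler \<beta> 1 z) \<in> borel_measurable borel"
      using b by (intro mittag_leffler_measurable) auto
    then have "(\<lambda>x. mittag_leffler \<beta> 1 (- l * real j * (t - x) powr \<beta>)) \<in> borel_measurable borel" for j
      by (rule measurable_compose[rotated]) auto
    then have "(\<lambda>x. p (t - x)) \<in> borel_measurable borel"
      unfolding p_def by (intro borel_measurable_sum borel_measurable_times borel_measurable_const)
    then show ?thesis by (subst integral_distr) auto
  qed
  also have "distr C borel (\<lambda>\<omega>. t - R \<omega>) = power_law \<nu> t"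
  proof (rule C.distr_eq_power_law[OF nu t])
    show "0 \<le> t - R \<omega> \<and> t - R \<omega> \<le> t" if "\<omega> \<in> space C" for \<omega>
      using R_bounds[of \<omega>] that by (simp add: C_space)
    show "C.prob {\<omega>\<in>space C. t - R \<omega> \<le> c} = (c / t) powr \<nu>" if c: "0 \<le> c" "c < t" for c
    proof -
      have [measurable]: "G c \<in> measurable M (count_space UNIV)" by (rule Gm[OF c(1)])
      have "{\<omega>\<in>space M. t - R \<omega> \<le> c} \<in> events" by measurable
      moreover have "?B \<inter> {\<omega>\<in>space M. t - R \<omega> \<le> c} = {\<omega>\<in>space M. 1 \<le> G t \<omega> \<and> J \<omega> \<le> G c \<omega>}"
      proof -
        have "t - R \<omega> \<le> c \<longleftrightarrow> J \<omega> \<le> G c \<omega>" if "\<omega> \<in> space M" "1 \<le> G t \<omega>" for \<omega>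
          using R_less[OF that, of "t - c"] c by (auto simp: not_less[symmetric])
        then show ?thesis by auto
      qed
      ultimately show ?thesis
        using birth_cdf[of c] c B_pos by (simp add: C_prob C_space)
    qed
  qed measurable
  also have "(\<integral>x. p (t - x) \<partial>power_law \<nu> t) = (\<Sum>j=1..k. real ((k - 1) choose (j - 1)) * (-1) ^ (j - 1) *
    (Gamma (\<nu> + 1) * mittag_leffler \<beta> (\<nu> + 1) (- l * real j * t powr \<beta>)))"
  proof -
    have "has_bochner_integral (power_law \<nu> t) (\<lambda>x. p (t - x)) (\<Sum>j=1..k. real ((k - 1) choose (j - 1)) * (-1) ^ (j - 1) *
      (Gamma (\<nu> + 1) * mittag_leffler \<beta> (\<nu> + 1) (- l * real j * t powr \<beta>)))"
      unfolding p_def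
      by (intro has_bochner_integral_sum has_bochner_integral_mult_right
          integral_power_law_mittag_leffler[OF nu b(1) t])
    then show ?thesis by (simp only: has_bochner_integral_iff)
  qed
  also have "\<dots> = Gamma (\<nu> + 1) * (\<Sum>j=1..k. real ((k - 1) choose (j - 1)) * (-1) ^ (j - 1) *
    mittag_leffler \<beta> (\<nu> + 1) (- l * real j * t powr \<beta>))"
    by (simp only: sum_distrib_left mult.left_commute)
  finally show ?thesis .
qed

end
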